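(* Let $m\ge2$ and let $(X_t)_{t\in\mathbb{Z}}$ be a real-valued process whose increment process $\Delta_t=X_t-X_{t-1}$ is stationary, such that $\boldsymbol{\Delta}_0=(\Delta_1,\dots,\Delta_{m-1})^\top$ has no ties in the sense that $\mathbb{P}(X_j=X_k)=0$ for $j\ne k$. Suppose $(\Delta_t)$ is a 1-approximating functional, with approximating constants $(a_k)_{k\in\mathbb{N}_0}$, of an absolutely regular process with mixing coefficients $(\beta_k)_{k\in\mathbb{N}_0}$ such that $\sum_{k=0}^\infty k^2(\sqrt{a_k}+\beta_k)<\infty$. Let $\phi$ be a function witnessing the $1$-continuity of the kernel $h$ with respect to the distribution of $\boldsymbol{\Delta}_0$, and assume $$\sum_{k=m-1}^\infty k^2\,\phi\Big(2\sqrt{\textstyle\sum_{i=0}^{m-1}a_{k-i}}\Big)<\infty.$$ Then, as $n\to\infty$, $\sqrt n(\hat{\mathbf p}-\mathbf p)\xrightarrow{d}N(\mathbf 0,\Sigma)$, where $\Sigma=(\sigma_{ij})_{1\le i,j\le m!}$ with $$\sigma_{ij}=p_i(\delta_{ij}-p_j)+\sum_{k=1}^\infty\big(p_{ij}(k)+p_{ji}(k)-2p_ip_j\big),$$ the series converging absolutely.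
   Context: OPs: for $m\ge2$, $S_m$ is the set of permutations of $1,\dots,m$; for $\mathbf{x}\in\mathbb{R}^m$ its OP is the unique $\pi\in S_m$ with $\pi^{(j)}<\pi^{(k)}\iff x_j<x_k$ (or $x_j=x_k$ and $j<k$). The $m!$ OPs are $\pi_1,\dots,\pi_{m!}$ in lexicographic order. $\Pi_{\Delta}(\mathbf{y})$ denotes the OP of $(0,y_1,y_1+y_2,\dots,y_1+\dots+y_{m-1})$ for $\mathbf y\in\mathbb R^{m-1}$, and $h(\mathbf{y})=(\mathbb{1}\{\Pi_{\Delta}(\mathbf{y})=\pi_1\},\dots,\mathbb{1}\{\Pi_{\Delta}(\mathbf{y})=\pi_{m!}\})^\top$. With $\mathbf{X}_t=(X_t,\dots,X_{t+m-1})$ and $\boldsymbol\Delta_t=(\Delta_{t+1},\dots,\Delta_{t+m-1})^\top$, $\Pi_t$ is the OP of $\mathbf X_t$ (equivalently $\Pi_\Delta(\boldsymbol\Delta_t)$); $\mathbf p=(p_1,\dots,p_{m!})$ with $p_i=\mathbb P(\Pi_0=\pi_i)$; $\hat{\mathbf p}=\frac1n\sum_{t=1}^n h(\boldsymbol\Delta_t)$; $p_{ij}(k)=\mathbb P(\Pi_0=\pi_i,\Pi_k=\pi_j)$; $\delta_{ij}$ is the Kronecker delta. Mixing: for a process $(Z_t)$ let $\mathcal A_k^l=\sigma(Z_k,\dots,Z_l)$. It is absolutely regular if $\beta_k=\sup_n\sup\sum_{i=1}^I\sum_{j=1}^J|\mathbb P(A_i\cap B_j)-\mathbb P(A_i)\mathbb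 P(B_j)|\to0$, the inner sup over finite $\mathcal A_1^n$-measurable partitions $(A_i)$ and finite $\mathcal A_{n+k}^\infty$-measurable partitions $(B_j)$. A sequence $(Y_t)$ is a functional of a stationary $(Z_t)$ if $Y_t=f((Z_{t+k})_{k\in\mathbb Z})$ for a measurable $f$; it is a 1-approximating functional with constants $a_k\to0$ if $\mathbb E|Y_0-\mathbb E(Y_0\mid\mathcal A_{-k}^k)|\le a_k$ for all $k\in\mathbb N_0$. A function $h$ is $1$-continuous w.r.t. a distribution $F$ with witness $\phi:(0,\infty)\to(0,\infty)$, $\phi(\varepsilon)\to0$ as $\varepsilon\to0$, if $\mathbb E(\|h(\mathbf Y)-h(\mathbf Y')\|\mathbb 1\{\|\mathbf Y-\mathbf Y'\|\le\varepsilon\})\le\phi(\varepsilon)$ for all $\mathbf Y,\mathbf Y'$ each with distribution $F$ (the value $\phi(0)$ is understood as $\lim$ / the same expression at $\varepsilon=0$). *)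

theory Defs
  imports "HOL-Probability.Probability" "HOL-Combinatorics.Multiset_Permutations"
          "HOL-Library.List_Lexorder"
begin

text \<open>Permutations of 1..m are lists of length m; position j (0-based) holds pi^(j+1).
  The ordinal pattern of x (given on positions 0..m-1) is the unique permutation with
  pi^(j) < pi^(k) iff x_j < x_k or (x_j = x_k and j < k).\<close>

definition ord_pattern :: "nat \<Rightarrow> (nat \<Rightarrow> real) \<Rightarrow> nat list" where
  "ord_pattern m x = (THE \<pi>. \<pi> \<in> permutations_of_set {1..m} \<and>
      (\<forall>j<m. \<forall>k<m. \<pi> ! j < \<pi> ! k \<longleftrightarrow> (x j < x k \<or> (x j = x k \<and> j < k))))"

text \<open>The m! ordinal patterns in lexicographic order; \<open>op_enum m i\<close> is pi_(i+1).\<close>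
definition op_enum :: "nat \<Rightarrow> nat \<Rightarrow> nat list" where
  "op_enum m i = sorted_list_of_set (permutations_of_set {1..m}) ! i"

text \<open>Pi_Delta(y): ordinal pattern of (0, y_1, y_1+y_2, ..., y_1+...+y_(m-1));
  here y is indexed 0..m-2.\<close>
definition op_delta :: "nat \<Rightarrow> (nat \<Rightarrow> real) \<Rightarrow> nat list" where
  "op_delta m y = ord_pattern m (\<lambda>j. \<Sum>l<j. y l)"

text \<open>The kernel h, coordinate i (0-based, i < m!).\<close>
definition h_op :: "nat \<Rightarrow> (nat \<Rightarrow> real) \<Rightarrow> nat \<Rightarrow> real" where
  "h_op m y i = (if op_delta m y = op_enum m i then 1 else 0)"

definition stationary_process :: "'a measure \<Rightarrow> 'b measure \<Rightarrow> (int \<Rightarrow> 'a \<Rightarrow> 'b) \<Rightarrow> bool" where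
  "stationary_process M N Z \<longleftrightarrow> (\<forall>(k::nat) (s::int).
     distr M (PiM {..<k} (\<lambda>_. N)) (\<lambda>\<omega>. \<lambda>i\<in>{..<k}. Z (s + int i) \<omega>) =
     distr M (PiM {..<k} (\<lambda>_. N)) (\<lambda>\<omega>. \<lambda>i\<in>{..<k}. Z (int i) \<omega>))"

definition gen_sigma :: "'a measure \<Rightarrow> 'b measure \<Rightarrow> (int \<Rightarrow> 'a \<Rightarrow> 'b) \<Rightarrow> int set \<Rightarrow> 'a measure" where
  "gen_sigma M N Z I = sigma (space M) (\<Union>i\<in>I. {Z i -` B \<inter> space M | B. B \<in> sets N})"

definition fin_partition :: "'a measure \<Rightarrow> 'a measure \<Rightarrow> nat set \<Rightarrow> (nat \<Rightarrow> 'a set) \<Rightarrow> bool" where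
  "fin_partition M F I A \<longleftrightarrow> finite I \<and> (\<forall>i\<in>I. A i \<in> sets F) \<and> disjoint_family_on A I
     \<and> (\<Union>i\<in>I. A i) = space M"

definition beta_coeff :: "'a measure \<Rightarrow> 'b measure \<Rightarrow> (int \<Rightarrow> 'a \<Rightarrow> 'b) \<Rightarrow> nat \<Rightarrow> real" where
  "beta_coeff M N Z k = (SUP n\<in>{1::int..}. Sup {(\<Sum>i\<in>I. \<Sum>j\<in>J.
        \<bar>measure M (A i \<inter> B j) - measure M (A i) * measure M (B j)\<bar>) | I A J B.
        fin_partition M (gen_sigma M N Z {1..n}) I A \<and>
        fin_partition M (gen_sigma M N Z {n + int k..}) J B})"

definition absolutely_regular :: "'a measure \<Rightarrow> 'b measure \<Rightarrow> (int \<Rightarrow> 'a \<Rightarrow> 'b) \<Rightarrow> bool" where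
  "absolutely_regular M N Z \<longleftrightarrow> beta_coeff M N Z \<longlonglongrightarrow> 0"

definition functional_of :: "'a measure \<Rightarrow> 'b measure \<Rightarrow> (int \<Rightarrow> 'a \<Rightarrow> 'b) \<Rightarrow> (int \<Rightarrow> 'a \<Rightarrow> real) \<Rightarrow> bool" where
  "functional_of M N Z Y \<longleftrightarrow> stationary_process M N Z \<and> (\<forall>t. Z t \<in> measurable M N) \<and>
     (\<exists>f \<in> borel_measurable (PiM UNIV (\<lambda>_::int. N)).
        \<forall>t. \<forall>\<omega>\<in>space M. Y t \<omega> = f (\<lambda>k. Z (t + k) \<omega>))"

definition one_approx_functional :: "'a measure \<Rightarrow> 'b measure \<Rightarrow> (int \<Rightarrow> 'a \<Rightarrow> 'b) \<Rightarrow>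
    (int \<Rightarrow> 'a \<Rightarrow> real) \<Rightarrow> (nat \<Rightarrow> real) \<Rightarrow> bool" where
  "one_approx_functional M N Z Y a \<longleftrightarrow> functional_of M N Z Y \<and> integrable M (Y 0) \<and>
     a \<longlonglongrightarrow> 0 \<and>
     (\<forall>k::nat. (\<integral>\<omega>. \<bar>Y 0 \<omega> - real_cond_exp M (gen_sigma M N Z {- int k..int k}) (Y 0) \<omega>\<bar> \<partial>M) \<le> a k)"

definition vnorm :: "nat \<Rightarrow> (nat \<Rightarrow> real) \<Rightarrow> real" where
  "vnorm d y = sqrt (\<Sum>i<d. (y i)\<^sup>2)"

text \<open>h (of dimension m!) is 1-continuous w.r.t. the distribution F on R^(m-1) with witness phi.
  The expectation over Y, Y' with law F is taken w.r.t. their joint law mu, which is an arbitrary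
  probability measure on R^(m-1) x R^(m-1) with both marginals equal to F.  phi(0) = 0 is the
  stated convention for the value at 0.\<close>
definition one_continuous :: "nat \<Rightarrow> (nat \<Rightarrow> real) measure \<Rightarrow> (real \<Rightarrow> real) \<Rightarrow> bool" where
  "one_continuous m F \<phi> \<longleftrightarrow>
     (\<forall>\<epsilon>>0. \<phi> \<epsilon> > 0) \<and> (\<phi> \<longlongrightarrow> 0) (at_right 0) \<and> \<phi> 0 = 0 \<and>
     (\<forall>\<mu> \<epsilon>. \<epsilon> > 0 \<longrightarrow> prob_space \<mu> \<longrightarrow>
        sets \<mu> = sets (PiM {..<m-1} (\<lambda>_. borel) \<Otimes>\<^sub>M PiM {..<m-1} (\<lambda>_. borel)) \<longrightarrow>
        distr \<mu> (PiM {..<m-1} (\<lambda>_. borel)) fst = F \<longrightarrow>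
        distr \<mu> (PiM {..<m-1} (\<lambda>_. borel)) snd = F \<longrightarrow>
        (\<integral>z. vnorm (fact m) (\<lambda>i. h_op m (fst z) i - h_op m (snd z) i) *
              indicator {z. vnorm (m-1) (\<lambda>i. fst z i - snd z i) \<le> \<epsilon>} z \<partial>\<mu>) \<le> \<phi> \<epsilon>)"

definition gaussian_measure :: "(real^'k) measure \<Rightarrow> ('k::finite \<Rightarrow> 'k \<Rightarrow> real) \<Rightarrow> bool" where
  "gaussian_measure G S \<longleftrightarrow> prob_space G \<and> sets G = sets borel \<and>
     (\<forall>t::real^'k. (\<integral>x. cis (t \<bullet> x) \<partial>G) =
        complex_of_real (exp (- (\<Sum>i\<in>UNIV. \<Sum>j\<in>UNIV. t$i * t$j * S i j) / 2)))"

definition converges_in_distr_normal :: "'a measure \<Rightarrow> (nat \<Rightarrow> 'a \<Rightarrow> real^'k) \<Rightarrow>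
    ('k::finite \<Rightarrow> 'k \<Rightarrow> real) \<Rightarrow> bool" where
  "converges_in_distr_normal M Y S \<longleftrightarrow> (\<exists>G. gaussian_measure G S \<and>
     (\<forall>g :: real^'k \<Rightarrow> real. continuous_on UNIV g \<longrightarrow> bounded (range g) \<longrightarrow>
        (\<lambda>n. \<integral>\<omega>. g (Y n \<omega>) \<partial>M) \<longlonglongrightarrow> (\<integral>x. g x \<partial>G)))"

end

theory Submission
  imports Defs "HOL-Real_Asymp.Real_Asymp"
begin

text \<open>
  Each coordinate of the kernel is first approximated by a function of finitely many \<open>Z\<^sub>t\<close>.
  The conditional expectations of the increments given a window of \<open>Z\<close> are discretised on a grid;
  two copies of the increments that are conditionally independent given the grid cell are close in
  \<open>L\<^sup>1\<close> and both have the law of the increments, so 1-continuity bounds the distance of the kernel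
  to its cell average. The summability assumptions turn into error and mixing rates \<open>O(k\<^sup>-\<^sup>3)\<close>.

  For a linear combination of the centred coordinates, Bernstein blocking with big blocks of length
  about \<open>n powr 0.45\<close> separated by gaps of order \<open>n powr 0.4\<close> gives the limit of the characteristic
  function: the third absolute moment of a block of length \<open>p\<close> is \<open>O(p)\<close> times its second moment,
  hence \<open>O(p\<^sup>2)\<close>, and mixing makes the block factors nearly multiplicative. Characteristic functions
  and bounded second moments yield weak convergence, because bounded continuous functions are
  approximated on compact sets by uniformly bounded trigonometric polynomials.
\<close>

section \<open>Weak convergence from characteristic functions\<close>

text \<open>1-continuity compares the kernel at two vectors only if both have exactly the law of the
  increments. A conditional expectation of the increments has another law, so the kernel cannot be
  compared with its value there; hence the approximant is an average of the kernel over a cell,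
  controlled by a coupling whose two marginals are both the original law. Let A be the sum of
  a_(k-j) over 0 <= j <= m-1. Markov's inequality at the threshold 2 sqrt(A) gives the error phi(2
  sqrt(A)) + O(sqrt(A)), which is where the two summability assumptions come from.

  Mixing is postulated only for index sets inside the positive integers, while windows extend to
  both sides of a time point. This explains the recurring offsets \<open>l + 1\<close>, which
  stationarity makes harmless.

  \<open>converges_in_distr_normal\<close> asks for the limit as a measure. Positive
  semidefiniteness of the covariance is obtained from limits of variances, and the Gaussian measure
  is then built from independent standard normals.\<close>

inductive trig_poly :: "('a::euclidean_space \<Rightarrow> real) \<Rightarrow> bool" where
  cos: "trig_poly (\<lambda>x. cos (t \<bullet> x))"
| sin: "trig_poly (\<lambda>x. sin (t \<bullet> x))"
| add: "trig_poly f \<Longrightarrow> trig_poly g \<Longrightarrow> trig_poly (\<lambda>x. f x + g x)"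
| scale: "trig_poly f \<Longrightarrow> trig_poly (\<lambda>x. c * f x)"

lemma trig_poly_const: "trig_poly (\<lambda>x::'a::euclidean_space. c)"
  using trig_poly.scale[OF trig_poly.cos[of "0::'a"], of c] by simp

lemma trig_poly_diff:
  assumes "trig_poly f" "trig_poly g" shows "trig_poly (\<lambda>x. f x - g x)"
  using trig_poly.add[OF assms(1) trig_poly.scale[OF assms(2), of "-1"]] by simp

text \<open>Stone-Weierstrass needs an algebra, whereas \<open>trig_poly\<close> is generated as a
  linear span. The product-to-sum identities show that products of the generators stay in the
  span.\<close>

lemma trig_poly_mult_basic:
  assumes "trig_poly g"
  shows "trig_poly (\<lambda>x. cos (t \<bullet> x) * g x)" "trig_poly (\<lambda>x. sin (t \<bullet> x) * g x)"
  using assms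
proof (induction rule: trig_poly.induct)
  case (cos s)
  have "(\<lambda>x. cos (t \<bullet> x) * cos (s \<bullet> x)) = (\<lambda>x. (1/2) * (cos ((t - s) \<bullet> x) + cos ((t + s) \<bullet> x)))"
    by (simp add: cos_times_cos inner_diff_left inner_add_left fun_eq_iff)
  moreover have "(\<lambda>x. sin (t \<bullet> x) * cos (s \<bullet> x)) = (\<lambda>x. (1/2) * (sin ((t + s) \<bullet> x) + sin ((t - s) \<bullet> x)))"
    by (simp add: sin_times_cos inner_diff_left inner_add_left fun_eq_iff)
  ultimately show "trig_poly (\<lambda>x. cos (t \<bullet> x) * cos (s \<bullet> x))"
    "trig_poly (\<lambda>x. sin (t \<bullet> x) * cos (s \<bullet> x))"
    using trig_poly.scale[OF trig_poly.add[OF trig_poly.cos trig_poly.cos], of "1/2" "t - s" "t + s"]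
      trig_poly.scale[OF trig_poly.add[OF trig_poly.sin trig_poly.sin], of "1/2" "t + s" "t - s"]
    by (simp_all only:)
next
  case (sin s)
  have "(\<lambda>x. cos (t \<bullet> x) * sin (s \<bullet> x)) = (\<lambda>x. (1/2) * (sin ((t + s) \<bullet> x) - sin ((t - s) \<bullet> x)))"
    by (simp add: cos_times_sin inner_diff_left inner_add_left fun_eq_iff)
  moreover have "(\<lambda>x. sin (t \<bullet> x) * sin (s \<bullet> x)) = (\<lambda>x. (1/2) * (cos ((t - s) \<bullet> x) - cos ((t + s) \<bullet> x)))"
    by (simp add: sin_times_sin inner_diff_left inner_add_left fun_eq_iff)
  ultimately show "trig_poly (\<lambda>x. cos (t \<bullet> x) * sin (s \<bullet> x))"
    "trig_poly (\<lambda>x. sin (t \<bullet> x) * sin (s \<bullet> x))"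
    using trig_poly.scale[OF trig_poly_diff[OF trig_poly.cos trig_poly.cos], of "1/2" "t - s" "t + s"]
      trig_poly.scale[OF trig_poly_diff[OF trig_poly.sin trig_poly.sin], of "1/2" "t + s" "t - s"]
    by (simp_all only:)
next
  case (add f g)
  show "trig_poly (\<lambda>x. cos (t \<bullet> x) * (f x + g x))" "trig_poly (\<lambda>x. sin (t \<bullet> x) * (f x + g x))"
    using trig_poly.add[OF add.IH(1) add.IH(3)] trig_poly.add[OF add.IH(2) add.IH(4)]
    by (simp_all add: distrib_left)
next
  case (scale f c)
  show "trig_poly (\<lambda>x. cos (t \<bullet> x) * (c * f x))" "trig_poly (\<lambda>x. sin (t \<bullet> x) * (c * f x))"
    using trig_poly.scale[OF scale.IH(1), of c] trig_poly.scale[OF scale.IH(2), of c]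
    by (simp_all add: mult.left_commute)
qed

lemma trig_poly_mult:
  assumes "trig_poly f" "trig_poly g" shows "trig_poly (\<lambda>x. f x * g x)"
  using assms(1)
proof (induction rule: trig_poly.induct)
  case (add f h)
  show ?case using trig_poly.add[OF add.IH] by (simp add: distrib_right)
next
  case (scale f c)
  show ?case using trig_poly.scale[OF scale.IH, of c] by (simp add: mult.assoc)
qed (rule trig_poly_mult_basic[OF assms(2)])+

lemma continuous_on_trig_poly: "trig_poly f \<Longrightarrow> continuous_on S f"
  by (induction rule: trig_poly.induct) (intro continuous_intros; assumption)+

lemma bounded_trig_poly: "trig_poly f \<Longrightarrow> \<exists>B. \<forall>x. \<bar>f x\<bar> \<le> B"
proof (induction rule: trig_poly.induct)
  case (add f g)
  then obtain A B where "\<forall>x. \<bar>f x\<bar> \<le> A" "\<forall>x. \<bar>g x\<bar> \<le> B" by auto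
  then have "\<forall>x. \<bar>f x + g x\<bar> \<le> A + B" by (metis abs_triangle_ineq add_mono order_trans)
  then show ?case by blast
next
  case (scale f c)
  then obtain A where "\<forall>x. \<bar>f x\<bar> \<le> A" by auto
  then have "\<forall>x. \<bar>c * f x\<bar> \<le> \<bar>c\<bar> * A" by (simp add: abs_mult mult_left_mono)
  then show ?case by blast
qed (auto intro: exI[of _ 1])

lemma trig_poly_polynomial:
  fixes q :: "real \<Rightarrow> real"
  assumes "real_polynomial_function q" "trig_poly f"
  shows "trig_poly (\<lambda>x. q (f x))"
  using assms(1)
proof (induction rule: real_polynomial_function.induct)
  case (linear q)
  then have "q y = q 1 * y" for y
    using linear_scale[OF bounded_linear.linear[OF linear], of y 1] by simp
  then have "(\<lambda>x. q (f x)) = (\<lambda>x. q 1 * f x)" by (intro ext)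
  then show ?case using trig_poly.scale[OF assms(2)] by simp
qed (rule trig_poly_const trig_poly.add trig_poly_mult; assumption)+

text \<open>A single cosine or sine may agree at both points. With \<open>t\<close> along
  \<open>x - y\<close>, scaled so that the phases at \<open>x\<close> and \<open>y\<close> differ by
  pi/2, the sine shifted by the phase at \<open>y\<close> is 1 at \<open>x\<close> and 0 at
  \<open>y\<close>.\<close>

lemma trig_poly_separates:
  fixes x y :: "'a::euclidean_space"
  assumes "x \<noteq> y" shows "\<exists>f. trig_poly f \<and> f x \<noteq> f y"
proof -
  define t where "t = (pi / 2 / ((x - y) \<bullet> (x - y))) *\<^sub>R (x - y)"
  have "t \<bullet> (x - y) = pi / 2" using assms by (simp add: t_def)
  then have *: "t \<bullet> x = t \<bullet> y + pi / 2" by (simp add: inner_diff_right)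
  define f where "f z = cos (t \<bullet> y) * sin (t \<bullet> z) - sin (t \<bullet> y) * cos (t \<bullet> z)" for z
  have "trig_poly f" unfolding f_def by (intro trig_poly_diff trig_poly.intros)
  moreover have "f z = sin (t \<bullet> z - t \<bullet> y)" for z by (simp add: f_def sin_diff)
  then have "f x = 1" "f y = 0" by (simp_all add: *)
  ultimately show ?thesis by auto
qed

text \<open>A trigonometric polynomial that is close to \<open>g\<close> on a compact set may be large off it;
  composing with a polynomial approximation of a truncation keeps it bounded.\<close>
lemma trig_poly_approx_bounded:
  fixes g :: "'a::euclidean_space \<Rightarrow> real"
  assumes "compact S" "continuous_on S g" "\<And>x. \<bar>g x\<bar> \<le> B" "e > 0"
  obtains f where "trig_poly f" "\<And>x. x \<in> S \<Longrightarrow> \<bar>g x - f x\<bar> \<le> e" "\<And>x. \<bar>f x\<bar> \<le> B + e"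
proof -
  have "\<exists>h. trig_poly h \<and> (\<forall>x\<in>S. \<bar>g x - h x\<bar> < e / 2)"
  proof (rule Stone_Weierstrass_HOL)
    show "\<And>x y. x \<in> S \<and> y \<in> S \<and> x \<noteq> y \<Longrightarrow> \<exists>f. trig_poly f \<and> f x \<noteq> f y"
      using trig_poly_separates by blast
  qed (simp_all add: assms trig_poly_const continuous_on_trig_poly trig_poly.add trig_poly_mult)
  then obtain h where h: "trig_poly h" "\<forall>x\<in>S. \<bar>g x - h x\<bar> < e / 2" by blast
  obtain R where R: "\<And>x. \<bar>h x\<bar> \<le> R" using bounded_trig_poly[OF h(1)] by auto
  define c where "c y = max (- B) (min B y)" for y :: real
  have c: "continuous_on {-R..R} c" unfolding c_def by (intro continuous_intros)
  obtain q where q: "real_polynomial_function q" "\<And>y. y \<in> {-R..R} \<Longrightarrow> \<bar>c y - q y\<bar> < e / 2"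
    using Stone_Weierstrass_real_polynomial_function[OF compact_Icc c, of "e/2"] assms(4) by auto
  have q': "\<bar>c (h x) - q (h x)\<bar> < e / 2" for x
    using q(2)[of "h x"] R[of x] by (auto simp: abs_le_iff)
  show thesis
  proof
    show "trig_poly (\<lambda>x. q (h x))" using trig_poly_polynomial[OF q(1) h(1)] .
    show "\<bar>g x - q (h x)\<bar> \<le> e" if "x \<in> S" for x
    proof -
      \<comment> \<open>The clamp \<open>c\<close> is non-expansive and fixes \<open>g x\<close>,
        which lies between -B and B.\<close>
      have "\<bar>g x - c (h x)\<bar> \<le> \<bar>g x - h x\<bar>" using assms(3)[of x] by (auto simp: c_def)
      also have "\<dots> < e / 2" using h(2) that by auto
      finally show ?thesis using q'[of x] by linarith
    qed
    show "\<bar>q (h x)\<bar> \<le> B + e" for x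
    proof -
      have "0 \<le> B" using assms(3)[of x] by linarith
      then have "\<bar>c (h x)\<bar> \<le> B" unfolding c_def by linarith
      then show ?thesis using q'[of x] assms(4) by linarith
    qed
  qed
qed

lemma trig_poly_expectation_tendsto:
  fixes Y :: "nat \<Rightarrow> 'b \<Rightarrow> 'a::euclidean_space"
  assumes "prob_space M" "prob_space G" "sets G = sets borel"
    and Y: "\<And>n. Y n \<in> borel_measurable M"
    and conv: "\<And>t. (\<lambda>n. \<integral>\<omega>. cis (t \<bullet> Y n \<omega>) \<partial>M) \<longlonglongrightarrow> (\<integral>x. cis (t \<bullet> x) \<partial>G)"
    and "trig_poly f"
  shows "(\<lambda>n. \<integral>\<omega>. f (Y n \<omega>) \<partial>M) \<longlonglongrightarrow> (\<integral>x. f x \<partial>G)"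
proof -
  interpret M: prob_space M by fact
  interpret G: prob_space G by fact
  note [measurable] = Y
  note [measurable_cong] = assms(3)
  have cis_meas[measurable]: "cis \<in> borel_measurable borel"
    by (intro borel_measurable_continuous_onI continuous_intros)
  have iM: "integrable M (\<lambda>\<omega>. f (Y n \<omega>))" and iG: "integrable G f" if tf: "trig_poly f" for f n
  proof -
    obtain B where "\<forall>x. \<bar>f x\<bar> \<le> B" using bounded_trig_poly[OF tf] by auto
    moreover have [measurable]: "f \<in> borel_measurable borel"
      using continuous_on_trig_poly[OF tf] borel_measurable_continuous_onI by blast
    ultimately show "integrable M (\<lambda>\<omega>. f (Y n \<omega>))" "integrable G f"
      by (auto intro!: M.integrable_const_bound[of _ B] G.integrable_const_bound[of _ B])
  qed
  have icM: "integrable M (\<lambda>\<omega>. cis (t \<bullet> Y n \<omega>))" and icG: "integrable G (\<lambda>x. cis (t \<bullet> x))" for t n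
    by (auto intro!: M.integrable_const_bound[of _ 1] G.integrable_const_bound[of _ 1])
  show ?thesis using \<open>trig_poly f\<close>
  proof (induction rule: trig_poly.induct)
    case (cos t)
    have "(\<lambda>n. Re (\<integral>\<omega>. cis (t \<bullet> Y n \<omega>) \<partial>M)) \<longlonglongrightarrow> Re (\<integral>x. cis (t \<bullet> x) \<partial>G)"
      by (intro tendsto_intros conv)
    then show ?case using icM icG by (simp flip: integral_Re)
  next
    case (sin t)
    have "(\<lambda>n. Im (\<integral>\<omega>. cis (t \<bullet> Y n \<omega>) \<partial>M)) \<longlonglongrightarrow> Im (\<integral>x. cis (t \<bullet> x) \<partial>G)"
      by (intro tendsto_intros conv)
    then show ?case using icM icG by (simp flip: integral_Im)
  next
    case (add f g)
    then show ?case using iM iG by (simp add: tendsto_add)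
  next
    case (scale f c)
    then show ?case by (simp add: tendsto_mult_left)
  qed
qed

text \<open>Tightness is assumed uniformly for the \<open>Y n\<close>; the single measure
  \<open>G\<close> is tight by itself. On a ball carrying all but \<open>e\<close> of each mass,
  \<open>g\<close> is replaced by a trigonometric polynomial, whose expectations converge by
  hypothesis; the uniform bound on that polynomial controls what happens off the ball.\<close>

theorem weak_convergence_of_characteristic_functions:
  fixes Y :: "nat \<Rightarrow> 'b \<Rightarrow> 'a::euclidean_space"
  assumes "prob_space M" "prob_space G" "sets G = sets borel"
    and Y: "\<And>n. Y n \<in> borel_measurable M"
    and conv: "\<And>t. (\<lambda>n. \<integral>\<omega>. cis (t \<bullet> Y n \<omega>) \<partial>M) \<longlonglongrightarrow> (\<integral>x. cis (t \<bullet> x) \<partial>G)"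
    and tight: "\<And>e. e > 0 \<Longrightarrow> \<exists>R. \<forall>n. measure M {\<omega> \<in> space M. norm (Y n \<omega>) > R} \<le> e"
    and g: "continuous_on UNIV g" "bounded (range g)"
  shows "(\<lambda>n. \<integral>\<omega>. g (Y n \<omega>) \<partial>M) \<longlonglongrightarrow> (\<integral>x. g x \<partial>G :: real)"
proof -
  interpret M: prob_space M by fact
  interpret G: prob_space G by fact
  note [measurable] = Y
  note [measurable_cong] = assms(3)
  have [measurable]: "g \<in> borel_measurable borel"
    using g(1) by (rule borel_measurable_continuous_onI)
  obtain B where "B > 0" and B: "\<And>x. \<bar>g x\<bar> \<le> B"
    using g(2) by (auto simp: bounded_pos)
  show ?thesis
  proof (rule metric_LIMSEQ_I)
    fix r :: real assume "r > 0"
    \<comment> \<open>The three errors below add up to at most 3e + 6Be, so this choice leaves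
      strict room below \<open>r\<close>. The condition e <= B turns the bound 2B + e off the ball
      into 3B.\<close>
    define e where "e = min B (r / (4 + 8 * B))"
    have "e > 0" "e \<le> B" using \<open>r > 0\<close> \<open>B > 0\<close> by (auto simp: e_def)
    have "e \<le> r / (4 + 8 * B)" by (simp add: e_def)
    then have "e * (4 + 8 * B) \<le> r" using \<open>B > 0\<close> by (simp add: pos_le_divide_eq)
    then have er: "4 * e + 8 * B * e \<le> r" by (simp add: algebra_simps)
    obtain R where R: "\<And>n. measure M {\<omega> \<in> space M. norm (Y n \<omega>) > R} \<le> e"
      using tight[OF \<open>e > 0\<close>] by auto
    have "(\<lambda>k. measure G {x \<in> space G. norm x > real k}) \<longlonglongrightarrow> measure G (\<Inter>k. {x \<in> space G. norm x > real k})"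
      by (rule G.finite_Lim_measure_decseq) (auto simp: decseq_def)
    moreover have "(\<Inter>k. {x \<in> space G. norm x > real k}) = {}"
    proof -
      { fix x :: 'a
        obtain k :: nat where "norm x \<le> real k" using real_arch_simple by blast
        then have "\<exists>k::nat. \<not> norm x > real k" by (auto simp: not_less) }
      then show ?thesis by auto
    qed
    ultimately have "(\<lambda>k. measure G {x \<in> space G. norm x > real k}) \<longlonglongrightarrow> 0" by simp
    from order_tendstoD(2)[OF this \<open>e > 0\<close>] obtain k :: nat
      where k: "measure G {x \<in> space G. norm x > real k} < e"
      by (auto simp: eventually_sequentially)
    define T where "T = max R (real k)"
    have RT: "measure M {\<omega> \<in> space M. norm (Y n \<omega>) > T} \<le> e" for n
      by (rule order_trans[OF M.finite_measure_mono R[of n]]) (auto simp: T_def)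
    have kT: "measure G {x \<in> space G. norm x > T} \<le> e"
      by (rule order_trans[OF G.finite_measure_mono less_imp_le[OF k]]) (auto simp: T_def)
    obtain f where f: "trig_poly f" "\<And>x. x \<in> cball 0 T \<Longrightarrow> \<bar>g x - f x\<bar> \<le> e" "\<And>x. \<bar>f x\<bar> \<le> B + e"
      using trig_poly_approx_bounded[of "cball 0 T" g B e] g(1) B \<open>e > 0\<close>
      by (metis compact_cball continuous_on_subset subset_UNIV)
    have fm[measurable]: "f \<in> borel_measurable borel"
      using continuous_on_trig_poly[OF f(1)] borel_measurable_continuous_onI by blast
    have approx: "\<bar>(\<integral>\<omega>. g (W \<omega>) \<partial>P) - (\<integral>\<omega>. f (W \<omega>) \<partial>P)\<bar> \<le> e + 3 * B * e"
      if P: "prob_space P" and W: "W \<in> borel_measurable P"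
        and t: "measure P {\<omega> \<in> space P. norm (W \<omega>) > T} \<le> e" for P :: "'c measure" and W
    proof -
      interpret P: prob_space P by fact
      note [measurable] = W
      have ig: "integrable P (\<lambda>\<omega>. g (W \<omega>))"
        by (rule P.integrable_const_bound[of _ B]) (use B in auto)
      have jf: "integrable P (\<lambda>\<omega>. f (W \<omega>))"
        by (rule P.integrable_const_bound[of _ "B + e"]) (use f in auto)
      have ii: "integrable P (\<lambda>\<omega>. indicator {\<omega> \<in> space P. norm (W \<omega>) > T} \<omega> :: real)"
        by (rule P.integrable_const_bound[of _ 1]) auto
      have "\<bar>(\<integral>\<omega>. g (W \<omega>) \<partial>P) - (\<integral>\<omega>. f (W \<omega>) \<partial>P)\<bar> = \<bar>\<integral>\<omega>. g (W \<omega>) - f (W \<omega>) \<partial>P\<bar>"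
        using ig jf by simp
      also have "\<dots> \<le> (\<integral>\<omega>. \<bar>g (W \<omega>) - f (W \<omega>)\<bar> \<partial>P)" by (rule integral_abs_bound)
      also have "\<dots> \<le> (\<integral>\<omega>. e + 3 * B * indicator {\<omega> \<in> space P. norm (W \<omega>) > T} \<omega> \<partial>P)"
      proof (rule integral_mono)
        show "integrable P (\<lambda>\<omega>. e + 3 * B * indicator {\<omega> \<in> space P. norm (W \<omega>) > T} \<omega>)"
          using ii by simp
        show "\<bar>g (W \<omega>) - f (W \<omega>)\<bar> \<le> e + 3 * B * indicator {\<omega> \<in> space P. norm (W \<omega>) > T} \<omega>"
          if "\<omega> \<in> space P" for \<omega>
        proof (cases "norm (W \<omega>) > T")
          case True
          have "\<bar>g (W \<omega>) - f (W \<omega>)\<bar> \<le> B + (B + e)"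
            using B[of "W \<omega>"] f(3)[of "W \<omega>"] by linarith
          then show ?thesis using True that \<open>e \<le> B\<close> \<open>e > 0\<close> by simp
        next
          case False
          then show ?thesis using f(2)[of "W \<omega>"] that by simp
        qed
      qed (use ig jf in auto)
      also have "\<dots> = e + 3 * B * measure P {\<omega> \<in> space P. norm (W \<omega>) > T}"
        using ii by (simp add: P.prob_space)
      also have "\<dots> \<le> e + 3 * B * e" using t \<open>B > 0\<close> by simp
      finally show ?thesis .
    qed
    have aG: "\<bar>(\<integral>x. g x \<partial>G) - (\<integral>x. f x \<partial>G)\<bar> \<le> e + 3 * B * e"
      using approx[OF \<open>prob_space G\<close>, of "\<lambda>x. x"] kT by simp
    have aM: "\<bar>(\<integral>\<omega>. g (Y n \<omega>) \<partial>M) - (\<integral>\<omega>. f (Y n \<omega>) \<partial>M)\<bar> \<le> e + 3 * B * e" for n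
      using approx[OF \<open>prob_space M\<close> Y RT] .
    have "(\<lambda>n. \<integral>\<omega>. f (Y n \<omega>) \<partial>M) \<longlonglongrightarrow> (\<integral>x. f x \<partial>G)"
      by (rule trig_poly_expectation_tendsto) (use assms f in auto)
    then obtain n0 where n0: "\<And>n. n \<ge> n0 \<Longrightarrow> \<bar>(\<integral>\<omega>. f (Y n \<omega>) \<partial>M) - (\<integral>x. f x \<partial>G)\<bar> < e"
      using \<open>e > 0\<close> by (metis LIMSEQ_D real_norm_def)
    have "B * e > 0" using \<open>e > 0\<close> \<open>B > 0\<close> by simp
    then have "dist (\<integral>\<omega>. g (Y n \<omega>) \<partial>M) (\<integral>x. g x \<partial>G) < r" if "n \<ge> n0" for n
      using aG aM[of n] n0[OF that] er \<open>e > 0\<close> unfolding dist_real_def by linarith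
    then show "\<exists>no. \<forall>n\<ge>no. dist (\<integral>\<omega>. g (Y n \<omega>) \<partial>M) (\<integral>x. g x \<partial>G) < r" by blast
  qed
qed

section \<open>Gaussian measures with a given covariance\<close>

definition quad_form :: "('k::finite \<Rightarrow> 'k \<Rightarrow> real) \<Rightarrow> ('k \<Rightarrow> real) \<Rightarrow> real" where
  "quad_form S t = (\<Sum>i\<in>UNIV. \<Sum>j\<in>UNIV. t i * t j * S i j)"

text \<open>Along a coordinate axis the form is a quadratic polynomial in \<open>x\<close>. It is
  used twice: with vanishing leading coefficient for \<open>psd_zero_row\<close>, and for completing
  the square in \<open>gaussian_measure_exists\<close>.\<close>

lemma quad_form_add_axis:
  fixes S :: "'k::finite \<Rightarrow> 'k \<Rightarrow> real"
  assumes "\<And>i j. S i j = S j i"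
  shows "quad_form S (\<lambda>k. t k + x * of_bool (k = i)) =
    quad_form S t + 2 * x * (\<Sum>j\<in>UNIV. t j * S i j) + x\<^sup>2 * S i i"
proof -
  define d where "d k = (of_bool (k = i) :: real)" for k
  have d: "(\<Sum>k\<in>UNIV. d k * f k) = f i" for f :: "'k \<Rightarrow> real"
  proof -
    have "d k * f k = (if k = i then f k else 0)" for k by (simp add: d_def)
    then show ?thesis by simp
  qed
  have "quad_form S (\<lambda>k. t k + x * d k) =
     (\<Sum>k\<in>UNIV. \<Sum>l\<in>UNIV. t k * t l * S k l + x * (d k * (t l * S k l)) + x * (d l * (t k * S k l))
        + x\<^sup>2 * (d k * (d l * S k l)))"
    unfolding quad_form_def by (intro sum.cong refl) (simp add: algebra_simps power2_eq_square)
  also have "\<dots> = quad_form S t + x * (\<Sum>k\<in>UNIV. d k * (\<Sum>l\<in>UNIV. t l * S k l))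
      + x * (\<Sum>k\<in>UNIV. \<Sum>l\<in>UNIV. d l * (t k * S k l)) + x\<^sup>2 * (\<Sum>k\<in>UNIV. d k * (\<Sum>l\<in>UNIV. d l * S k l))"
    unfolding quad_form_def by (simp add: sum.distrib sum_distrib_left)
  also have "\<dots> = quad_form S t + x * (\<Sum>l\<in>UNIV. t l * S i l) + x * (\<Sum>k\<in>UNIV. t k * S k i) + x\<^sup>2 * S i i"
    by (simp add: d)
  also have "\<dots> = quad_form S t + 2 * x * (\<Sum>j\<in>UNIV. t j * S i j) + x\<^sup>2 * S i i"
    using assms by simp
  finally show ?thesis by (simp add: d_def)
qed

text \<open>If the diagonal entry vanishes, the form is affine along axis \<open>i\<close>, with
  slope \<open>2 * S i j\<close> at the unit vector of \<open>j\<close>. A nonzero slope would make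
  it negative somewhere; the chosen \<open>x\<close> gives the value -1.\<close>

lemma psd_zero_row:
  fixes S :: "'k::finite \<Rightarrow> 'k \<Rightarrow> real"
  assumes sym: "\<And>i j. S i j = S j i" and psd: "\<And>t. quad_form S t \<ge> 0" and "S i i = 0"
  shows "S i j = 0"
proof (rule ccontr)
  assume nz: "S i j \<noteq> 0"
  define c where "c = quad_form S (\<lambda>k. of_bool (k = j))"
  define x where "x = - (c + 1) / (2 * S i j)"
  have "(\<Sum>k\<in>UNIV. of_bool (k = j) * S i k) = (\<Sum>k\<in>UNIV. if k = j then S i k else 0)"
    by (intro sum.cong) auto
  then have "quad_form S (\<lambda>k. of_bool (k = j) + x * of_bool (k = i)) = c + 2 * x * S i j"
    using quad_form_add_axis[OF sym, where t = "\<lambda>k. of_bool (k = j)" and x = x and i = i] assms(3) by (simp add: c_def)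
  also have "\<dots> = -1" using nz by (simp add: x_def field_simps)
  finally show False using psd[of "\<lambda>k. of_bool (k = j) + x * of_bool (k = i)"] by simp
qed

text \<open>The new measure is the law of x + z w with x distributed as \<open>G\<close> and z an
  independent standard normal: its characteristic function gains the factor exp(-(t.w)^2 /
  2).\<close>

lemma gaussian_measure_add_rank_one:
  fixes G :: "(real^'k::finite) measure"
  assumes "gaussian_measure G S"
  shows "\<exists>G' :: (real^'k) measure. gaussian_measure G' (\<lambda>i j. S i j + w $ i * w $ j)"
proof -
  have G: "prob_space G" "sets G = sets borel"
    and char: "\<And>t. (\<integral>x. cis (t \<bullet> x) \<partial>G) =
        complex_of_real (exp (- (\<Sum>i\<in>UNIV. \<Sum>j\<in>UNIV. t$i * t$j * S i j) / 2))"
    using assms by (auto simp: gaussian_measure_def)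
  define N where "N = std_normal_distribution"
  interpret G: prob_space G by fact
  interpret N: real_distribution N unfolding N_def by (rule real_dist_normal_dist)
  interpret P: pair_prob_space G N ..
  note [measurable_cong] = G(2)
  have cis_meas[measurable]: "cis \<in> borel_measurable borel"
    by (intro borel_measurable_continuous_onI continuous_intros)
  define G' where "G' = distr (G \<Otimes>\<^sub>M N) borel (\<lambda>(x, z). x + z *\<^sub>R w)"
  have m[measurable]: "(\<lambda>(x, z). x + z *\<^sub>R w) \<in> borel_measurable (G \<Otimes>\<^sub>M N)" by measurable
  have "prob_space G'" unfolding G'_def by (rule P.prob_space_distr[OF m])
  moreover have "sets G' = sets borel" by (simp add: G'_def)
  moreover have "(\<integral>x. cis (t \<bullet> x) \<partial>G') =
        complex_of_real (exp (- (\<Sum>i\<in>UNIV. \<Sum>j\<in>UNIV. t$i * t$j * (S i j + w $ i * w $ j)) / 2))" for t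
  proof -
    have N_char: "(\<integral>z. cis ((t \<bullet> w) * z) \<partial>N) = complex_of_real (exp (- (t \<bullet> w)\<^sup>2 / 2))"
      using fun_cong[OF char_std_normal_distribution, of "t \<bullet> w"]
      by (simp add: char_def N_def cis_conv_exp)
    have int: "integrable (G \<Otimes>\<^sub>M N) (\<lambda>(x, z). cis (t \<bullet> x) * cis ((t \<bullet> w) * z))"
      by (rule P.integrable_const_bound[of _ 1]) (auto simp: norm_mult split_beta)
    have "(\<integral>x. cis (t \<bullet> x) \<partial>G') = (\<integral>p. (case p of (x, z) \<Rightarrow> cis (t \<bullet> x) * cis ((t \<bullet> w) * z)) \<partial>(G \<Otimes>\<^sub>M N))"
      unfolding G'_def
      by (subst integral_distr)
         (auto simp: split_beta cis_mult inner_add_right mult.commute intro!: Bochner_Integration.integral_cong)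
    also have "\<dots> = (\<integral>x. (\<integral>z. cis (t \<bullet> x) * cis ((t \<bullet> w) * z) \<partial>N) \<partial>G)"
      using P.integral_fst'[OF int] by simp
    also have "\<dots> = (\<integral>x. cis (t \<bullet> x) \<partial>G) * complex_of_real (exp (- (t \<bullet> w)\<^sup>2 / 2))"
      by (simp add: N_char)
    also have "\<dots> = complex_of_real (exp (- ((\<Sum>i\<in>UNIV. \<Sum>j\<in>UNIV. t$i * t$j * S i j) + (t \<bullet> w)\<^sup>2) / 2))"
      by (simp add: char add_divide_distrib mult_exp_exp diff_divide_distrib flip: of_real_mult)
    also have "(t \<bullet> w)\<^sup>2 = (\<Sum>i\<in>UNIV. \<Sum>j\<in>UNIV. t$i * t$j * (w $ i * w $ j))"
      by (simp add: inner_vec_def power2_eq_square sum_product mult_ac)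
    also have "(\<Sum>i\<in>UNIV. \<Sum>j\<in>UNIV. t$i * t$j * S i j) + \<dots> =
       (\<Sum>i\<in>UNIV. \<Sum>j\<in>UNIV. t$i * t$j * (S i j + w $ i * w $ j))"
      by (simp add: sum.distrib distrib_left)
    finally show ?thesis .
  qed
  ultimately show ?thesis unfolding gaussian_measure_def by blast
qed

text \<open>Splitting off the rank-one part of a nonzero row (one Cholesky step) reduces the number of
  nonzero diagonal entries.\<close>
theorem gaussian_measure_exists:
  fixes S :: "'k::finite \<Rightarrow> 'k \<Rightarrow> real"
  assumes "\<And>i j. S i j = S j i" and "\<And>t. quad_form S t \<ge> 0"
  shows "\<exists>G :: (real^'k) measure. gaussian_measure G S"
  using assms
proof (induction "card {i. S i i \<noteq> 0}" arbitrary: S rule: less_induct)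
  case less
  note sym = less.prems(1) and psd = less.prems(2)
  show ?case
  proof (cases "\<forall>i. S i i = 0")
    case True
    then have "S i j = 0" for i j using psd_zero_row[OF sym psd] by blast
    moreover have "prob_space (return borel (0 :: real^'k))" by (rule prob_space_return) simp
    moreover have "cis \<in> borel_measurable borel"
      by (intro borel_measurable_continuous_onI continuous_intros)
    ultimately have "gaussian_measure (return borel (0 :: real^'k)) S"
      unfolding gaussian_measure_def by (simp add: integral_return)
    then show ?thesis by blast
  next
    case False
    then obtain i where i: "S i i \<noteq> 0" by blast
    have "(\<Sum>k\<in>UNIV. (\<Sum>l\<in>UNIV. of_bool (k = i) * of_bool (l = i) * S k l)) = 
       (\<Sum>k\<in>UNIV. if k = i then (\<Sum>l\<in>UNIV. if l = i then S k l else 0) else 0)"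
      by (intro sum.cong refl) (auto intro!: sum.cong)
    then have "S i i \<ge> 0" using psd[of "\<lambda>k. of_bool (k = i)"] by (simp add: quad_form_def)
    with i have pos: "S i i > 0" by simp
    \<comment> \<open>The Schur complement of \<open>S i i\<close>, kept at full size with row and
      column \<open>i\<close> equal to zero.\<close>
    define S' where "S' k l = S k l - S i k * S i l / S i i" for k l
    have sym': "S' k l = S' l k" for k l using sym by (simp add: S'_def mult.commute)
    have psd': "quad_form S' t \<ge> 0" for t
    proof -
      define b where "b = (\<Sum>j\<in>UNIV. t j * S i j)"
      have "quad_form S' t = quad_form S t - (\<Sum>k\<in>UNIV. \<Sum>l\<in>UNIV. (t k * S i k) * (t l * S i l)) / S i i"
        by (simp add: quad_form_def S'_def right_diff_distrib sum_subtractf sum_divide_distrib mult_ac)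
      also have "\<dots> = quad_form S t - b\<^sup>2 / S i i"
        by (simp add: b_def power2_eq_square sum_product)
      \<comment> \<open>Completing the square: the form of \<open>S'\<close> at \<open>t\<close> is
        the minimum of the form of \<open>S\<close> over all translates of \<open>t\<close> along
        axis \<open>i\<close>, hence nonnegative.\<close>
      also have "\<dots> = quad_form S (\<lambda>k. t k + (- b / S i i) * of_bool (k = i))"
        using pos by (subst quad_form_add_axis[OF sym]) (simp add: b_def[symmetric] power2_eq_square field_simps)
      finally show ?thesis using psd by simp
    qed
    have "S' k k = 0" if "S k k = 0" for k
      using psd_zero_row[OF sym psd that, of i] that sym[of i k] by (simp add: S'_def)
    moreover have "S' i i = 0" using pos by (simp add: S'_def)
    ultimately have "{k. S' k k \<noteq> 0} \<subset> {k. S k k \<noteq> 0}" using i by auto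
    then have "card {k. S' k k \<noteq> 0} < card {k. S k k \<noteq> 0}" by (intro psubset_card_mono) auto
    from less.hyps[OF this sym' psd'] obtain G :: "(real^'k) measure" where "gaussian_measure G S'" by blast
    from gaussian_measure_add_rank_one[OF this, of "\<chi> k. S i k / sqrt (S i i)"]
    obtain G' :: "(real^'k) measure"
      where "gaussian_measure G' (\<lambda>k l. S' k l + (S i k / sqrt (S i i)) * (S i l / sqrt (S i i)))"
      by auto
    moreover have "S' k l + (S i k / sqrt (S i i)) * (S i l / sqrt (S i i)) = S k l" for k l
      using pos by (simp add: S'_def)
    ultimately show ?thesis by auto
  qed
qed

section \<open>Generated sigma-algebras and shift invariance\<close>

lemma space_gen_sigma [simp]: "space (gen_sigma M N Z I) = space M"
  by (simp add: gen_sigma_def space_measure_of_conv)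

lemma sets_gen_sigma:
  "sets (gen_sigma M N Z I) = sigma_sets (space M) (\<Union>i\<in>I. {Z i -` B \<inter> space M | B. B \<in> sets N})"
  unfolding gen_sigma_def by (rule sets_measure_of) auto

lemma measurable_gen_sigma:
  assumes "i \<in> I" "Z i \<in> measurable M N"
  shows "Z i \<in> measurable (gen_sigma M N Z I) N"
proof (rule measurableI)
  show "Z i \<omega> \<in> space N" if "\<omega> \<in> space (gen_sigma M N Z I)" for \<omega>
    using measurable_space[OF assms(2)] that by simp
  show "Z i -` B \<inter> space (gen_sigma M N Z I) \<in> sets (gen_sigma M N Z I)" if "B \<in> sets N" for B
    using that assms(1) by (auto simp: sets_gen_sigma intro!: sigma_sets.Basic)
qed

lemma subalgebra_gen_sigma:
  assumes "\<And>i. Z i \<in> measurable M N"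
  shows "subalgebra M (gen_sigma M N Z I)"
proof -
  have "sigma_sets (space M) (\<Union>i\<in>I. {Z i -` B \<inter> space M | B. B \<in> sets N}) \<subseteq> sets M"
    by (rule sets.sigma_sets_subset) (use assms in \<open>auto intro: measurable_sets\<close>)
  then show ?thesis by (simp add: subalgebra_def sets_gen_sigma)
qed

lemma subalgebra_gen_sigma_mono:
  assumes "I \<subseteq> J" shows "subalgebra (gen_sigma M N Z J) (gen_sigma M N Z I)"
  unfolding subalgebra_def sets_gen_sigma space_gen_sigma
  using assms by (intro conjI refl sigma_sets_mono') auto

lemma measurable_gen_sigma_window:
  assumes "\<And>i. Z i \<in> measurable M N" "\<And>i. i \<in> I \<Longrightarrow> t + i \<in> J" 
  shows "(\<lambda>\<omega>. \<lambda>i\<in>I. Z (t + i) \<omega>) \<in> measurable (gen_sigma M N Z J) (PiM I (\<lambda>_. N))"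
  using assms by (intro measurable_restrict measurable_gen_sigma) auto

section \<open>Factorization of measurable functions through the generating process\<close>

lemma doob_dynkin_ennreal:
  fixes g :: "'a \<Rightarrow> ennreal"
  assumes X: "X \<in> \<Omega> \<rightarrow> space P" and "g \<in> borel_measurable (vimage_algebra \<Omega> X P)"
  shows "\<exists>v\<in>borel_measurable P. \<forall>\<omega>\<in>\<Omega>. g \<omega> = v (X \<omega>)"
  using assms(2)
proof (induction rule: borel_measurable_induct)
  case (cong f g)
  then show ?case by auto
next
  case (set A)
  then obtain B where "B \<in> sets P" "A = X -` B \<inter> \<Omega>"
    using sets_vimage_algebra2[OF X] by auto
  then show ?case by (intro bexI[of _ "indicator B"]) (auto simp: indicator_def)
next
  case (mult u c)
  then obtain v where "v \<in> borel_measurable P" "\<forall>\<omega>\<in>\<Omega>. u \<omega> = v (X \<omega>)" by blast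
  then show ?case by (intro bexI[of _ "\<lambda>x. c * v x"]) auto
next
  case (add u w)
  then obtain v v' where "v \<in> borel_measurable P" "\<forall>\<omega>\<in>\<Omega>. u \<omega> = v (X \<omega>)"
    "v' \<in> borel_measurable P" "\<forall>\<omega>\<in>\<Omega>. w \<omega> = v' (X \<omega>)" by blast
  then show ?case by (intro bexI[of _ "\<lambda>x. v' x + v x"]) auto
next
  case (seq U)
  then have "\<forall>i. \<exists>v. v \<in> borel_measurable P \<and> (\<forall>\<omega>\<in>\<Omega>. U i \<omega> = v (X \<omega>))" by blast
  then obtain v where v: "\<And>i. v i \<in> borel_measurable P" "\<And>i \<omega>. \<omega> \<in> \<Omega> \<Longrightarrow> U i \<omega> = v i (X \<omega>)"
    by metis
  then show ?case by (intro bexI[of _ "\<lambda>x. SUP i. v i x"]) (auto simp: image_comp)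
qed

lemma doob_dynkin:
  fixes g :: "'a \<Rightarrow> real"
  assumes "X \<in> \<Omega> \<rightarrow> space P" and g: "g \<in> borel_measurable (vimage_algebra \<Omega> X P)"
  shows "\<exists>v\<in>borel_measurable P. \<forall>\<omega>\<in>\<Omega>. g \<omega> = v (X \<omega>)"
proof -
  have "(\<lambda>\<omega>. ennreal (g \<omega>)) \<in> borel_measurable (vimage_algebra \<Omega> X P)"
    "(\<lambda>\<omega>. ennreal (- g \<omega>)) \<in> borel_measurable (vimage_algebra \<Omega> X P)"
    using g by measurable
  from this[THEN doob_dynkin_ennreal[OF assms(1)]]
  obtain u v where u: "u \<in> borel_measurable P" "\<forall>\<omega>\<in>\<Omega>. ennreal (g \<omega>) = u (X \<omega>)"
    and v: "v \<in> borel_measurable P" "\<forall>\<omega>\<in>\<Omega>. ennreal (- g \<omega>) = v (X \<omega>)" by blast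
  have "g \<omega> = enn2real (u (X \<omega>)) - enn2real (v (X \<omega>))" if "\<omega> \<in> \<Omega>" for \<omega>
    using that u(2)[rule_format, OF that, symmetric] v(2)[rule_format, OF that, symmetric]
    by (cases "g \<omega> \<ge> 0") (simp_all add: ennreal_neg)
  then show ?thesis
    using u(1) v(1) by (intro bexI[of _ "\<lambda>x. enn2real (u x) - enn2real (v x)"]) auto
qed

text \<open>Conditional expectations given a window of \<open>Z\<close> are functions on the sample
  space. Writing them as functions of the window path allows the same function to be applied to a
  window around any other time.\<close>

lemma gen_sigma_factorization:
  fixes g :: "'a \<Rightarrow> real"
  assumes Z: "\<And>i. Z i \<in> measurable M N" and g: "g \<in> borel_measurable (gen_sigma M N Z I)"
  shows "\<exists>v\<in>borel_measurable (PiM I (\<lambda>_. N)). \<forall>\<omega>\<in>space M. g \<omega> = v (\<lambda>i\<in>I. Z i \<omega>)"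
proof (rule doob_dynkin)
  show X: "(\<lambda>\<omega>. \<lambda>i\<in>I. Z i \<omega>) \<in> space M \<rightarrow> space (PiM I (\<lambda>_. N))"
    using measurable_space[OF Z] by (auto simp: space_PiM)
  let ?V = "vimage_algebra (space M) (\<lambda>\<omega>. \<lambda>i\<in>I. Z i \<omega>) (PiM I (\<lambda>_. N))"
  have "Z i -` B \<inter> space M \<in> sets ?V" if "i \<in> I" "B \<in> sets N" for i B
  proof -
    have "(\<lambda>x. x i) -` B \<inter> space (PiM I (\<lambda>_. N)) \<in> sets (PiM I (\<lambda>_. N))"
      using that by (intro measurable_sets[OF measurable_component_singleton]) auto
    then have "(\<lambda>\<omega>. \<lambda>i\<in>I. Z i \<omega>) -` ((\<lambda>x. x i) -` B \<inter> space (PiM I (\<lambda>_. N))) \<inter> space M \<in> sets ?V"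
      by (rule in_vimage_algebra)
    moreover have "(\<lambda>\<omega>. \<lambda>i\<in>I. Z i \<omega>) -` ((\<lambda>x. x i) -` B \<inter> space (PiM I (\<lambda>_. N))) \<inter> space M
      = Z i -` B \<inter> space M"
      using X that by auto
    ultimately show ?thesis by simp
  qed
  then have "(\<Union>i\<in>I. {Z i -` B \<inter> space M | B. B \<in> sets N}) \<subseteq> sets ?V" by blast
  then have "sets (gen_sigma M N Z I) \<subseteq> sets ?V"
    unfolding sets_gen_sigma using sets.sigma_sets_subset[of _ ?V] by simp
  then have "subalgebra ?V (gen_sigma M N Z I)" by (simp add: subalgebra_def)
  then show "g \<in> borel_measurable ?V" using g by (rule measurable_from_subalg)
qed

text \<open>\<open>stationary_process\<close> speaks of finite stretches of consecutive times only.
  Every finite-dimensional cylinder becomes a box over such a stretch once the missing coordinates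
  are filled with the whole space, and these cylinders determine a finite measure on the path
  space.\<close>

lemma stationary_process_shift:
  assumes "stationary_process M N Z" and Z: "\<And>t. Z t \<in> measurable M N" and "prob_space M"
  shows "distr M (PiM UNIV (\<lambda>_. N)) (\<lambda>\<omega> i. Z (s + i) \<omega>) = distr M (PiM UNIV (\<lambda>_. N)) (\<lambda>\<omega> i. Z i \<omega>)"
proof (rule measure_eqI_PiM_infinite)
  interpret prob_space M by fact
  have paths: "(\<lambda>\<omega> i. Z (r + i) \<omega>) \<in> measurable M (PiM UNIV (\<lambda>_. N))" for r
    using measurable_restrict[of UNIV "\<lambda>i. Z (r + i)" M "\<lambda>_. N", OF Z] by (simp add: restrict_def)
  show "finite_measure (distr M (PiM UNIV (\<lambda>_. N)) (\<lambda>\<omega> i. Z (s + i) \<omega>))"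
    by (rule finite_measure_distr[OF paths])
  fix A and J :: "int set"
  assume J: "finite J" and A: "\<And>i. i \<in> J \<Longrightarrow> A i \<in> sets N"
  obtain lo k where k: "\<And>i. i \<in> J \<Longrightarrow> lo \<le> i \<and> i < lo + int k"
  proof (cases "J = {}")
    case True
    then show ?thesis using that by blast
  next
    case False
    show ?thesis
    proof (rule that[of "Min J" "nat (Max J - Min J + 1)"])
      fix i assume "i \<in> J"
      then have "Min J \<le> i" "i \<le> Max J" using J by auto
      then show "Min J \<le> i \<and> i < Min J + int (nat (Max J - Min J + 1))" by simp
    qed
  qed
  \<comment> \<open>The smallest stretch containing \<open>J\<close>, or the empty one, has been
    moved to start at 0; coordinates outside \<open>J\<close> carry no restriction.\<close>
  define B where "B j = (if lo + int j \<in> J then A (lo + int j) else space N)" for j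
  have B: "PiE {..<k} B \<in> sets (PiM {..<k} (\<lambda>_. N))"
    by (rule sets_PiM_I_finite) (auto simp: B_def A)
  have eq: "emeasure (distr M (PiM UNIV (\<lambda>_. N)) (\<lambda>\<omega> i. Z (r + i) \<omega>)) (prod_emb UNIV (\<lambda>_. N) J (PiE J A))
     = emeasure (distr M (PiM {..<k} (\<lambda>_. N)) (\<lambda>\<omega>. \<lambda>i\<in>{..<k}. Z (0 + int i) \<omega>)) (PiE {..<k} B)" for r
  proof -
    have "emeasure (distr M (PiM UNIV (\<lambda>_. N)) (\<lambda>\<omega> i. Z (r + i) \<omega>)) (prod_emb UNIV (\<lambda>_. N) J (PiE J A))
      = emeasure M ((\<lambda>\<omega> i. Z (r + i) \<omega>) -` prod_emb UNIV (\<lambda>_. N) J (PiE J A) \<inter> space M)"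
      using A J by (intro emeasure_distr[OF paths]) (auto intro!: sets_PiM_I)
    also have "(\<lambda>\<omega> i. Z (r + i) \<omega>) -` prod_emb UNIV (\<lambda>_. N) J (PiE J A) \<inter> space M
      = (\<lambda>\<omega>. \<lambda>i\<in>{..<k}. Z (r + lo + int i) \<omega>) -` PiE {..<k} B \<inter> space M"
    proof (intro set_eqI iffI)
      fix \<omega> assume "\<omega> \<in> (\<lambda>\<omega> i. Z (r + i) \<omega>) -` prod_emb UNIV (\<lambda>_. N) J (PiE J A) \<inter> space M"
      then show "\<omega> \<in> (\<lambda>\<omega>. \<lambda>i\<in>{..<k}. Z (r + lo + int i) \<omega>) -` PiE {..<k} B \<inter> space M"
        using measurable_space[OF Z] by (auto simp: prod_emb_def B_def PiE_iff add.assoc)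
    next
      fix \<omega> assume \<omega>: "\<omega> \<in> (\<lambda>\<omega>. \<lambda>i\<in>{..<k}. Z (r + lo + int i) \<omega>) -` PiE {..<k} B \<inter> space M"
      have "Z (r + i) \<omega> \<in> A i" if "i \<in> J" for i
      proof -
        define j where "j = nat (i - lo)"
        have "j < k" "i = lo + int j" using k[OF that] by (auto simp: j_def)
        then show ?thesis using \<omega> that by (auto simp: B_def PiE_iff add.assoc dest!: bspec[of _ _ j])
      qed
      then show "\<omega> \<in> (\<lambda>\<omega> i. Z (r + i) \<omega>) -` prod_emb UNIV (\<lambda>_. N) J (PiE J A) \<inter> space M"
        using measurable_space[OF Z] \<omega> by (auto simp: prod_emb_def PiE_iff)
    qed
    also have "emeasure M \<dots> = emeasure (distr M (PiM {..<k} (\<lambda>_. N)) (\<lambda>\<omega>. \<lambda>i\<in>{..<k}. Z (r + lo + int i) \<omega>)) (PiE {..<k} B)"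
      using B Z by (intro emeasure_distr[symmetric] measurable_restrict) auto
    finally show ?thesis using assms(1) by (simp add: stationary_process_def)
  qed
  show "emeasure (distr M (PiM UNIV (\<lambda>_. N)) (\<lambda>\<omega> i. Z (s + i) \<omega>)) (prod_emb UNIV (\<lambda>_. N) J (PiE J A))
     = emeasure (distr M (PiM UNIV (\<lambda>_. N)) (\<lambda>\<omega> i. Z i \<omega>)) (prod_emb UNIV (\<lambda>_. N) J (PiE J A))"
    using eq[of s] eq[of 0] by simp
qed auto

lemma stationary_process_integral_shift:
  fixes F :: "(int \<Rightarrow> 'b) \<Rightarrow> 'c::{banach, second_countable_topology}"
  assumes "stationary_process M N Z" and Z: "\<And>t. Z t \<in> measurable M N" and "prob_space M"
    and F: "F \<in> borel_measurable (PiM UNIV (\<lambda>_. N))"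
  shows "(\<integral>\<omega>. F (\<lambda>i. Z (s + i) \<omega>) \<partial>M) = (\<integral>\<omega>. F (\<lambda>i. Z i \<omega>) \<partial>M)"
proof -
  have paths: "(\<lambda>\<omega> i. Z (r + i) \<omega>) \<in> measurable M (PiM UNIV (\<lambda>_. N))" for r
    using measurable_restrict[of UNIV "\<lambda>i. Z (r + i)" M "\<lambda>_. N", OF Z] by (simp add: restrict_def)
  show ?thesis
    using stationary_process_shift[OF assms(1-3), of s] integral_distr[OF paths F, of s]
      integral_distr[OF paths[of 0] F] by simp
qed

section \<open>Covariance bounds under absolute regularity\<close>

context
  fixes M :: "'a measure" and N :: "'b measure" and Z :: "int \<Rightarrow> 'a \<Rightarrow> 'b"
  assumes M: "prob_space M" and Z: "\<And>t. Z t \<in> measurable M N"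
begin

interpretation prob_space M by (rule M)

lemmas gen_sigma_sub = subalgebra_gen_sigma[of Z M N, OF Z]

lemma fin_partition_gen_sigma_sets:
  assumes "fin_partition M (gen_sigma M N Z K) I A" "i \<in> I"
  shows "A i \<in> sets M"
  using assms gen_sigma_sub[of K] by (auto simp: fin_partition_def subalgebra_def)

lemma fin_partition_sum_measure:
  assumes A: "fin_partition M (gen_sigma M N Z K) I A" and B: "B \<in> sets M"
  shows "(\<Sum>i\<in>I. measure M (A i \<inter> B)) = measure M B"
proof -
  have "disjoint_family_on (\<lambda>i. A i \<inter> B) I"
    using A unfolding fin_partition_def disjoint_family_on_def by blast
  then have "measure M (\<Union>i\<in>I. A i \<inter> B) = (\<Sum>i\<in>I. measure M (A i \<inter> B))"
    using A B fin_partition_gen_sigma_sets[OF A]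
    by (intro finite_measure_finite_Union) (auto simp: fin_partition_def)
  moreover have "(\<Union>i\<in>I. A i \<inter> B) = B"
    using A sets.sets_into_space[OF B] by (auto simp: fin_partition_def)
  ultimately show ?thesis by simp
qed

text \<open>The suprema in \<open>beta_coeff\<close> are taken over sets of reals and bound their
  elements only if these sets are bounded above; this supplies the bound.\<close>

lemma fin_partition_dependence_le_2:
  assumes A: "fin_partition M (gen_sigma M N Z K) I A" and B: "fin_partition M (gen_sigma M N Z L) J B"
  shows "(\<Sum>i\<in>I. \<Sum>j\<in>J. \<bar>measure M (A i \<inter> B j) - measure M (A i) * measure M (B j)\<bar>) \<le> 2"
proof -
  note As = fin_partition_gen_sigma_sets[OF A] and Bs = fin_partition_gen_sigma_sets[OF B]
  have A1: "(\<Sum>i\<in>I. measure M (A i)) = 1"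
    using fin_partition_sum_measure[OF A sets.top] sets.sets_into_space[OF As]
    by (simp add: prob_space Int_absorb2)
  have B1: "(\<Sum>j\<in>J. measure M (B j)) = 1"
    using fin_partition_sum_measure[OF B sets.top] sets.sets_into_space[OF Bs]
    by (simp add: prob_space Int_absorb2)
  have "(\<Sum>i\<in>I. \<Sum>j\<in>J. \<bar>measure M (A i \<inter> B j) - measure M (A i) * measure M (B j)\<bar>)
    \<le> (\<Sum>i\<in>I. \<Sum>j\<in>J. measure M (A i \<inter> B j) + measure M (A i) * measure M (B j))"
    by (intro sum_mono order_trans[OF abs_triangle_ineq4]) simp
  also have "\<dots> = (\<Sum>i\<in>I. \<Sum>j\<in>J. measure M (B j \<inter> A i)) + (\<Sum>i\<in>I. measure M (A i)) * (\<Sum>j\<in>J. measure M (B j))"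
    by (simp add: sum.distrib sum_product Int_commute)
  also have "(\<Sum>i\<in>I. \<Sum>j\<in>J. measure M (B j \<inter> A i)) = (\<Sum>i\<in>I. measure M (A i))"
    by (intro sum.cong refl fin_partition_sum_measure[OF B] As)
  finally show ?thesis using A1 B1 by simp
qed

lemma fin_partition_trivial: "fin_partition M (gen_sigma M N Z K) {0} (\<lambda>_. space M)"
  using sets.top[of "gen_sigma M N Z K"] by (auto simp: fin_partition_def disjoint_family_on_def)

lemma fin_partition_dependence_le_beta_coeff:
  assumes "n \<ge> 1" and A: "fin_partition M (gen_sigma M N Z {1..n}) I A"
    and B: "fin_partition M (gen_sigma M N Z {n + int k..}) J B"
  shows "(\<Sum>i\<in>I. \<Sum>j\<in>J. \<bar>measure M (A i \<inter> B j) - measure M (A i) * measure M (B j)\<bar>) \<le> beta_coeff M N Z k"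
proof -
  define T where "T n = {(\<Sum>i\<in>I. \<Sum>j\<in>J.
        \<bar>measure M (A i \<inter> B j) - measure M (A i) * measure M (B j)\<bar>) | I A J B.
        fin_partition M (gen_sigma M N Z {1..n}) I A \<and>
        fin_partition M (gen_sigma M N Z {n + int k..}) J B}" for n
  have le2: "x \<le> 2" if "x \<in> T n" for x n
    using that fin_partition_dependence_le_2 by (auto simp: T_def)
  have ne: "T n \<noteq> {}" for n
    unfolding T_def using fin_partition_trivial by blast
  have "(\<Sum>i\<in>I. \<Sum>j\<in>J. \<bar>measure M (A i \<inter> B j) - measure M (A i) * measure M (B j)\<bar>) \<in> T n"
    unfolding T_def using A B by blast
  then have "(\<Sum>i\<in>I. \<Sum>j\<in>J. \<bar>measure M (A i \<inter> B j) - measure M (A i) * measure M (B j)\<bar>) \<le> Sup (T n)"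
    by (rule cSup_upper) (use le2 in \<open>auto intro!: bdd_aboveI[of _ 2]\<close>)
  also have "Sup (T n) \<le> (SUP n\<in>{1::int..}. Sup (T n))"
  proof (rule cSUP_upper)
    show "bdd_above ((\<lambda>n. Sup (T n)) ` {1..})"
      by (rule bdd_aboveI[of _ 2]) (use ne le2 in \<open>auto intro!: cSup_least\<close>)
  qed (use assms in auto)
  also have "\<dots> = beta_coeff M N Z k" by (simp add: beta_coeff_def T_def)
  finally show ?thesis .
qed

lemma beta_coeff_nonneg: "beta_coeff M N Z k \<ge> 0"
  by (rule order_trans[OF _ fin_partition_dependence_le_beta_coeff[OF order_refl fin_partition_trivial fin_partition_trivial]])
     simp

lemma simple_approximation:
  assumes F: "F \<in> borel_measurable (gen_sigma M N Z K)" and le: "\<And>\<omega>. \<omega> \<in> space M \<Longrightarrow> \<bar>F \<omega>\<bar> \<le> 1"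
    and "m > (0::nat)"
  shows "\<exists>A x. fin_partition M (gen_sigma M N Z K) {..2 * m} A \<and> (\<forall>i\<le>2 * m. \<bar>x i\<bar> \<le> (1::real)) \<and>
    (\<forall>\<omega>\<in>space M. \<bar>F \<omega> - (\<Sum>i\<le>2 * m. x i * indicator (A i) \<omega>)\<bar> \<le> 1 / m)"
proof -
  \<comment> \<open>The integer part of m F lies between -m and m; adding \<open>m\<close> numbers
    the level sets from 0 to 2m.\<close>
  define idx where "idx \<omega> = nat (\<lfloor>real m * F \<omega>\<rfloor> + int m)" for \<omega>
  define x where "x i = (real i - real m) / real m" for i
  define A where "A i = {\<omega> \<in> space M. idx \<omega> = i}" for i
  have fl: "- int m \<le> \<lfloor>real m * F \<omega>\<rfloor>" "\<lfloor>real m * F \<omega>\<rfloor> \<le> int m" if "\<omega> \<in> space M" for \<omega>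
  proof -
    have "real m * F \<omega> \<le> real m * 1" "real m * (- 1) \<le> real m * F \<omega>"
      using le[OF that] by (intro mult_left_mono; simp add: abs_le_iff)+
    then show "- int m \<le> \<lfloor>real m * F \<omega>\<rfloor>" "\<lfloor>real m * F \<omega>\<rfloor> \<le> int m" by linarith+
  qed
  then have idx: "idx \<omega> \<le> 2 * m" if "\<omega> \<in> space M" for \<omega>
    using that[THEN fl(1)] that[THEN fl(2)] by (simp add: idx_def)
  have [measurable]: "idx \<in> measurable (gen_sigma M N Z K) (count_space UNIV)"
    unfolding idx_def using F by measurable
  have "A i \<in> sets (gen_sigma M N Z K)" for i
  proof -
    have "{\<omega> \<in> space (gen_sigma M N Z K). idx \<omega> = i} \<in> sets (gen_sigma M N Z K)" by measurable
    then show ?thesis by (simp add: A_def)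
  qed
  then have "fin_partition M (gen_sigma M N Z K) {..2 * m} A"
    using idx by (auto simp: fin_partition_def disjoint_family_on_def A_def)
  moreover have "\<bar>x i\<bar> \<le> 1" if "i \<le> 2 * m" for i
  proof -
    have "real i \<le> 2 * real m" using that by linarith
    then show ?thesis using \<open>m > 0\<close> by (simp add: x_def abs_le_iff field_simps)
  qed
  moreover have "\<bar>F \<omega> - (\<Sum>i\<le>2 * m. x i * indicator (A i) \<omega>)\<bar> \<le> 1 / m" if \<omega>: "\<omega> \<in> space M" for \<omega>
  proof -
    have "(\<Sum>i\<le>2 * m. x i * indicator (A i) \<omega>) = (\<Sum>i\<le>2 * m. if i = idx \<omega> then x i else 0)"
      using \<omega> by (intro sum.cong) (auto simp: A_def)
    also have "\<dots> = x (idx \<omega>)" using idx[OF \<omega>] by simp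
    also have "\<dots> = \<lfloor>real m * F \<omega>\<rfloor> / m" using fl(1)[OF \<omega>] by (simp add: x_def idx_def)
    also have "\<bar>F \<omega> - \<dots>\<bar> = \<bar>real m * F \<omega> - \<lfloor>real m * F \<omega>\<rfloor>\<bar> / m"
      using \<open>m > 0\<close> by (simp add: field_simps abs_divide flip: abs_mult)
    also have "\<dots> \<le> 1 / m" by (intro divide_right_mono) linarith+
    finally show ?thesis .
  qed
  ultimately show ?thesis by blast
qed

text \<open>For simple functions the covariance is a sum of the differences P(A_i B_j) - P(A_i)
  P(B_j) with weights of modulus at most 1. Since \<open>beta_coeff\<close> adds the absolute values
  of these differences over whole partitions, it bounds the covariance with constant 1. Uniform
  approximation by level sets gives the general case.\<close>

lemma beta_mixing_covariance:
  assumes "n \<ge> 1"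
    and F: "F \<in> borel_measurable (gen_sigma M N Z {1..n})" "\<And>\<omega>. \<omega> \<in> space M \<Longrightarrow> \<bar>F \<omega>\<bar> \<le> 1"
    and G: "G \<in> borel_measurable (gen_sigma M N Z {n + int k..})" "\<And>\<omega>. \<omega> \<in> space M \<Longrightarrow> \<bar>G \<omega>\<bar> \<le> 1"
  shows "\<bar>(\<integral>\<omega>. F \<omega> * G \<omega> \<partial>M) - (\<integral>\<omega>. F \<omega> \<partial>M) * (\<integral>\<omega>. G \<omega> \<partial>M)\<bar> \<le> beta_coeff M N Z k"
proof (rule field_le_epsilon)
  fix e :: real assume "e > 0"
  \<comment> \<open>Passing to simple functions costs 2/m in the mixed moment and 2/m in the product
    of the means.\<close>
  obtain m :: nat where m: "m > 0" "5 / real m < e"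
  proof -
    obtain m :: nat where "5 / e < real m" using reals_Archimedean2 by blast
    moreover have "0 < 5 / e" using \<open>e > 0\<close> by simp
    ultimately have "real m > 0" by linarith
    moreover from this have "5 / real m < e"
      using \<open>5 / e < real m\<close> \<open>e > 0\<close> by (simp add: pos_divide_less_eq mult.commute)
    ultimately show ?thesis using that[of m] by simp
  qed
  obtain A x where A: "fin_partition M (gen_sigma M N Z {1..n}) {..2 * m} A" and x: "\<And>i. i \<le> 2 * m \<Longrightarrow> \<bar>x i\<bar> \<le> (1::real)"
    and FA: "\<And>\<omega>. \<omega> \<in> space M \<Longrightarrow> \<bar>F \<omega> - (\<Sum>i\<le>2 * m. x i * indicator (A i) \<omega>)\<bar> \<le> 1 / m"
    using simple_approximation[OF F m(1)] by blast
  obtain B y where B: "fin_partition M (gen_sigma M N Z {n + int k..}) {..2 * m} B" and y: "\<And>i. i \<le> 2 * m \<Longrightarrow> \<bar>y i\<bar> \<le> (1::real)"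
    and GB: "\<And>\<omega>. \<omega> \<in> space M \<Longrightarrow> \<bar>G \<omega> - (\<Sum>i\<le>2 * m. y i * indicator (B i) \<omega>)\<bar> \<le> 1 / m"
    using simple_approximation[OF G m(1)] by blast
  define F' where "F' \<omega> = (\<Sum>i\<le>2 * m. x i * indicator (A i) \<omega>)" for \<omega>
  define G' where "G' \<omega> = (\<Sum>i\<le>2 * m. y i * indicator (B i) \<omega>)" for \<omega>
  note FA' = FA[folded F'_def] and GB' = GB[folded G'_def]
  note As[measurable] = fin_partition_gen_sigma_sets[OF A] and Bs[measurable] = fin_partition_gen_sigma_sets[OF B]
  note [measurable] = measurable_from_subalg[OF gen_sigma_sub F(1)]
    measurable_from_subalg[OF gen_sigma_sub G(1)]
  have iF: "integrable M F" and iG: "integrable M G"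
    using F(2) G(2) by (auto intro!: integrable_const_bound[of _ 1])
  have iFG: "integrable M (\<lambda>\<omega>. F \<omega> * G \<omega>)"
    using F(2) G(2) by (auto intro!: integrable_const_bound[of _ 1] simp: abs_mult mult_le_one)
  have iA: "integrable M (indicator (A i) :: 'a \<Rightarrow> real)" and iB: "integrable M (indicator (B i) :: 'a \<Rightarrow> real)" if "i \<le> 2 * m" for i
    using As[of i] Bs[of i] that by (auto simp: emeasure_eq_measure)
  have iAB: "integrable M (\<lambda>\<omega>. x i * y j * indicator (A i \<inter> B j) \<omega>)" if "i \<le> 2 * m" "j \<le> 2 * m" for i j
    using As[of i] Bs[of j] that by (intro integrable_mult_right) (auto simp: emeasure_eq_measure)
  have iF': "integrable M F'" and iG': "integrable M G'"
    unfolding F'_def G'_def using iA iB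
    by (intro Bochner_Integration.integrable_sum integrable_mult_right; simp)+
  have EF': "(\<integral>\<omega>. F' \<omega> \<partial>M) = (\<Sum>i\<le>2 * m. x i * measure M (A i))"
    unfolding F'_def using iA sets.sets_into_space[OF As]
    by (subst Bochner_Integration.integral_sum) (auto intro!: sum.cong simp: Int_absorb2)
  have EG': "(\<integral>\<omega>. G' \<omega> \<partial>M) = (\<Sum>i\<le>2 * m. y i * measure M (B i))"
    unfolding G'_def using iB sets.sets_into_space[OF Bs]
    by (subst Bochner_Integration.integral_sum) (auto intro!: sum.cong simp: Int_absorb2)
  have FG': "F' \<omega> * G' \<omega> = (\<Sum>i\<le>2 * m. \<Sum>j\<le>2 * m. x i * y j * indicator (A i \<inter> B j) \<omega>)" for \<omega>
    unfolding F'_def G'_def sum_product by (intro sum.cong refl) (simp add: indicator_inter_arith)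
  have iFG': "integrable M (\<lambda>\<omega>. F' \<omega> * G' \<omega>)"
    unfolding FG' using iAB by (intro Bochner_Integration.integrable_sum) auto
  have EFG': "(\<integral>\<omega>. F' \<omega> * G' \<omega> \<partial>M) = (\<Sum>i\<le>2 * m. \<Sum>j\<le>2 * m. x i * y j * measure M (A i \<inter> B j))"
    unfolding FG' using iAB sets.sets_into_space[OF As]
    by (subst Bochner_Integration.integral_sum, intro Bochner_Integration.integrable_sum, simp,
        intro sum.cong refl, subst Bochner_Integration.integral_sum, simp)
       (auto intro!: sum.cong simp: Int_absorb2 le_infI1)
  have abs_F': "\<bar>F' \<omega>\<bar> \<le> 1" if "\<omega> \<in> space M" for \<omega>
  proof -
    have "\<omega> \<in> (\<Union>i\<in>{..2 * m}. A i)" using A that by (simp add: fin_partition_def)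
    then obtain i where i: "i \<le> 2 * m" "\<omega> \<in> A i" by auto
    have disj: "disjoint_family_on A {..2 * m}" using A by (simp add: fin_partition_def)
    then have "\<omega> \<notin> A j" if "j \<le> 2 * m" "j \<noteq> i" for j
      using disjoint_family_onD[OF disj, of i j] i that by auto
    then have "F' \<omega> = (\<Sum>j\<le>2 * m. if j = i then x j else 0)" unfolding F'_def
      using i by (intro sum.cong refl) (auto simp: indicator_def)
    then show ?thesis using i x by simp
  qed
  have "\<bar>(\<integral>\<omega>. F' \<omega> * G' \<omega> \<partial>M) - (\<integral>\<omega>. F' \<omega> \<partial>M) * (\<integral>\<omega>. G' \<omega> \<partial>M)\<bar>
    = \<bar>\<Sum>i\<le>2 * m. \<Sum>j\<le>2 * m. x i * y j * (measure M (A i \<inter> B j) - measure M (A i) * measure M (B j))\<bar>"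
    unfolding EF' EG' EFG' by (simp add: sum_product right_diff_distrib sum_subtractf mult_ac)
  also have "\<dots> \<le> (\<Sum>i\<le>2 * m. \<Sum>j\<le>2 * m. \<bar>measure M (A i \<inter> B j) - measure M (A i) * measure M (B j)\<bar>)"
  proof (intro sum_norm_le[where 'a = real, unfolded real_norm_def])
    fix i j assume "i \<in> {..2 * m}" "j \<in> {..2 * m}"
    then have "\<bar>x i\<bar> * \<bar>y j\<bar> \<le> 1" using x y by (intro mult_le_one) auto
    then show "\<bar>x i * y j * (measure M (A i \<inter> B j) - measure M (A i) * measure M (B j))\<bar>
       \<le> \<bar>measure M (A i \<inter> B j) - measure M (A i) * measure M (B j)\<bar>"
      by (simp add: abs_mult mult_left_le_one_le)
  qed
  also have "\<dots> \<le> beta_coeff M N Z k"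
    by (rule fin_partition_dependence_le_beta_coeff[OF \<open>n \<ge> 1\<close> A B])
  finally have *: "\<bar>(\<integral>\<omega>. F' \<omega> * G' \<omega> \<partial>M) - (\<integral>\<omega>. F' \<omega> \<partial>M) * (\<integral>\<omega>. G' \<omega> \<partial>M)\<bar> \<le> beta_coeff M N Z k" .
  have close: "\<bar>(\<integral>\<omega>. f \<omega> \<partial>M) - (\<integral>\<omega>. g \<omega> \<partial>M)\<bar> \<le> c"
    if "integrable M f" "integrable M g" "\<And>\<omega>. \<omega> \<in> space M \<Longrightarrow> \<bar>f \<omega> - g \<omega>\<bar> \<le> c" for f g and c :: real
  proof -
    have "\<bar>(\<integral>\<omega>. f \<omega> \<partial>M) - (\<integral>\<omega>. g \<omega> \<partial>M)\<bar> = \<bar>\<integral>\<omega>. f \<omega> - g \<omega> \<partial>M\<bar>" using that by simp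
    also have "\<dots> \<le> (\<integral>\<omega>. \<bar>f \<omega> - g \<omega>\<bar> \<partial>M)" by (rule integral_abs_bound)
    also have "\<dots> \<le> (\<integral>\<omega>. c \<partial>M)" using that by (intro integral_mono) auto
    finally show ?thesis by (simp add: prob_space)
  qed
  have bd: "\<bar>a * b - c * d\<bar> \<le> 2 / m" if "\<bar>b\<bar> \<le> 1" "\<bar>c\<bar> \<le> 1" "\<bar>a - c\<bar> \<le> 1 / m" "\<bar>b - d\<bar> \<le> 1 / m" for a b c d :: real
  proof -
    have "\<bar>a * b - c * d\<bar> = \<bar>(a - c) * b + c * (b - d)\<bar>" by (simp add: algebra_simps)
    also have "\<dots> \<le> \<bar>a - c\<bar> * \<bar>b\<bar> + \<bar>c\<bar> * \<bar>b - d\<bar>"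
      by (metis abs_mult abs_triangle_ineq)
    also have "\<dots> \<le> (1 / m) * 1 + 1 * (1 / m)" using that by (intro add_mono mult_mono) auto
    finally show ?thesis by simp
  qed
  have "\<bar>(\<integral>\<omega>. F \<omega> * G \<omega> \<partial>M) - (\<integral>\<omega>. F' \<omega> * G' \<omega> \<partial>M)\<bar> \<le> 2 / m"
    using G(2) abs_F' FA' GB' by (intro close iFG iFG' bd)
  moreover have "\<bar>(\<integral>\<omega>. F \<omega> \<partial>M) * (\<integral>\<omega>. G \<omega> \<partial>M) - (\<integral>\<omega>. F' \<omega> \<partial>M) * (\<integral>\<omega>. G' \<omega> \<partial>M)\<bar> \<le> 2 / m"
  proof (rule bd)
    show "\<bar>(\<integral>\<omega>. G \<omega> \<partial>M)\<bar> \<le> 1" using close[of G "\<lambda>_. 0" 1] G(2) iG by simp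
    show "\<bar>(\<integral>\<omega>. F' \<omega> \<partial>M)\<bar> \<le> 1" using close[of F' "\<lambda>_. 0" 1] abs_F' iF' by simp
  qed (use FA' GB' in \<open>auto intro!: close iF iG iF' iG'\<close>)
  moreover have "2 / real m + 2 / real m \<le> e" using m by (simp add: field_simps)
  ultimately show "\<bar>(\<integral>\<omega>. F \<omega> * G \<omega> \<partial>M) - (\<integral>\<omega>. F \<omega> \<partial>M) * (\<integral>\<omega>. G \<omega> \<partial>M)\<bar> \<le> beta_coeff M N Z k + e"
    using * by linarith
qed

text \<open>Real and imaginary parts give four real covariances, each bounded by
  \<open>beta_coeff\<close>.\<close>

lemma beta_mixing_covariance_complex:
  fixes F G :: "'a \<Rightarrow> complex"
  assumes "n \<ge> 1"
    and F: "F \<in> borel_measurable (gen_sigma M N Z {1..n})" "\<And>\<omega>. \<omega> \<in> space M \<Longrightarrow> norm (F \<omega>) \<le> 1"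
    and G: "G \<in> borel_measurable (gen_sigma M N Z {n + int k..})" "\<And>\<omega>. \<omega> \<in> space M \<Longrightarrow> norm (G \<omega>) \<le> 1"
  shows "norm ((\<integral>\<omega>. F \<omega> * G \<omega> \<partial>M) - (\<integral>\<omega>. F \<omega> \<partial>M) * (\<integral>\<omega>. G \<omega> \<partial>M)) \<le> 4 * beta_coeff M N Z k"
proof -
  note [measurable] = measurable_from_subalg[OF gen_sigma_sub F(1)]
    measurable_from_subalg[OF gen_sigma_sub G(1)]
  note le = order_trans[OF abs_Re_le_cmod] order_trans[OF abs_Im_le_cmod]
  have i[simp]: "integrable M F" "integrable M G" "integrable M (\<lambda>\<omega>. F \<omega> * G \<omega>)"
    using F(2) G(2) by (auto intro!: integrable_const_bound[of _ 1] simp: norm_mult mult_le_one)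
  have r[simp]: "integrable M (\<lambda>\<omega>. Re (F \<omega>) * Re (G \<omega>))" "integrable M (\<lambda>\<omega>. Im (F \<omega>) * Im (G \<omega>))"
    "integrable M (\<lambda>\<omega>. Re (F \<omega>) * Im (G \<omega>))" "integrable M (\<lambda>\<omega>. Im (F \<omega>) * Re (G \<omega>))"
    using le[OF F(2)] le[OF G(2)]
    by (auto intro!: integrable_const_bound[of _ 1] AE_I2 mult_le_one simp: abs_mult)
  have c: "\<bar>(\<integral>\<omega>. f (F \<omega>) * g (G \<omega>) \<partial>M) - (\<integral>\<omega>. f (F \<omega>) \<partial>M) * (\<integral>\<omega>. g (G \<omega>) \<partial>M)\<bar> \<le> beta_coeff M N Z k"
    if "f \<in> {Re, Im}" "g \<in> {Re, Im}" for f g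
    using that F(1) G(1) le[OF F(2)] le[OF G(2)]
    by (intro beta_mixing_covariance[OF \<open>n \<ge> 1\<close>]) auto
  let ?D = "(\<integral>\<omega>. F \<omega> * G \<omega> \<partial>M) - (\<integral>\<omega>. F \<omega> \<partial>M) * (\<integral>\<omega>. G \<omega> \<partial>M)"
  have "Re ?D = ((\<integral>\<omega>. Re (F \<omega>) * Re (G \<omega>) \<partial>M) - (\<integral>\<omega>. Re (F \<omega>) \<partial>M) * (\<integral>\<omega>. Re (G \<omega>) \<partial>M))
     - ((\<integral>\<omega>. Im (F \<omega>) * Im (G \<omega>) \<partial>M) - (\<integral>\<omega>. Im (F \<omega>) \<partial>M) * (\<integral>\<omega>. Im (G \<omega>) \<partial>M))"
    by (simp flip: integral_Re integral_Im)
  moreover have "Im ?D = ((\<integral>\<omega>. Re (F \<omega>) * Im (G \<omega>) \<partial>M) - (\<integral>\<omega>. Re (F \<omega>) \<partial>M) * (\<integral>\<omega>. Im (G \<omega>) \<partial>M))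
     + ((\<integral>\<omega>. Im (F \<omega>) * Re (G \<omega>) \<partial>M) - (\<integral>\<omega>. Im (F \<omega>) \<partial>M) * (\<integral>\<omega>. Re (G \<omega>) \<partial>M))"
    by (simp flip: integral_Re integral_Im)
  ultimately have "\<bar>Re ?D\<bar> + \<bar>Im ?D\<bar> \<le> 4 * beta_coeff M N Z k"
    using c[of Re Re] c[of Im Im] c[of Re Im] c[of Im Re] by simp
  then show ?thesis using cmod_le[of ?D] by linarith
qed

end

section \<open>Approximation by finite windows\<close>

lemma norm_cis_diff_le: "norm (cis x - cis y) \<le> \<bar>x - y\<bar>"
proof -
  have "cis x - cis y = cis y * (cis (x - y) - 1)"
    by (simp add: right_diff_distrib cis_mult)
  then have "norm (cis x - cis y) = norm (cis (x - y) - 1)" by (simp add: norm_mult)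
  also have "\<dots> \<le> \<bar>x - y\<bar>" using iexp_approx1[of "x - y" 0] by (simp add: cis_conv_exp)
  finally show ?thesis .
qed

lemma norm_cis_taylor2: "norm (cis x - (1 + \<i> * x - x\<^sup>2 / 2)) \<le> \<bar>x\<bar> ^ 3 / 6"
  using iexp_approx1[of x 2]
  by (simp add: cis_conv_exp eval_nat_numeral power2_eq_square algebra_simps)

text \<open>Replacing 1 - y by exp(-y) for a single block makes the power over all blocks an exact
  exponential.\<close>

lemma abs_exp_minus_taylor1:
  fixes y :: real assumes "y \<ge> 0" shows "\<bar>exp (- y) - (1 - y)\<bar> \<le> y\<^sup>2"
proof -
  have "exp (- y) \<ge> 1 - y" using exp_ge_add_one_self[of "- y"] by simp
  moreover have "exp (- y) \<le> 1 - y + y\<^sup>2"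
  proof -
    have "exp (- y) \<le> 1 / (1 + y)"
      using exp_ge_add_one_self[of y] assms by (simp add: exp_minus field_simps)
    also have "\<dots> \<le> 1 - y + y\<^sup>2"
    proof -
      have "1 \<le> 1 + y ^ 3" using assms by simp
      also have "\<dots> = (1 - y + y\<^sup>2) * (1 + y)" by (simp add: algebra_simps power2_eq_square power3_eq_cube)
      finally show ?thesis using assms by (simp add: pos_divide_le_eq)
    qed
    finally show ?thesis .
  qed
  ultimately show ?thesis by (simp add: abs_le_iff)
qed

context prob_space
begin

lemma integrable_bounded:
  fixes f :: "'a \<Rightarrow> 'c::{banach, second_countable_topology}"
  assumes "f \<in> borel_measurable M" "\<And>\<omega>. \<omega> \<in> space M \<Longrightarrow> norm (f \<omega>) \<le> B"
  shows "integrable M f"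
  by (rule integrable_const_bound[of _ B]) (use assms in auto)

lemma cis_borel_measurable [measurable]: "cis \<in> borel_measurable borel"
  by (intro borel_measurable_continuous_onI continuous_intros)

lemma expectation_cis_diff_le:
  assumes [measurable]: "f \<in> borel_measurable M" "g \<in> borel_measurable M"
    and "integrable M (\<lambda>\<omega>. \<bar>f \<omega> - g \<omega>\<bar>)"
  shows "norm ((\<integral>\<omega>. cis (f \<omega>) \<partial>M) - (\<integral>\<omega>. cis (g \<omega>) \<partial>M)) \<le> (\<integral>\<omega>. \<bar>f \<omega> - g \<omega>\<bar> \<partial>M)"
proof -
  have i: "integrable M (\<lambda>\<omega>. cis (f \<omega>))" "integrable M (\<lambda>\<omega>. cis (g \<omega>))"
    by (rule integrable_bounded[of _ 1]; simp)+
  then have "(\<integral>\<omega>. cis (f \<omega>) \<partial>M) - (\<integral>\<omega>. cis (g \<omega>) \<partial>M) = (\<integral>\<omega>. cis (f \<omega>) - cis (g \<omega>) \<partial>M)" by simp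
  also have "norm \<dots> \<le> (\<integral>\<omega>. norm (cis (f \<omega>) - cis (g \<omega>)) \<partial>M)" by (rule integral_norm_bound)
  also have "\<dots> \<le> (\<integral>\<omega>. \<bar>f \<omega> - g \<omega>\<bar> \<partial>M)"
    using i by (intro integral_mono assms integrable_norm Bochner_Integration.integrable_diff norm_cis_diff_le)
  finally show ?thesis .
qed

lemma norm_expectation_cis_le_1: "norm (\<integral>\<omega>. cis (f \<omega>) \<partial>M) \<le> 1"
proof -
  have "norm (\<integral>\<omega>. cis (f \<omega>) \<partial>M) \<le> (\<integral>\<omega>. norm (cis (f \<omega>)) \<partial>M)" by (rule integral_norm_bound)
  then show ?thesis by (simp add: prob_space)
qed

lemma expectation_abs_le_sqrt:
  assumes [measurable]: "f \<in> borel_measurable M" and "integrable M (\<lambda>\<omega>. (f \<omega>)\<^sup>2)"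
  shows "(\<integral>\<omega>. \<bar>f \<omega>\<bar> \<partial>M) \<le> sqrt (\<integral>\<omega>. (f \<omega>)\<^sup>2 \<partial>M)"
proof (rule real_le_rsqrt)
  have "integrable M (\<lambda>\<omega>. \<bar>f \<omega>\<bar>)"
    by (rule square_integrable_imp_integrable) (use assms in auto)
  then have "variance (\<lambda>\<omega>. \<bar>f \<omega>\<bar>) = (\<integral>\<omega>. (f \<omega>)\<^sup>2 \<partial>M) - (\<integral>\<omega>. \<bar>f \<omega>\<bar> \<partial>M)\<^sup>2"
    using variance_eq[of "\<lambda>\<omega>. \<bar>f \<omega>\<bar>"] assms by simp
  then show "(\<integral>\<omega>. \<bar>f \<omega>\<bar> \<partial>M)\<^sup>2 \<le> (\<integral>\<omega>. (f \<omega>)\<^sup>2 \<partial>M)"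
    using variance_positive[of "\<lambda>\<omega>. \<bar>f \<omega>\<bar>"] by simp
qed

end

text \<open>The rate is asked for some index \<open>i\<close> up to \<open>k\<close>, as
  \<open>running_min_cubic_rate\<close> provides it. Sigma-algebras separated by a gap
  \<open>k\<close> are also separated by the smaller gap \<open>i\<close>, so the coefficient at
  \<open>i\<close> bounds their dependence.\<close>

locale beta_mixing_rate = prob_space M for M :: "'a measure" +
  fixes N :: "'b measure" and Z :: "int \<Rightarrow> 'a \<Rightarrow> 'b" and C :: real
  assumes Z_measurable: "\<And>t. Z t \<in> measurable M N"
    and mixing: "\<And>k. \<exists>i\<le>k. beta_coeff M N Z i \<le> C / (real k + 1) ^ 3"
begin

lemmas gen_sigma_subM = subalgebra_gen_sigma[of Z M N, OF Z_measurable]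

lemma C_nonneg: "C \<ge> 0"
  using mixing[of 0] beta_coeff_nonneg[of M Z N 0, OF prob_space_axioms Z_measurable] by simp

lemma measurable_gen_sigma_mono:
  "f \<in> borel_measurable (gen_sigma M N Z I) \<Longrightarrow> I \<subseteq> J \<Longrightarrow> f \<in> borel_measurable (gen_sigma M N Z J)"
  using measurable_from_subalg[OF subalgebra_gen_sigma_mono] .

lemma measurable_gen_sigma_M:
  "f \<in> borel_measurable (gen_sigma M N Z I) \<Longrightarrow> f \<in> borel_measurable M"
  using measurable_from_subalg[OF gen_sigma_subM] .

lemma covariance_gap:
  fixes F G :: "'a \<Rightarrow> complex"
  assumes "n \<ge> 1"
    and F: "F \<in> borel_measurable (gen_sigma M N Z {1..n})" "\<And>\<omega>. \<omega> \<in> space M \<Longrightarrow> norm (F \<omega>) \<le> 1"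
    and G: "G \<in> borel_measurable (gen_sigma M N Z {n + int k..})" "\<And>\<omega>. \<omega> \<in> space M \<Longrightarrow> norm (G \<omega>) \<le> 1"
  shows "norm ((\<integral>\<omega>. F \<omega> * G \<omega> \<partial>M) - (\<integral>\<omega>. F \<omega> \<partial>M) * (\<integral>\<omega>. G \<omega> \<partial>M)) \<le> 4 * C / (real k + 1) ^ 3"
proof -
  obtain i where i: "i \<le> k" "beta_coeff M N Z i \<le> C / (real k + 1) ^ 3" using mixing by blast
  have "norm ((\<integral>\<omega>. F \<omega> * G \<omega> \<partial>M) - (\<integral>\<omega>. F \<omega> \<partial>M) * (\<integral>\<omega>. G \<omega> \<partial>M)) \<le> 4 * beta_coeff M N Z i"
    using i(1) F G by (intro beta_mixing_covariance_complex[OF prob_space_axioms Z_measurable \<open>n \<ge> 1\<close>])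
      (auto intro: measurable_gen_sigma_mono)
  then show ?thesis using i(2) by simp
qed

lemma covariance_gap_real:
  fixes F G :: "'a \<Rightarrow> real"
  assumes "n \<ge> 1" "K > 0"
    and F: "F \<in> borel_measurable (gen_sigma M N Z {1..n})" "\<And>\<omega>. \<omega> \<in> space M \<Longrightarrow> \<bar>F \<omega>\<bar> \<le> K"
    and G: "G \<in> borel_measurable (gen_sigma M N Z {n + int k..})" "\<And>\<omega>. \<omega> \<in> space M \<Longrightarrow> \<bar>G \<omega>\<bar> \<le> K"
  shows "\<bar>(\<integral>\<omega>. F \<omega> * G \<omega> \<partial>M) - (\<integral>\<omega>. F \<omega> \<partial>M) * (\<integral>\<omega>. G \<omega> \<partial>M)\<bar> \<le> K\<^sup>2 * C / (real k + 1) ^ 3"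
proof -
  obtain i where i: "i \<le> k" "beta_coeff M N Z i \<le> C / (real k + 1) ^ 3" using mixing by blast
  have "\<bar>(\<integral>\<omega>. F \<omega> / K * (G \<omega> / K) \<partial>M) - (\<integral>\<omega>. F \<omega> / K \<partial>M) * (\<integral>\<omega>. G \<omega> / K \<partial>M)\<bar> \<le> beta_coeff M N Z i"
    using i(1) F G \<open>K > 0\<close>
    by (intro beta_mixing_covariance[OF prob_space_axioms Z_measurable \<open>n \<ge> 1\<close>])
      (auto intro!: borel_measurable_divide intro: measurable_gen_sigma_mono)
  also have "(\<integral>\<omega>. F \<omega> / K * (G \<omega> / K) \<partial>M) - (\<integral>\<omega>. F \<omega> / K \<partial>M) * (\<integral>\<omega>. G \<omega> / K \<partial>M)
    = ((\<integral>\<omega>. F \<omega> * G \<omega> \<partial>M) - (\<integral>\<omega>. F \<omega> \<partial>M) * (\<integral>\<omega>. G \<omega> \<partial>M)) / K\<^sup>2"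
    by (simp add: power2_eq_square diff_divide_distrib)
  finally have "\<bar>(\<integral>\<omega>. F \<omega> * G \<omega> \<partial>M) - (\<integral>\<omega>. F \<omega> \<partial>M) * (\<integral>\<omega>. G \<omega> \<partial>M)\<bar> \<le> beta_coeff M N Z i * K\<^sup>2"
    using \<open>K > 0\<close> by (simp add: abs_divide pos_divide_le_eq)
  also have "\<dots> \<le> C / (real k + 1) ^ 3 * K\<^sup>2" using i(2) by (intro mult_right_mono) auto
  finally show ?thesis by (simp add: mult.commute)
qed

text \<open>The bound \<open>K\<close> is imposed on the approximants too, so that products of two
  variables can be replaced by products of approximants at a cost linear in the mean absolute
  errors.\<close>

definition approximable :: "(int \<Rightarrow> 'a \<Rightarrow> real) \<Rightarrow> (nat \<Rightarrow> int \<Rightarrow> 'a \<Rightarrow> real) \<Rightarrow> real \<Rightarrow> real \<Rightarrow> bool" where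
  "approximable U V K D \<longleftrightarrow> K > 0 \<and>
     (\<forall>t. U t \<in> borel_measurable M \<and> (\<forall>\<omega>\<in>space M. \<bar>U t \<omega>\<bar> \<le> K)) \<and>
     (\<forall>l t. V l t \<in> borel_measurable (gen_sigma M N Z {t - int l..t + int l}) \<and>
       (\<forall>\<omega>\<in>space M. \<bar>V l t \<omega>\<bar> \<le> K) \<and> (\<integral>\<omega>. \<bar>U t \<omega> - V l t \<omega>\<bar> \<partial>M) \<le> D / (real l + 1) ^ 3)"

lemma approximable_D_nonneg: 
  assumes "approximable U V K D" shows "D \<ge> 0"
proof -
  have "0 \<le> (\<integral>\<omega>. \<bar>U 0 \<omega> - V 0 0 \<omega>\<bar> \<partial>M)" by simp
  also have "\<dots> \<le> D / (real 0 + 1) ^ 3" using assms unfolding approximable_def by blast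
  finally show ?thesis by simp
qed

text \<open>The lag is divided into thirds: windows of radius l = \<open>k div 3\<close> around
  \<open>s\<close> and \<open>s + k\<close> are still at least \<open>l\<close> apart. The bound on
  \<open>s\<close> keeps the left window among the positive indices, to which
  \<open>beta_coeff\<close> refers. Each of the two replacements of \<open>A\<close>,
  \<open>B\<close> by \<open>V\<close>, \<open>W\<close> costs 2KD, and 27 is the cube of 3 in k + 1
  <= 3(l + 1).\<close>

lemma covariance_decay:
  assumes A: "approximable A V K D" and B: "approximable B W K D"
    and s: "s \<ge> int (k div 3) + 1"
  shows "\<bar>(\<integral>\<omega>. A s \<omega> * B (s + int k) \<omega> \<partial>M) - (\<integral>\<omega>. A s \<omega> \<partial>M) * (\<integral>\<omega>. B (s + int k) \<omega> \<partial>M)\<bar>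
     \<le> 27 * (4 * K * D + K\<^sup>2 * C) / (real k + 1) ^ 3"
proof -
  define l where "l = k div 3"
  define t where "t = s + int k"
  have "K > 0" using A by (simp add: approximable_def)
  have Am[measurable]: "A s \<in> borel_measurable M" "B t \<in> borel_measurable M"
    using A B by (auto simp: approximable_def)
  have Vm: "V l s \<in> borel_measurable (gen_sigma M N Z {s - int l..s + int l})"
    "W l t \<in> borel_measurable (gen_sigma M N Z {t - int l..t + int l})"
    using A B by (auto simp: approximable_def)
  note [measurable] = Vm[THEN measurable_gen_sigma_M]
  have bd: "\<bar>A s \<omega>\<bar> \<le> K" "\<bar>B t \<omega>\<bar> \<le> K" "\<bar>V l s \<omega>\<bar> \<le> K" "\<bar>W l t \<omega>\<bar> \<le> K" if "\<omega> \<in> space M" for \<omega>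
    using A B that by (auto simp: approximable_def)
  have err: "(\<integral>\<omega>. \<bar>A s \<omega> - V l s \<omega>\<bar> \<partial>M) \<le> D / (real l + 1) ^ 3" "(\<integral>\<omega>. \<bar>B t \<omega> - W l t \<omega>\<bar> \<partial>M) \<le> D / (real l + 1) ^ 3"
    using A B by (auto simp: approximable_def)
  have i: "integrable M (A s)" "integrable M (B t)" "integrable M (V l s)" "integrable M (W l t)"
    by (rule integrable_bounded[of _ K]; use bd in simp)+
  have ii: "integrable M (\<lambda>\<omega>. A s \<omega> * B t \<omega>)" "integrable M (\<lambda>\<omega>. V l s \<omega> * W l t \<omega>)"
    by (rule integrable_bounded[of _ "K * K"]; use bd \<open>K > 0\<close> in \<open>auto simp: abs_mult intro!: mult_mono\<close>)+
  have ab: "\<bar>a * b - v * w\<bar> \<le> K * \<bar>a - v\<bar> + K * \<bar>b - w\<bar>" if "\<bar>b\<bar> \<le> K" "\<bar>v\<bar> \<le> K" for a b v w :: real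
  proof -
    have "\<bar>a * b - v * w\<bar> = \<bar>b * (a - v) + v * (b - w)\<bar>" by (simp add: algebra_simps)
    also have "\<dots> \<le> \<bar>b\<bar> * \<bar>a - v\<bar> + \<bar>v\<bar> * \<bar>b - w\<bar>" by (metis abs_mult abs_triangle_ineq)
    also have "\<dots> \<le> K * \<bar>a - v\<bar> + K * \<bar>b - w\<bar>" using that by (intro add_mono mult_right_mono) auto
    finally show ?thesis .
  qed
  have 1: "\<bar>(\<integral>\<omega>. A s \<omega> * B t \<omega> \<partial>M) - (\<integral>\<omega>. V l s \<omega> * W l t \<omega> \<partial>M)\<bar> \<le> 2 * K * D / (real l + 1) ^ 3"
  proof -
    have "\<bar>(\<integral>\<omega>. A s \<omega> * B t \<omega> \<partial>M) - (\<integral>\<omega>. V l s \<omega> * W l t \<omega> \<partial>M)\<bar> = \<bar>\<integral>\<omega>. A s \<omega> * B t \<omega> - V l s \<omega> * W l t \<omega> \<partial>M\<bar>"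
      using ii by simp
    also have "\<dots> \<le> (\<integral>\<omega>. \<bar>A s \<omega> * B t \<omega> - V l s \<omega> * W l t \<omega>\<bar> \<partial>M)" by (rule integral_abs_bound)
    also have "\<dots> \<le> (\<integral>\<omega>. K * \<bar>A s \<omega> - V l s \<omega>\<bar> + K * \<bar>B t \<omega> - W l t \<omega>\<bar> \<partial>M)"
      using i ii bd by (intro integral_mono ab) auto
    also have "\<dots> = K * (\<integral>\<omega>. \<bar>A s \<omega> - V l s \<omega>\<bar> \<partial>M) + K * (\<integral>\<omega>. \<bar>B t \<omega> - W l t \<omega>\<bar> \<partial>M)"
      using i by simp
    also have "\<dots> \<le> K * (D / (real l + 1) ^ 3) + K * (D / (real l + 1) ^ 3)"
      using err \<open>K > 0\<close> by (intro add_mono mult_left_mono) auto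
    finally show ?thesis by (simp add: mult_ac)
  qed
  have mean: "\<bar>(\<integral>\<omega>. f \<omega> \<partial>M)\<bar> \<le> K" if "integrable M f" "\<And>\<omega>. \<omega> \<in> space M \<Longrightarrow> \<bar>f \<omega>\<bar> \<le> K" for f
  proof -
    have "\<bar>(\<integral>\<omega>. f \<omega> \<partial>M)\<bar> \<le> (\<integral>\<omega>. \<bar>f \<omega>\<bar> \<partial>M)" by (rule integral_abs_bound)
    also have "\<dots> \<le> (\<integral>\<omega>. K \<partial>M)" using that by (intro integral_mono) auto
    finally show ?thesis by (simp add: prob_space)
  qed
  have diff: "\<bar>(\<integral>\<omega>. f \<omega> \<partial>M) - (\<integral>\<omega>. g \<omega> \<partial>M)\<bar> \<le> (\<integral>\<omega>. \<bar>f \<omega> - g \<omega>\<bar> \<partial>M)" if "integrable M f" "integrable M g" for f g :: "'a \<Rightarrow> real"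
    using integral_abs_bound[of M "\<lambda>\<omega>. f \<omega> - g \<omega>"] that by simp
  have 2: "\<bar>(\<integral>\<omega>. A s \<omega> \<partial>M) * (\<integral>\<omega>. B t \<omega> \<partial>M) - (\<integral>\<omega>. V l s \<omega> \<partial>M) * (\<integral>\<omega>. W l t \<omega> \<partial>M)\<bar> \<le> 2 * K * D / (real l + 1) ^ 3"
  proof -
    have "\<bar>(\<integral>\<omega>. A s \<omega> \<partial>M) * (\<integral>\<omega>. B t \<omega> \<partial>M) - (\<integral>\<omega>. V l s \<omega> \<partial>M) * (\<integral>\<omega>. W l t \<omega> \<partial>M)\<bar>
      \<le> K * \<bar>(\<integral>\<omega>. A s \<omega> \<partial>M) - (\<integral>\<omega>. V l s \<omega> \<partial>M)\<bar> + K * \<bar>(\<integral>\<omega>. B t \<omega> \<partial>M) - (\<integral>\<omega>. W l t \<omega> \<partial>M)\<bar>"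
      using i bd by (intro ab mean) auto
    also have "\<dots> \<le> K * (D / (real l + 1) ^ 3) + K * (D / (real l + 1) ^ 3)"
      using \<open>K > 0\<close> diff[OF i(1,3)] diff[OF i(2,4)] err by (intro add_mono mult_left_mono) auto
    finally show ?thesis by (simp add: mult_ac)
  qed
  have kl: "2 * l \<le> k" "l \<le> k - 2 * l" "k \<le> 3 * l + 2" by (auto simp: l_def)
  have 3: "\<bar>(\<integral>\<omega>. V l s \<omega> * W l t \<omega> \<partial>M) - (\<integral>\<omega>. V l s \<omega> \<partial>M) * (\<integral>\<omega>. W l t \<omega> \<partial>M)\<bar> \<le> K\<^sup>2 * C / (real l + 1) ^ 3"
  proof (rule covariance_gap_real[of "s + int l"])
    show "V l s \<in> borel_measurable (gen_sigma M N Z {1..s + int l})"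
      using s by (intro measurable_gen_sigma_mono[OF Vm(1)]) (auto simp: l_def)
    show "W l t \<in> borel_measurable (gen_sigma M N Z {s + int l + int l..})"
      using kl by (intro measurable_gen_sigma_mono[OF Vm(2)]) (auto simp: t_def)
  qed (use s bd \<open>K > 0\<close> in auto)
  have "D \<ge> 0" by (rule approximable_D_nonneg[OF A])
  have tri: "\<bar>a - b\<bar> \<le> x + y + z" if "\<bar>a - v\<bar> \<le> x" "\<bar>b - w\<bar> \<le> y" "\<bar>v - w\<bar> \<le> z" for a b v w x y z :: real
    using that by linarith
  have "\<bar>(\<integral>\<omega>. A s \<omega> * B t \<omega> \<partial>M) - (\<integral>\<omega>. A s \<omega> \<partial>M) * (\<integral>\<omega>. B t \<omega> \<partial>M)\<bar>
    \<le> 2 * K * D / (real l + 1) ^ 3 + 2 * K * D / (real l + 1) ^ 3 + K\<^sup>2 * C / (real l + 1) ^ 3"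
    by (rule tri[OF 1 2 3])
  also have "\<dots> = (4 * K * D + K\<^sup>2 * C) / (real l + 1) ^ 3" by (simp add: add_divide_distrib)
  also have "\<dots> \<le> (4 * K * D + K\<^sup>2 * C) / ((real k + 1) / 3) ^ 3"
    using kl(3) \<open>K > 0\<close> \<open>D \<ge> 0\<close> C_nonneg
    by (intro divide_left_mono power_mono mult_pos_pos) auto
  also have "\<dots> = 27 * (4 * K * D + K\<^sup>2 * C) / (real k + 1) ^ 3" by (simp add: power_divide)
  finally show ?thesis by (simp add: t_def)
qed

end

section \<open>Variance of partial sums\<close>

lemma summable_inverse_cube: "summable (\<lambda>k. c / (real k + 1) ^ 3)" (is ?A)
  and summable_inverse_square: "summable (\<lambda>k. c / (real k + 1) ^ 2)" (is ?B)
proof -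
  have "summable (\<lambda>k. inverse (real (k + 1) ^ 3))" "summable (\<lambda>k. inverse (real (k + 1) ^ 2))"
    by (subst summable_iff_shift[of "\<lambda>k. inverse (real k ^ _)"], rule inverse_power_summable, simp)+
  from this[THEN summable_mult[of _ c]] show ?A ?B by (simp_all add: field_simps)
qed

text \<open>Stationarity is recorded in the form in which blocking uses it: constant mean,
  covariances that depend on the lag alone, and equal characteristic functions for the sums over all
  stretches of the same length.\<close>

locale stationary_mixing_functional = beta_mixing_rate M N Z C
  for M :: "'a measure" and N :: "'b measure" and Z C +
  fixes U :: "int \<Rightarrow> 'a \<Rightarrow> real" and V K D and \<gamma> :: "nat \<Rightarrow> real"
  assumes approx: "approximable U V K D"
    and centred: "\<And>t. (\<integral>\<omega>. U t \<omega> \<partial>M) = 0"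
    and cov: "\<And>s k. (\<integral>\<omega>. U s \<omega> * U (s + int k) \<omega> \<partial>M) = \<gamma> k"
    and char_shift: "\<And>c n s. (\<integral>\<omega>. cis (c * (\<Sum>t<n. U (s + int t) \<omega>)) \<partial>M) = (\<integral>\<omega>. cis (c * (\<Sum>t<n. U (int t) \<omega>)) \<partial>M)"
begin

lemma K_pos: "K > 0"
  and U_measurable [measurable]: "U t \<in> borel_measurable M"
  and U_bound: "\<omega> \<in> space M \<Longrightarrow> \<bar>U t \<omega>\<bar> \<le> K"
  and V_gen_sigma: "V l t \<in> borel_measurable (gen_sigma M N Z {t - int l..t + int l})"
  and V_bound: "\<omega> \<in> space M \<Longrightarrow> \<bar>V l t \<omega>\<bar> \<le> K"
  and UV_error: "(\<integral>\<omega>. \<bar>U t \<omega> - V l t \<omega>\<bar> \<partial>M) \<le> D / (real l + 1) ^ 3"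
  using approx by (auto simp: approximable_def)

lemma V_measurable [measurable]: "V l t \<in> borel_measurable M"
  using V_gen_sigma by (rule measurable_gen_sigma_M)

lemma D_nonneg: "D \<ge> 0"
  by (rule approximable_D_nonneg[OF approx])

lemma sum_U_bound: "\<omega> \<in> space M \<Longrightarrow> \<bar>\<Sum>t\<in>T. U (f t) \<omega>\<bar> \<le> real (card T) * K"
  using sum_norm_bound[of T "\<lambda>t. U (f t) \<omega>" K] U_bound by simp

lemma integrable_U [simp]: "integrable M (U t)" "integrable M (V l t)" "integrable M (\<lambda>\<omega>. U s \<omega> * U t \<omega>)"
proof -
  show "integrable M (U t)" "integrable M (V l t)"
    by (rule integrable_bounded[of _ K]; use U_bound V_bound in simp)+
  show "integrable M (\<lambda>\<omega>. U s \<omega> * U t \<omega>)"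
    by (rule integrable_bounded[of _ "K * K"])
       (use U_bound K_pos in \<open>auto simp: abs_mult intro!: mult_mono\<close>)
qed

lemma gamma_decay: "\<bar>\<gamma> k\<bar> \<le> 27 * (4 * K * D + K\<^sup>2 * C) / (real k + 1) ^ 3"
  using covariance_decay[OF approx approx order_refl, of k] by (simp add: cov centred)

lemma summable_gamma: "summable (\<lambda>k. \<bar>\<gamma> k\<bar>)"
  by (rule summable_comparison_test'[OF summable_inverse_cube]) (use gamma_decay in simp)

text \<open>This series is the correction term in \<open>v_eq\<close>; its partial sums stay bounded
  and disappear after division by the block length.\<close>

lemma summable_gamma_weighted: "summable (\<lambda>k. real k * \<gamma> k)"
proof (rule summable_comparison_test'[OF summable_inverse_square])
  fix k :: nat
  define G where "G = 27 * (4 * K * D + K\<^sup>2 * C)"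
  have "norm (real k * \<gamma> k) = real k * \<bar>\<gamma> k\<bar>" by (simp add: abs_mult)
  also have "\<dots> \<le> (real k + 1) * (G / (real k + 1) ^ 3)"
    using gamma_decay[of k] by (intro mult_mono) (auto simp: G_def)
  also have "\<dots> = G / (real k + 1) ^ 2" by (simp add: power2_eq_square power3_eq_cube)
  finally show "norm (real k * \<gamma> k) \<le> G / (real k + 1) ^ 2" .
qed

definition Gam :: real where "Gam = (\<Sum>k. \<bar>\<gamma> k\<bar>)"

lemma Gam_nonneg: "Gam \<ge> 0"
  unfolding Gam_def using summable_gamma by (intro suminf_nonneg) auto

lemma cov_abs: "(\<integral>\<omega>. U s \<omega> * U t \<omega> \<partial>M) = \<gamma> (nat \<bar>t - s\<bar>)"
proof (cases "s \<le> t")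
  case True
  then show ?thesis using cov[of s "nat (t - s)"] by simp
next
  case False
  then show ?thesis using cov[of t "nat (s - t)"] by (simp add: mult.commute)
qed

text \<open>On each side of \<open>s\<close> distinct times have distinct distances from
  \<open>s\<close>, so each half of the sum is at most \<open>Gam\<close>.\<close>

lemma sum_gamma_le:
  assumes "finite T" shows "(\<Sum>t\<in>T. \<bar>\<gamma> (nat \<bar>t - s\<bar>)\<bar>) \<le> 2 * Gam"
proof -
  have part: "(\<Sum>t\<in>S. \<bar>\<gamma> (nat \<bar>t - s\<bar>)\<bar>) \<le> Gam" if "finite S" "inj_on (\<lambda>t. nat \<bar>t - s\<bar>) S" for S
  proof -
    have "(\<Sum>t\<in>S. \<bar>\<gamma> (nat \<bar>t - s\<bar>)\<bar>) = (\<Sum>k\<in>(\<lambda>t. nat \<bar>t - s\<bar>) ` S. \<bar>\<gamma> k\<bar>)"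
      using that by (simp add: sum.reindex)
    also have "\<dots> \<le> Gam" unfolding Gam_def
      using that summable_gamma by (intro sum_le_suminf) auto
    finally show ?thesis .
  qed
  have "(\<Sum>t\<in>T. \<bar>\<gamma> (nat \<bar>t - s\<bar>)\<bar>) = (\<Sum>t\<in>{t\<in>T. t \<ge> s}. \<bar>\<gamma> (nat \<bar>t - s\<bar>)\<bar>) + (\<Sum>t\<in>{t\<in>T. \<not> t \<ge> s}. \<bar>\<gamma> (nat \<bar>t - s\<bar>)\<bar>)"
    using assms by (subst sum.union_disjoint[symmetric]) (auto intro!: sum.cong)
  also have "\<dots> \<le> Gam + Gam"
    using assms by (intro add_mono part) (auto simp: inj_on_def)
  finally show ?thesis by simp
qed

lemma second_moment_eq:
  "(\<integral>\<omega>. (\<Sum>t\<in>T. U t \<omega>)\<^sup>2 \<partial>M) = (\<Sum>s\<in>T. \<Sum>t\<in>T. \<gamma> (nat \<bar>t - s\<bar>))"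
proof -
  have "(\<integral>\<omega>. (\<Sum>t\<in>T. U t \<omega>)\<^sup>2 \<partial>M) = (\<integral>\<omega>. (\<Sum>s\<in>T. \<Sum>t\<in>T. U s \<omega> * U t \<omega>) \<partial>M)"
    by (simp add: power2_eq_square sum_product)
  also have "\<dots> = (\<Sum>s\<in>T. \<Sum>t\<in>T. \<integral>\<omega>. U s \<omega> * U t \<omega> \<partial>M)"
    by (simp add: Bochner_Integration.integral_sum)
  finally show ?thesis by (simp add: cov_abs)
qed

text \<open>\<open>T\<close> is an arbitrary finite set, not only an interval, because the bound is
  applied to the scattered times that lie in no block.\<close>

lemma second_moment_le:
  assumes "finite T"
  shows "(\<integral>\<omega>. (\<Sum>t\<in>T. U t \<omega>)\<^sup>2 \<partial>M) \<le> 2 * Gam * real (card T)"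
proof -
  have "(\<integral>\<omega>. (\<Sum>t\<in>T. U t \<omega>)\<^sup>2 \<partial>M) \<le> (\<Sum>s\<in>T. \<Sum>t\<in>T. \<bar>\<gamma> (nat \<bar>t - s\<bar>)\<bar>)"
    unfolding second_moment_eq by (intro sum_mono) simp
  also have "\<dots> \<le> (\<Sum>s\<in>T. 2 * Gam)" by (intro sum_mono sum_gamma_le assms)
  finally show ?thesis by (simp add: mult.commute)
qed

definition v :: "nat \<Rightarrow> real" where "v p = (\<integral>\<omega>. (\<Sum>t<p. U (int t) \<omega>)\<^sup>2 \<partial>M)"

lemma sum_U_reindex: "inj_on f T \<Longrightarrow> (\<Sum>t\<in>T. U (f t) \<omega>) = (\<Sum>x\<in>f ` T. U x \<omega>)"
  by (simp add: sum.reindex)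

lemma v_le: "v p \<le> 2 * Gam * real p"
  unfolding v_def using second_moment_le[of "int ` {..<p}"]
  by (subst sum_U_reindex) (auto simp: card_image)

lemma v_nonneg: "v p \<ge> 0"
  unfolding v_def by simp

text \<open>The familiar p gamma_0 + 2 sum (p - k) gamma_k, arranged so that the limit of
  \<open>v p / p\<close> can be read off. In the induction the new time point has covariances
  gamma_p, ..., gamma_1 with the earlier ones.\<close>

lemma v_eq: "v p = real p * (2 * (\<Sum>k<p. \<gamma> k) - \<gamma> 0) - 2 * (\<Sum>k<p. real k * \<gamma> k)"
proof (induction p)
  case 0
  then show ?case by (simp add: v_def)
next
  case (Suc p)
  have i2: "integrable M (\<lambda>\<omega>. (\<Sum>t<p. U (int t) \<omega>)\<^sup>2)"
    by (simp add: power2_eq_square sum_product)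
  have "v (Suc p) = (\<integral>\<omega>. (\<Sum>t<p. U (int t) \<omega>)\<^sup>2 + (2 * (\<Sum>t<p. U (int t) \<omega> * U (int p) \<omega>) + U (int p) \<omega> * U (int p) \<omega>) \<partial>M)"
    unfolding v_def by (intro Bochner_Integration.integral_cong refl)
      (simp add: power2_eq_square algebra_simps sum_distrib_left)
  also have "\<dots> = v p + (2 * (\<Sum>t<p. \<integral>\<omega>. U (int t) \<omega> * U (int p) \<omega> \<partial>M) + (\<integral>\<omega>. U (int p) \<omega> * U (int p) \<omega> \<partial>M))"
    using i2 by (simp add: v_def Bochner_Integration.integral_sum)
  also have "(\<Sum>t<p. \<integral>\<omega>. U (int t) \<omega> * U (int p) \<omega> \<partial>M) = (\<Sum>t<p. \<gamma> (Suc (p - Suc t)))"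
    by (intro sum.cong refl) (auto simp: cov_abs intro!: arg_cong[of _ _ \<gamma>])
  also have "\<dots> = (\<Sum>k<p. \<gamma> (Suc k))" by (rule sum.nat_diff_reindex)
  also have "(\<integral>\<omega>. U (int p) \<omega> * U (int p) \<omega> \<partial>M) = \<gamma> 0" by (simp add: cov_abs)
  finally have "v (Suc p) = v p + (2 * (\<Sum>k<Suc p. \<gamma> k) - \<gamma> 0)"
    by (simp only: sum.lessThan_Suc_shift) simp
  then show ?case using Suc.IH by (simp add: algebra_simps)
qed

text \<open>This is gamma_0 + 2 (gamma_1 + gamma_2 + ...), the long-run variance.\<close>

definition sig2 :: real where "sig2 = 2 * (\<Sum>k. \<gamma> k) - \<gamma> 0"

lemma v_tendsto: "(\<lambda>p. v p / real p) \<longlonglongrightarrow> sig2"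
proof -
  have "summable \<gamma>" using summable_gamma by (rule summable_rabs_cancel)
  then have 1: "(\<lambda>p. \<Sum>k<p. \<gamma> k) \<longlonglongrightarrow> (\<Sum>k. \<gamma> k)" by (rule summable_LIMSEQ)
  have 2: "(\<lambda>p. \<Sum>k<p. real k * \<gamma> k) \<longlonglongrightarrow> (\<Sum>k. real k * \<gamma> k)"
    by (rule summable_LIMSEQ[OF summable_gamma_weighted])
  have "(\<lambda>p. (2 * (\<Sum>k<p. \<gamma> k) - \<gamma> 0) - 2 * (\<Sum>k<p. real k * \<gamma> k) * (1 / real p)) \<longlonglongrightarrow> (2 * (\<Sum>k. \<gamma> k) - \<gamma> 0) - 2 * (\<Sum>k. real k * \<gamma> k) * 0"
    by (intro tendsto_intros 1 2 lim_1_over_n)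
  moreover have "\<forall>\<^sub>F p in sequentially. (2 * (\<Sum>k<p. \<gamma> k) - \<gamma> 0) - 2 * (\<Sum>k<p. real k * \<gamma> k) * (1 / real p) = v p / real p"
    by (intro eventually_sequentiallyI[of 1]) (simp add: v_eq diff_divide_distrib)
  ultimately show ?thesis by (auto simp: sig2_def elim: Lim_transform_eventually)
qed

lemma sig2_nonneg: "sig2 \<ge> 0"
  by (rule LIMSEQ_le_const[OF v_tendsto]) (use v_nonneg in auto)

text \<open>In the second-order expansion the linear term vanishes by centring and the quadratic
  term is exactly \<open>v p\<close>. The cubic remainder is bounded by estimating one factor of the
  block sum pointwise by p K. The last summand is the price of replacing 1 - y by exp(-y).\<close>

lemma block_char_approx:
  "norm ((\<integral>\<omega>. cis (c * (\<Sum>t<p. U (int t) \<omega>)) \<partial>M) - complex_of_real (exp (- (c\<^sup>2 * v p / 2))))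
     \<le> \<bar>c\<bar> ^ 3 * real p * K * v p / 6 + (c\<^sup>2 * v p / 2)\<^sup>2"
proof -
  define S where "S \<omega> = (\<Sum>t<p. U (int t) \<omega>)" for \<omega>
  have [measurable]: "S \<in> borel_measurable M" unfolding S_def by measurable
  have bd: "\<bar>S \<omega>\<bar> \<le> real p * K" if "\<omega> \<in> space M" for \<omega>
    using sum_U_bound[OF that, of int "{..<p}"] by (simp add: S_def)
  have iS: "integrable M S" unfolding S_def by simp
  have iS2: "integrable M (\<lambda>\<omega>. (S \<omega>)\<^sup>2)" unfolding S_def by (simp add: power2_eq_square sum_product)
  have ES: "(\<integral>\<omega>. S \<omega> \<partial>M) = 0" unfolding S_def by (simp add: centred)
  have ES2: "(\<integral>\<omega>. (S \<omega>)\<^sup>2 \<partial>M) = v p" by (simp add: S_def v_def)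
  have icis: "integrable M (\<lambda>\<omega>. cis (c * S \<omega>))" by (rule integrable_bounded[of _ 1]) auto
  define f where "f \<omega> = \<i> * complex_of_real (c * S \<omega>)" for \<omega>
  define g where "g \<omega> = complex_of_real ((c * S \<omega>)\<^sup>2) / 2" for \<omega>
  have r: "integrable M (\<lambda>\<omega>. c * S \<omega>)" "integrable M (\<lambda>\<omega>. (c * S \<omega>)\<^sup>2)"
    using iS iS2 by (auto simp: power_mult_distrib)
  have if': "integrable M f" unfolding f_def by (intro integrable_mult_right integrable_of_real r)
  have ig: "integrable M g" unfolding g_def by (intro integrable_divide integrable_of_real r)
  have iP: "integrable M (\<lambda>\<omega>. 1 + f \<omega> - g \<omega>)" using if' ig by simp
  have Ef: "(\<integral>\<omega>. f \<omega> \<partial>M) = 0"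
    unfolding f_def using ES by (simp add: integral_complex_of_real del: of_real_mult)
  have Eg: "(\<integral>\<omega>. g \<omega> \<partial>M) = complex_of_real (c\<^sup>2 * v p / 2)"
    unfolding g_def using ES2 by (simp add: integral_complex_of_real power_mult_distrib del: of_real_mult of_real_power)
  have EP: "(\<integral>\<omega>. 1 + f \<omega> - g \<omega> \<partial>M) = 1 - complex_of_real (c\<^sup>2 * v p / 2)"
    using if' ig Ef Eg by (simp add: prob_space)
  have "norm ((\<integral>\<omega>. cis (c * S \<omega>) \<partial>M) - (1 - complex_of_real (c\<^sup>2 * v p / 2)))
     = norm (\<integral>\<omega>. cis (c * S \<omega>) - (1 + f \<omega> - g \<omega>) \<partial>M)"
    by (simp only: Bochner_Integration.integral_diff[OF icis iP] EP)
  also have "\<dots> \<le> (\<integral>\<omega>. norm (cis (c * S \<omega>) - (1 + f \<omega> - g \<omega>)) \<partial>M)"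
    by (rule integral_norm_bound)
  also have "\<dots> \<le> (\<integral>\<omega>. (\<bar>c\<bar> ^ 3 * (real p * K) / 6) * (S \<omega>)\<^sup>2 \<partial>M)"
  proof (rule integral_mono)
    show "integrable M (\<lambda>\<omega>. norm (cis (c * S \<omega>) - (1 + f \<omega> - g \<omega>)))"
      by (rule integrable_norm[OF Bochner_Integration.integrable_diff[OF icis iP]])
    show "integrable M (\<lambda>\<omega>. (\<bar>c\<bar> ^ 3 * (real p * K) / 6) * (S \<omega>)\<^sup>2)" using iS2 by simp
    fix \<omega> assume \<omega>: "\<omega> \<in> space M"
    have "norm (cis (c * S \<omega>) - (1 + f \<omega> - g \<omega>)) \<le> \<bar>c * S \<omega>\<bar> ^ 3 / 6"
      using norm_cis_taylor2[of "c * S \<omega>"] by (simp add: f_def g_def)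
    also have "\<bar>c * S \<omega>\<bar> ^ 3 = \<bar>c\<bar> ^ 3 * ((S \<omega>)\<^sup>2 * \<bar>S \<omega>\<bar>)"
      by (metis abs_mult power2_abs power2_eq_square power3_eq_cube power_mult_distrib)
    also have "\<bar>c\<bar> ^ 3 * ((S \<omega>)\<^sup>2 * \<bar>S \<omega>\<bar>) / 6 = \<bar>c\<bar> ^ 3 / 6 * (S \<omega>)\<^sup>2 * \<bar>S \<omega>\<bar>"
      by simp
    also have "\<dots> \<le> \<bar>c\<bar> ^ 3 / 6 * (S \<omega>)\<^sup>2 * (real p * K)"
      using bd[OF \<omega>] by (intro mult_left_mono) auto
    finally show "norm (cis (c * S \<omega>) - (1 + f \<omega> - g \<omega>)) \<le> (\<bar>c\<bar> ^ 3 * (real p * K) / 6) * (S \<omega>)\<^sup>2"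
      by (simp add: mult_ac)
  qed
  also have "\<dots> = \<bar>c\<bar> ^ 3 * real p * K * v p / 6" using ES2 by simp
  finally have 1: "norm ((\<integral>\<omega>. cis (c * S \<omega>) \<partial>M) - (1 - complex_of_real (c\<^sup>2 * v p / 2))) \<le> \<bar>c\<bar> ^ 3 * real p * K * v p / 6" .
  have "norm ((1 - complex_of_real (c\<^sup>2 * v p / 2)) - complex_of_real (exp (- (c\<^sup>2 * v p / 2)))) = \<bar>exp (- (c\<^sup>2 * v p / 2)) - (1 - c\<^sup>2 * v p / 2)\<bar>"
    by (metis norm_minus_commute norm_of_real of_real_1 of_real_diff)
  also have "\<dots> \<le> (c\<^sup>2 * v p / 2)\<^sup>2"
    using v_nonneg by (intro abs_exp_minus_taylor1) simp
  finally have 2: "norm ((1 - complex_of_real (c\<^sup>2 * v p / 2)) - complex_of_real (exp (- (c\<^sup>2 * v p / 2)))) \<le> (c\<^sup>2 * v p / 2)\<^sup>2" .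
  show ?thesis using norm_triangle_le[OF add_mono[OF 1 2]] by (simp add: S_def)
qed

end

section \<open>Bernstein blocking\<close>

context stationary_mixing_functional
begin

text \<open>The first time of block \<open>j\<close>. The initial \<open>l + 1\<close> places the
  leftmost window at index 1. In a period p + 3l, windows of radius \<open>l\<close> around the
  \<open>p\<close> block times occupy p + 2l indices, and the remaining \<open>l\<close> separate
  them from the windows of the next block.\<close>

definition block :: "nat \<Rightarrow> nat \<Rightarrow> nat \<Rightarrow> int" where
  "block p l j = int l + 1 + int (j * (p + 3 * l))"

lemma block_factor_measurable:
  assumes "p \<ge> 1" "i \<ge> 1"
  shows "(\<lambda>\<omega>. \<Prod>j<i. cis (c * (\<Sum>t<p. V l (block p l j + int t) \<omega>)))
    \<in> borel_measurable (gen_sigma M N Z {1..int (i * (p + 3 * l)) - int l})"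
proof -
  have "V l (block p l j + int t) \<in> borel_measurable (gen_sigma M N Z {1..int (i * (p + 3 * l)) - int l})"
    if "j < i" "t < p" for j t
  proof (rule measurable_gen_sigma_mono[OF V_gen_sigma])
    have "Suc j * (p + 3 * l) \<le> i * (p + 3 * l)" using that by (intro mult_le_mono1) auto
    then have "int (j * (p + 3 * l)) + int p + 3 * int l \<le> int (i * (p + 3 * l))"
      by (simp flip: of_nat_mult of_nat_add)
    then show "{block p l j + int t - int l..block p l j + int t + int l} \<subseteq> {1..int (i * (p + 3 * l)) - int l}"
      using that by (auto simp: block_def)
  qed
  then show ?thesis
    by (intro borel_measurable_prod measurable_compose[OF _ cis_borel_measurable] borel_measurable_times
        borel_measurable_sum borel_measurable_const) auto
qed

text \<open>Splitting off the last factor costs one covariance across the gap \<open>l\<close>. The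
  error already accumulated is multiplied by a number of modulus at most 1, so errors only add
  up.\<close>

lemma decoupling:
  assumes "p \<ge> 1"
  shows "norm ((\<integral>\<omega>. (\<Prod>j<r. cis (c * (\<Sum>t<p. V l (block p l j + int t) \<omega>))) \<partial>M)
      - (\<Prod>j<r. \<integral>\<omega>. cis (c * (\<Sum>t<p. V l (block p l j + int t) \<omega>)) \<partial>M))
    \<le> real r * (4 * C / (real l + 1) ^ 3)"
proof (induction r)
  case 0
  then show ?case by (simp add: prob_space)
next
  case (Suc i)
  define W where "W j \<omega> = cis (c * (\<Sum>t<p. V l (block p l j + int t) \<omega>))" for j \<omega>
  define \<epsilon> where "\<epsilon> = 4 * C / (real l + 1) ^ 3"
  have eps: "\<epsilon> \<ge> 0" using C_nonneg by (simp add: \<epsilon>_def)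
  have "norm ((\<integral>\<omega>. (\<Prod>j<i. W j \<omega>) * W i \<omega> \<partial>M) - (\<integral>\<omega>. (\<Prod>j<i. W j \<omega>) \<partial>M) * (\<integral>\<omega>. W i \<omega> \<partial>M)) \<le> \<epsilon>"
  \<comment> \<open>Before the first block there is no past: the product is empty, and the right end
    -l of its index set would not be admissible in \<open>covariance_gap\<close>.\<close>
  proof (cases "i = 0")
    case True
    then show ?thesis using eps by (simp add: prob_space)
  next
    case False
    define n where "n = int (i * (p + 3 * l)) - int l"
    have le: "p + 3 * l \<le> k \<Longrightarrow> 1 \<le> int k - int l" for k using \<open>p \<ge> 1\<close> by linarith
    have "p + 3 * l \<le> i * (p + 3 * l)" using False by simp
    then have n1: "n \<ge> 1" unfolding n_def by (rule le)
    show ?thesis unfolding \<epsilon>_def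
    proof (rule covariance_gap[OF n1])
      show "(\<lambda>\<omega>. \<Prod>j<i. W j \<omega>) \<in> borel_measurable (gen_sigma M N Z {1..n})"
        unfolding W_def n_def using block_factor_measurable[OF \<open>p \<ge> 1\<close>] False by simp
      have "V l (block p l i + int t) \<in> borel_measurable (gen_sigma M N Z {n + int l..})" for t
        by (rule measurable_gen_sigma_mono[OF V_gen_sigma]) (auto simp: block_def n_def)
      then show "W i \<in> borel_measurable (gen_sigma M N Z {n + int l..})"
        unfolding W_def
        by (intro measurable_compose[OF _ cis_borel_measurable] borel_measurable_times
            borel_measurable_sum borel_measurable_const) auto
    qed (auto simp: W_def simp flip: prod_norm)
  qed
  moreover have "norm ((\<integral>\<omega>. (\<Prod>j<i. W j \<omega>) \<partial>M) * (\<integral>\<omega>. W i \<omega> \<partial>M) - (\<Prod>j<i. \<integral>\<omega>. W j \<omega> \<partial>M) * (\<integral>\<omega>. W i \<omega> \<partial>M)) \<le> real i * \<epsilon>"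
  proof -
    have "norm ((\<integral>\<omega>. (\<Prod>j<i. W j \<omega>) \<partial>M) * (\<integral>\<omega>. W i \<omega> \<partial>M) - (\<Prod>j<i. \<integral>\<omega>. W j \<omega> \<partial>M) * (\<integral>\<omega>. W i \<omega> \<partial>M))
      = norm ((\<integral>\<omega>. (\<Prod>j<i. W j \<omega>) \<partial>M) - (\<Prod>j<i. \<integral>\<omega>. W j \<omega> \<partial>M)) * norm (\<integral>\<omega>. W i \<omega> \<partial>M)"
      by (simp flip: norm_mult left_diff_distrib)
    also have "\<dots> \<le> norm ((\<integral>\<omega>. (\<Prod>j<i. W j \<omega>) \<partial>M) - (\<Prod>j<i. \<integral>\<omega>. W j \<omega> \<partial>M)) * 1"
      unfolding W_def using norm_expectation_cis_le_1 by (intro mult_left_mono) auto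
    finally show ?thesis using Suc.IH by (simp add: W_def \<epsilon>_def)
  qed
  ultimately have "norm ((\<integral>\<omega>. (\<Prod>j<i. W j \<omega>) * W i \<omega> \<partial>M) - (\<Prod>j<i. \<integral>\<omega>. W j \<omega> \<partial>M) * (\<integral>\<omega>. W i \<omega> \<partial>M)) \<le> \<epsilon> + real i * \<epsilon>"
    using norm_diff_triangle_le by blast
  then show ?case by (simp add: W_def \<epsilon>_def algebra_simps add_divide_distrib)
qed

text \<open>Five replacements: drop the times outside the blocks, pass from \<open>U\<close> to the
  window approximants \<open>V\<close>, factorize, return to \<open>U\<close> in each factor, where
  stationarity makes all factors equal, and insert the exponential. The second and the fourth cost
  the same, whence the factor 2.\<close>

lemma blocking_bound:
  fixes n p l :: nat and \<theta> :: real
  assumes n: "n \<ge> 1" and p: "p \<ge> 1"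
  defines "r \<equiv> n div (p + 3 * l)" and "c \<equiv> \<theta> / sqrt (real n)"
  shows "norm ((\<integral>\<omega>. cis (c * (\<Sum>t<n. U (int t) \<omega>)) \<partial>M) - complex_of_real (exp (- (c\<^sup>2 * v p / 2))) ^ r)
    \<le> \<bar>c\<bar> * sqrt (2 * Gam * (real n - real r * real p))
      + 2 * \<bar>c\<bar> * (real r * real p) * (D / (real l + 1) ^ 3) + real r * (4 * C / (real l + 1) ^ 3)
      + real r * (\<bar>c\<bar> ^ 3 * real p * K * v p / 6 + (c\<^sup>2 * v p / 2)\<^sup>2)"
proof -
  define L where "L = p + 3 * l"
  \<comment> \<open>The whole sum is moved to start together with the first block;
    \<open>char_shift\<close> moves it back to 0 at the end.\<close>
  define s0 where "s0 = int l + 1"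
  define B where "B = (\<lambda>(j, t). j * L + t) ` ({..<r} \<times> {..<p})"
  define X where "X j \<omega> = (\<Sum>t<p. U (block p l j + int t) \<omega>)" for j \<omega>
  define Y where "Y j \<omega> = (\<Sum>t<p. V l (block p l j + int t) \<omega>)" for j \<omega>
  define \<psi> where "\<psi> = (\<integral>\<omega>. cis (c * (\<Sum>t<p. U (int t) \<omega>)) \<partial>M)"
  define \<delta> where "\<delta> = D / (real l + 1) ^ 3"
  have pL: "p \<le> L" "L > 0" using p by (auto simp: L_def)
  have inj: "inj_on (\<lambda>(j, t). j * L + t) ({..<r} \<times> {..<p})"
  proof (rule inj_onI)
    fix x y assume xy: "x \<in> {..<r} \<times> {..<p}" "y \<in> {..<r} \<times> {..<p}"
      and "(case x of (j, t) \<Rightarrow> j * L + t) = (case y of (j, t) \<Rightarrow> j * L + t)"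
    then have eq: "fst x * L + snd x = fst y * L + snd y" by (simp add: split_beta)
    have "snd x < L" "snd y < L" using xy pL by auto
    then have "fst x = (fst x * L + snd x) div L" "(fst y * L + snd y) div L = fst y" by simp_all
    with eq have "fst x = fst y" by simp
    with eq show "x = y" by (simp add: prod_eq_iff)
  qed
  have rL: "r * L \<le> n" by (simp add: r_def L_def)
  have BS: "B \<subseteq> {..<n}"
  proof
    fix x assume "x \<in> B"
    then obtain j t where jt: "j < r" "t < p" "x = j * L + t" by (auto simp: B_def)
    have "Suc j * L \<le> r * L" using jt by (intro mult_le_mono1) auto
    then have "j * L + L \<le> n" using rL by simp
    then show "x \<in> {..<n}" using jt pL by simp
  qed
  have cB: "card B = r * p" unfolding B_def using inj by (simp add: card_image card_cartesian_product)
  have sumB: "(\<Sum>t\<in>B. U (s0 + int t) \<omega>) = (\<Sum>j<r. X j \<omega>)" for \<omega>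
    unfolding B_def X_def block_def s0_def L_def[symmetric] sum.reindex[OF inj] sum.cartesian_product
    by (intro sum.cong refl) (auto simp: add.assoc)
  have split: "(\<Sum>t<n. U (s0 + int t) \<omega>) = (\<Sum>j<r. X j \<omega>) + (\<Sum>t\<in>{..<n} - B. U (s0 + int t) \<omega>)" for \<omega>
    using sum.subset_diff[OF BS, of "\<lambda>t. U (s0 + int t) \<omega>"] by (simp add: sumB)
  have [measurable]: "X j \<in> borel_measurable M" "Y j \<in> borel_measurable M" for j
    unfolding X_def Y_def by measurable
  have iX: "integrable M (X j)" "integrable M (Y j)" for j
    unfolding X_def Y_def by simp_all
  have XY: "(\<integral>\<omega>. \<bar>X j \<omega> - Y j \<omega>\<bar> \<partial>M) \<le> real p * \<delta>" for j
  proof -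
    have "(\<integral>\<omega>. \<bar>X j \<omega> - Y j \<omega>\<bar> \<partial>M) \<le> (\<integral>\<omega>. (\<Sum>t<p. \<bar>U (block p l j + int t) \<omega> - V l (block p l j + int t) \<omega>\<bar>) \<partial>M)"
      using iX[of j] by (intro integral_mono)
        (auto simp: X_def Y_def sum_subtractf[symmetric] intro!: sum_abs Bochner_Integration.integrable_sum)
    also have "\<dots> = (\<Sum>t<p. \<integral>\<omega>. \<bar>U (block p l j + int t) \<omega> - V l (block p l j + int t) \<omega>\<bar> \<partial>M)"
      by (intro Bochner_Integration.integral_sum) auto
    also have "\<dots> \<le> (\<Sum>t<p. \<delta>)" unfolding \<delta>_def by (intro sum_mono UV_error)
    finally show ?thesis by simp
  qed
  have 1: "norm ((\<integral>\<omega>. cis (c * (\<Sum>t<n. U (int t) \<omega>)) \<partial>M) - (\<integral>\<omega>. cis (c * (\<Sum>j<r. X j \<omega>)) \<partial>M))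
     \<le> \<bar>c\<bar> * sqrt (2 * Gam * (real n - real r * real p))"
  proof -
    define R where "R \<omega> = (\<Sum>t\<in>{..<n} - B. U (s0 + int t) \<omega>)" for \<omega>
    have [measurable]: "R \<in> borel_measurable M" unfolding R_def by measurable
    have "inj_on (\<lambda>t. s0 + int t) ({..<n} - B)" by (auto simp: inj_on_def)
    then have RT: "R = (\<lambda>\<omega>. \<Sum>x\<in>(\<lambda>t. s0 + int t) ` ({..<n} - B). U x \<omega>)"
      and "card ((\<lambda>t. s0 + int t) ` ({..<n} - B)) = n - r * p"
      using BS cB by (simp_all add: R_def fun_eq_iff sum.reindex card_image card_Diff_subset finite_subset[OF BS])
    moreover have "r * p \<le> n" using card_mono[OF _ BS] cB by simp
    ultimately have ER: "(\<integral>\<omega>. (R \<omega>)\<^sup>2 \<partial>M) \<le> 2 * Gam * (real n - real r * real p)"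
      using second_moment_le[of "(\<lambda>t. s0 + int t) ` ({..<n} - B)"] by (simp add: of_nat_diff)
    have iR2: "integrable M (\<lambda>\<omega>. (R \<omega>)\<^sup>2)" unfolding R_def by (simp add: power2_eq_square sum_product)
    have iR: "integrable M R" unfolding R_def by simp
    have "norm ((\<integral>\<omega>. cis (c * (\<Sum>t<n. U (s0 + int t) \<omega>)) \<partial>M) - (\<integral>\<omega>. cis (c * (\<Sum>j<r. X j \<omega>)) \<partial>M))
      \<le> (\<integral>\<omega>. \<bar>c * (\<Sum>t<n. U (s0 + int t) \<omega>) - c * (\<Sum>j<r. X j \<omega>)\<bar> \<partial>M)"
      using iX by (intro expectation_cis_diff_le) auto
    also have "\<dots> = (\<integral>\<omega>. \<bar>c\<bar> * \<bar>R \<omega>\<bar> \<partial>M)"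
      by (simp add: split R_def abs_mult flip: right_diff_distrib)
    also have "\<dots> \<le> \<bar>c\<bar> * sqrt (\<integral>\<omega>. (R \<omega>)\<^sup>2 \<partial>M)"
      using expectation_abs_le_sqrt[OF _ iR2] by (simp add: mult_left_mono)
    also have "\<dots> \<le> \<bar>c\<bar> * sqrt (2 * Gam * (real n - real r * real p))"
      using ER by (intro mult_left_mono) auto
    finally show ?thesis by (simp add: char_shift)
  qed
  have 2: "norm ((\<integral>\<omega>. cis (c * (\<Sum>j<r. X j \<omega>)) \<partial>M) - (\<integral>\<omega>. cis (c * (\<Sum>j<r. Y j \<omega>)) \<partial>M)) \<le> \<bar>c\<bar> * (real r * real p) * \<delta>"
  proof -
    have "norm ((\<integral>\<omega>. cis (c * (\<Sum>j<r. X j \<omega>)) \<partial>M) - (\<integral>\<omega>. cis (c * (\<Sum>j<r. Y j \<omega>)) \<partial>M))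
      \<le> (\<integral>\<omega>. \<bar>c * (\<Sum>j<r. X j \<omega>) - c * (\<Sum>j<r. Y j \<omega>)\<bar> \<partial>M)"
      using iX by (intro expectation_cis_diff_le) auto
    also have "\<dots> \<le> (\<integral>\<omega>. \<bar>c\<bar> * (\<Sum>j<r. \<bar>X j \<omega> - Y j \<omega>\<bar>) \<partial>M)"
      using iX by (intro integral_mono) (auto simp: abs_mult sum_subtractf[symmetric]
        simp flip: right_diff_distrib intro!: mult_left_mono sum_abs)
    also have "\<dots> = \<bar>c\<bar> * (\<Sum>j<r. \<integral>\<omega>. \<bar>X j \<omega> - Y j \<omega>\<bar> \<partial>M)"
      using iX by (simp add: Bochner_Integration.integral_sum)
    also have "\<dots> \<le> \<bar>c\<bar> * (\<Sum>j<r. real p * \<delta>)" by (intro mult_left_mono sum_mono XY) auto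
    finally show ?thesis by (simp add: mult_ac)
  qed
  have 3: "norm ((\<integral>\<omega>. cis (c * (\<Sum>j<r. Y j \<omega>)) \<partial>M) - (\<Prod>j<r. \<integral>\<omega>. cis (c * Y j \<omega>) \<partial>M)) \<le> real r * (4 * C / (real l + 1) ^ 3)"
  proof -
    have "cis (c * (\<Sum>j<i. Y j \<omega>)) = (\<Prod>j<i. cis (c * Y j \<omega>))" for i \<omega>
      by (induction i) (simp_all add: distrib_left flip: cis_mult)
    then show ?thesis using decoupling[OF p, where r = r and c = c and l = l] by (simp add: Y_def)
  qed
  have 4: "norm ((\<Prod>j<r. \<integral>\<omega>. cis (c * Y j \<omega>) \<partial>M) - \<psi> ^ r) \<le> \<bar>c\<bar> * (real r * real p) * \<delta>"
  proof -
    have "norm ((\<Prod>j<r. \<integral>\<omega>. cis (c * Y j \<omega>) \<partial>M) - (\<Prod>j<r. \<psi>)) \<le> (\<Sum>j<r. norm ((\<integral>\<omega>. cis (c * Y j \<omega>) \<partial>M) - \<psi>))"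
      unfolding \<psi>_def by (intro norm_prod_diff norm_expectation_cis_le_1)
    also have "\<dots> \<le> (\<Sum>j<r. \<bar>c\<bar> * (real p * \<delta>))"
    proof (rule sum_mono)
      fix j
      have "\<psi> = (\<integral>\<omega>. cis (c * X j \<omega>) \<partial>M)" unfolding \<psi>_def X_def by (simp add: char_shift)
      then have "norm ((\<integral>\<omega>. cis (c * Y j \<omega>) \<partial>M) - \<psi>) = norm ((\<integral>\<omega>. cis (c * X j \<omega>) \<partial>M) - (\<integral>\<omega>. cis (c * Y j \<omega>) \<partial>M))"
        by (simp add: norm_minus_commute)
      also have "\<dots> \<le> (\<integral>\<omega>. \<bar>c * X j \<omega> - c * Y j \<omega>\<bar> \<partial>M)"
        using iX by (intro expectation_cis_diff_le) auto
      also have "\<dots> = \<bar>c\<bar> * (\<integral>\<omega>. \<bar>X j \<omega> - Y j \<omega>\<bar> \<partial>M)"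
        by (simp add: abs_mult flip: right_diff_distrib)
      also have "\<dots> \<le> \<bar>c\<bar> * (real p * \<delta>)" by (intro mult_left_mono XY) auto
      finally show "norm ((\<integral>\<omega>. cis (c * Y j \<omega>) \<partial>M) - \<psi>) \<le> \<bar>c\<bar> * (real p * \<delta>)" .
    qed
    finally show ?thesis by (simp add: mult_ac)
  qed
  have 5: "norm (\<psi> ^ r - complex_of_real (exp (- (c\<^sup>2 * v p / 2))) ^ r)
     \<le> real r * (\<bar>c\<bar> ^ 3 * real p * K * v p / 6 + (c\<^sup>2 * v p / 2)\<^sup>2)"
  proof -
    have "norm (\<psi> ^ r - complex_of_real (exp (- (c\<^sup>2 * v p / 2))) ^ r) \<le> real r * norm (\<psi> - complex_of_real (exp (- (c\<^sup>2 * v p / 2))))"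
      unfolding \<psi>_def using v_nonneg by (intro norm_power_diff norm_expectation_cis_le_1) simp
    also have "\<dots> \<le> real r * (\<bar>c\<bar> ^ 3 * real p * K * v p / 6 + (c\<^sup>2 * v p / 2)\<^sup>2)"
      unfolding \<psi>_def by (intro mult_left_mono block_char_approx) auto
    finally show ?thesis .
  qed
  from norm_diff_triangle_le[OF norm_diff_triangle_le[OF norm_diff_triangle_le[OF norm_diff_triangle_le[OF 1 2] 3] 4] 5]
  show ?thesis by (simp add: \<delta>_def algebra_simps)
qed

theorem characteristic_function_tendsto:
  "(\<lambda>n. \<integral>\<omega>. cis (\<theta> / sqrt (real n) * (\<Sum>t<n. U (int t) \<omega>)) \<partial>M) \<longlonglongrightarrow> complex_of_real (exp (- (\<theta>\<^sup>2 * sig2 / 2)))"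
proof -
  \<comment> \<open>The exponents satisfy 1/3 < 0.4 < 0.45 < 1/2. The terms n / l^3 and sqrt(n) /
    l^3 vanish since 3 * 0.4 > 1, the share l / p of the gaps since 0.4 < 0.45, and the Taylor error
    p / sqrt(n) since 0.45 < 1/2.\<close>
  define p where "p n = nat \<lfloor>real n powr 0.45\<rfloor>" for n
  define l where "l n = nat \<lfloor>real n powr 0.4\<rfloor>" for n
  define r where "r n = n div (p n + 3 * l n)" for n
  define c where "c n = \<theta> / sqrt (real n)" for n
  have fl: "x \<le> real (nat \<lfloor>x\<rfloor>) + 1" "real (nat \<lfloor>x\<rfloor>) \<le> x" if "x \<ge> 0" for x :: real
  proof -
    have "real (nat \<lfloor>x\<rfloor>) = of_int \<lfloor>x\<rfloor>" using that by simp
    then show "x \<le> real (nat \<lfloor>x\<rfloor>) + 1" "real (nat \<lfloor>x\<rfloor>) \<le> x" by linarith+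
  qed
  have p_bd: "real n powr 0.45 - 1 \<le> real (p n)" "real (p n) \<le> real n powr 0.45" for n
    using fl[of "real n powr 0.45"] by (auto simp: p_def diff_le_eq)
  have l_bd: "real n powr 0.4 \<le> real (l n) + 1" "real (l n) \<le> real n powr 0.4" for n
    using fl[of "real n powr 0.4"] by (auto simp: l_def)
  have p1: "p n \<ge> 1" if "n \<ge> 1" for n
  proof -
    have "real n powr 0.45 \<ge> 1" using that by (simp add: ge_one_powr_ge_zero)
    then show ?thesis unfolding p_def by (simp add: le_nat_iff le_floor_iff)
  qed
  have r_le: "real (r n) * real (p n + 3 * l n) \<le> real n" for n
    unfolding r_def by (metis div_times_less_eq_dividend of_nat_le_iff of_nat_mult)
  have r_ge: "real n - real (p n + 3 * l n) \<le> real (r n) * real (p n + 3 * l n)" if "n \<ge> 1" for n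
  proof -
    have "n mod (p n + 3 * l n) < p n + 3 * l n" using p1[OF that] by (intro mod_less_divisor) linarith
    moreover have "n = r n * (p n + 3 * l n) + n mod (p n + 3 * l n)" unfolding r_def by (rule div_mult_mod_eq[symmetric])
    ultimately have "n \<le> r n * (p n + 3 * l n) + (p n + 3 * l n)" by linarith
    then have "real n \<le> real (r n * (p n + 3 * l n) + (p n + 3 * l n))" by (rule of_nat_mono)
    then show ?thesis by simp
  qed
  have rp_le: "real (r n) * real (p n) \<le> real n" for n
    using r_le[of n] mult_left_mono[of "real (p n)" "real (p n + 3 * l n)" "real (r n)"] by simp
  have rn: "real (r n) \<le> real n" for n unfolding r_def by simp
  have p_top: "filterlim p at_top sequentially"
  proof -
    have "filterlim (\<lambda>n. real n powr 0.45 - 1) at_top sequentially" by real_asymp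
    then have "filterlim (\<lambda>n. real (p n)) at_top sequentially"
      by (rule filterlim_at_top_mono) (use p_bd in auto)
    then show ?thesis by (simp add: filterlim_real_sequentially filterlim_sequentially_iff_filterlim_real)
  qed
  \<comment> \<open>The leftover times are 3l in each of the \<open>r\<close> periods, where r <= n
    / p, and an incomplete last period of fewer than p + 3l. From n = 2 on the denominator is
    positive.\<close>
  have rest_le: "(real n - real (r n) * real (p n)) / real n
      \<le> 3 * real n powr 0.4 / (real n powr 0.45 - 1) + (real n powr 0.45 + 3 * real n powr 0.4) / real n"
    if "n \<ge> 2" for n
  proof -
    have x1: "real n powr 0.45 > 1" using that by (intro gr_one_powr) auto
    have pp: "real (p n) > 0" using p1[of n] that by simp
    have "real (r n) \<le> real n / real (p n)" using rp_le[of n] pp by (simp add: pos_le_divide_eq)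
    also have "\<dots> \<le> real n / (real n powr 0.45 - 1)"
      using p_bd(1)[of n] x1 by (intro divide_left_mono mult_pos_pos) auto
    finally have "real (r n) * (3 * real (l n)) \<le> real n / (real n powr 0.45 - 1) * (3 * real n powr 0.4)"
      using l_bd(2)[of n] x1 by (intro mult_mono) auto
    moreover have "real n - real (r n) * real (p n) \<le> real (r n) * (3 * real (l n)) + (real (p n) + 3 * real (l n))"
      using r_ge[of n] that by (simp add: algebra_simps)
    moreover have "real (p n) + 3 * real (l n) \<le> real n powr 0.45 + 3 * real n powr 0.4"
      using p_bd(2)[of n] l_bd(2)[of n] by linarith
    ultimately have "real n - real (r n) * real (p n) \<le> real n / (real n powr 0.45 - 1) * (3 * real n powr 0.4) + (real n powr 0.45 + 3 * real n powr 0.4)"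
      by linarith
    then have "(real n - real (r n) * real (p n)) / real n \<le> (real n / (real n powr 0.45 - 1) * (3 * real n powr 0.4) + (real n powr 0.45 + 3 * real n powr 0.4)) / real n"
      by (rule divide_right_mono) simp
    also have "\<dots> = 3 * real n powr 0.4 / (real n powr 0.45 - 1) + (real n powr 0.45 + 3 * real n powr 0.4) / real n"
      using that by (simp add: add_divide_distrib)
    finally show ?thesis .
  qed
  have rest: "(\<lambda>n. (real n - real (r n) * real (p n)) / real n) \<longlonglongrightarrow> 0"
  proof (rule tendsto_sandwich[OF _ _ tendsto_const])
    show "\<forall>\<^sub>F n in sequentially. 0 \<le> (real n - real (r n) * real (p n)) / real n"
      using rp_le by (intro always_eventually allI divide_nonneg_nonneg) auto
    show "\<forall>\<^sub>F n in sequentially. (real n - real (r n) * real (p n)) / real n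
      \<le> 3 * real n powr 0.4 / (real n powr 0.45 - 1) + (real n powr 0.45 + 3 * real n powr 0.4) / real n"
      using rest_le by (intro eventually_sequentiallyI[of 2])
    show "(\<lambda>n. 3 * real n powr 0.4 / (real n powr 0.45 - 1) + (real n powr 0.45 + 3 * real n powr 0.4) / real n) \<longlonglongrightarrow> 0"
      by real_asymp
  qed
  have main: "(\<lambda>n. complex_of_real (exp (- ((c n)\<^sup>2 * v (p n) / 2))) ^ r n) \<longlonglongrightarrow> complex_of_real (exp (- (\<theta>\<^sup>2 * sig2 / 2)))"
  proof -
    have 1: "(\<lambda>n. v (p n) / real (p n)) \<longlonglongrightarrow> sig2"
      by (rule filterlim_compose[OF v_tendsto p_top])
    \<comment> \<open>The exponent of the power is half of c^2 r v(p) = theta^2 (r p / n) (v(p) /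
      p). The share r p / n is written as 1 minus the leftover share, so that \<open>rest\<close>
      applies.\<close>
    have "(\<lambda>n. complex_of_real (exp (- (\<theta>\<^sup>2 * ((1 - (real n - real (r n) * real (p n)) / real n) * (v (p n) / real (p n))) / 2)))) \<longlonglongrightarrow>
        complex_of_real (exp (- (\<theta>\<^sup>2 * ((1 - 0) * sig2) / 2)))"
      by (intro tendsto_intros 1 rest) simp
    moreover have "\<forall>\<^sub>F n in sequentially. complex_of_real (exp (- (\<theta>\<^sup>2 * ((1 - (real n - real (r n) * real (p n)) / real n) * (v (p n) / real (p n))) / 2)))
       = complex_of_real (exp (- ((c n)\<^sup>2 * v (p n) / 2))) ^ r n"
    proof (rule eventually_sequentiallyI[of 1])
      fix n :: nat assume n: "n \<ge> 1"
      have "\<theta>\<^sup>2 * ((1 - (real n - real (r n) * real (p n)) / real n) * (v (p n) / real (p n))) / 2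
        = real (r n) * ((c n)\<^sup>2 * v (p n) / 2)"
        using n p1[OF n] by (simp add: c_def power_divide field_simps)
      then show "complex_of_real (exp (- (\<theta>\<^sup>2 * ((1 - (real n - real (r n) * real (p n)) / real n) * (v (p n) / real (p n))) / 2)))
         = complex_of_real (exp (- ((c n)\<^sup>2 * v (p n) / 2))) ^ r n"
        by (simp flip: of_real_power exp_of_nat_mult)
    qed
    ultimately show ?thesis by (auto elim: Lim_transform_eventually)
  qed
  define err where "err n = \<bar>\<theta>\<bar> * sqrt (2 * Gam * ((real n - real (r n) * real (p n)) / real n))
      + 2 * \<bar>\<theta>\<bar> * D * (sqrt (real n) / (real n powr 0.4) ^ 3) + 4 * C * (real n / (real n powr 0.4) ^ 3)
      + (\<bar>\<theta>\<bar> ^ 3 * K * Gam / 3 * (real n powr 0.45 / sqrt (real n)) + \<theta> ^ 4 * Gam\<^sup>2 * (real n powr 0.45 / real n))" for n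
  have "err \<longlonglongrightarrow> \<bar>\<theta>\<bar> * sqrt (2 * Gam * 0) + 2 * \<bar>\<theta>\<bar> * D * 0 + 4 * C * 0 + (\<bar>\<theta>\<bar> ^ 3 * K * Gam / 3 * 0 + \<theta> ^ 4 * Gam\<^sup>2 * 0)"
    unfolding err_def
  proof (intro tendsto_intros rest)
    show "(\<lambda>n. sqrt (real n) / (real n powr 0.4) ^ 3) \<longlonglongrightarrow> 0" by real_asymp
    show "(\<lambda>n. real n / (real n powr 0.4) ^ 3) \<longlonglongrightarrow> 0" by real_asymp
    show "(\<lambda>n. real n powr 0.45 / sqrt (real n)) \<longlonglongrightarrow> 0" by real_asymp
    show "(\<lambda>n. real n powr 0.45 / real n) \<longlonglongrightarrow> 0" by real_asymp
  qed
  then have err0: "err \<longlonglongrightarrow> 0" by simp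
  have bound: "norm ((\<integral>\<omega>. cis (c n * (\<Sum>t<n. U (int t) \<omega>)) \<partial>M) - complex_of_real (exp (- ((c n)\<^sup>2 * v (p n) / 2))) ^ r n) \<le> err n"
    if n: "n \<ge> 1" for n
  proof -
    have n0: "real n > 0" "sqrt (real n) > 0" using n by auto
    have pow: "real n powr 0.4 > 0" using n by simp
    have lpow: "(real n powr 0.4) ^ 3 \<le> (real (l n) + 1) ^ 3" "(real n powr 0.4) ^ 3 > 0"
      using l_bd(1)[of n] pow by (auto intro!: power_mono)
    have ac: "\<bar>c n\<bar> = \<bar>\<theta>\<bar> / sqrt (real n)" by (simp add: c_def)
    have t1: "\<bar>c n\<bar> * sqrt (2 * Gam * (real n - real (r n) * real (p n))) = \<bar>\<theta>\<bar> * sqrt (2 * Gam * ((real n - real (r n) * real (p n)) / real n))"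
      by (simp add: ac real_sqrt_mult real_sqrt_divide)
    have t2: "2 * \<bar>c n\<bar> * (real (r n) * real (p n)) * (D / (real (l n) + 1) ^ 3) \<le> 2 * \<bar>\<theta>\<bar> * D * (sqrt (real n) / (real n powr 0.4) ^ 3)"
    proof -
      have "2 * \<bar>c n\<bar> * (real (r n) * real (p n)) * (D / (real (l n) + 1) ^ 3) \<le> 2 * \<bar>c n\<bar> * real n * (D / (real n powr 0.4) ^ 3)"
        using rp_le[of n] D_nonneg lpow by (intro mult_mono divide_left_mono mult_pos_pos) auto
      also have "\<dots> = 2 * (\<bar>c n\<bar> * real n) * (D / (real n powr 0.4) ^ 3)" by simp
      also have "\<bar>c n\<bar> * real n = \<bar>\<theta>\<bar> * sqrt (real n)"
        using n0 by (simp add: ac field_simps flip: power2_eq_square)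
      finally show ?thesis by (simp add: mult_ac)
    qed
    have t3: "real (r n) * (4 * C / (real (l n) + 1) ^ 3) \<le> 4 * C * (real n / (real n powr 0.4) ^ 3)"
    proof -
      have "real (r n) * (4 * C / (real (l n) + 1) ^ 3) \<le> real n * (4 * C / (real n powr 0.4) ^ 3)"
        using rn[of n] C_nonneg lpow by (intro mult_mono divide_left_mono mult_pos_pos) auto
      then show ?thesis by (simp add: mult_ac)
    qed
    have t4: "real (r n) * (\<bar>c n\<bar> ^ 3 * real (p n) * K * v (p n) / 6) \<le> \<bar>\<theta>\<bar> ^ 3 * K * Gam / 3 * (real n powr 0.45 / sqrt (real n))"
    proof -
      have "real (r n) * (\<bar>c n\<bar> ^ 3 * real (p n) * K * v (p n) / 6) = (\<bar>c n\<bar> ^ 3 * K / 6) * ((real (r n) * real (p n)) * v (p n))"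
        by simp
      also have "\<dots> \<le> (\<bar>c n\<bar> ^ 3 * K / 6) * (real n * (2 * Gam * real n powr 0.45))"
      proof (intro mult_left_mono mult_mono)
        show "v (p n) \<le> 2 * Gam * real n powr 0.45"
          by (rule order_trans[OF v_le]) (use p_bd(2)[of n] Gam_nonneg in \<open>auto intro!: mult_left_mono\<close>)
      qed (use K_pos v_nonneg rp_le[of n] in auto)
      also have "\<dots> = \<bar>\<theta>\<bar> ^ 3 / (real n * sqrt (real n)) * K / 6 * (real n * (2 * Gam * real n powr 0.45))"
        using n0 by (simp add: ac power_divide power3_eq_cube)
      also have "\<dots> = \<bar>\<theta>\<bar> ^ 3 * K * Gam / 3 * (real n powr 0.45 / sqrt (real n))"
        using n0 by (simp add: field_simps)
      finally show ?thesis .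
    qed
    have t5: "real (r n) * ((c n)\<^sup>2 * v (p n) / 2)\<^sup>2 \<le> \<theta> ^ 4 * Gam\<^sup>2 * (real n powr 0.45 / real n)"
    proof -
      have "(c n)\<^sup>2 * v (p n) / 2 \<le> (c n)\<^sup>2 * (2 * Gam * real (p n)) / 2"
        using v_le[of "p n"] by (intro divide_right_mono mult_left_mono) auto
      then have "((c n)\<^sup>2 * v (p n) / 2)\<^sup>2 \<le> ((c n)\<^sup>2 * (2 * Gam * real (p n)) / 2)\<^sup>2"
        using v_nonneg by (intro power_mono) auto
      also have "\<dots> = (c n) ^ 4 * Gam\<^sup>2 * (real (p n) * real (p n))"
        by (simp add: power_mult_distrib power2_eq_square power4_eq_xxxx mult_ac)
      finally have "real (r n) * ((c n)\<^sup>2 * v (p n) / 2)\<^sup>2 \<le> real (r n) * ((c n) ^ 4 * Gam\<^sup>2 * (real (p n) * real (p n)))"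
        by (intro mult_left_mono) auto
      also have "\<dots> = ((c n) ^ 4 * Gam\<^sup>2) * ((real (r n) * real (p n)) * real (p n))" by simp
      also have "\<dots> \<le> ((c n) ^ 4 * Gam\<^sup>2) * (real n * real n powr 0.45)"
        using rp_le[of n] p_bd(2)[of n] by (intro mult_left_mono mult_mono) auto
      also have "\<dots> = \<theta> ^ 4 / (real n * real n) * Gam\<^sup>2 * (real n * real n powr 0.45)"
        using n0 by (simp add: c_def power_divide power4_eq_xxxx)
      also have "\<dots> = \<theta> ^ 4 * Gam\<^sup>2 * (real n powr 0.45 / real n)"
        using n0 by (simp add: field_simps)
      finally show ?thesis .
    qed
    note blocking_bound[OF n p1[OF n], of \<theta> "l n", folded r_def c_def]
    also have "\<bar>c n\<bar> * sqrt (2 * Gam * (real n - real (r n) * real (p n)))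
        + 2 * \<bar>c n\<bar> * (real (r n) * real (p n)) * (D / (real (l n) + 1) ^ 3) + real (r n) * (4 * C / (real (l n) + 1) ^ 3)
        + real (r n) * (\<bar>c n\<bar> ^ 3 * real (p n) * K * v (p n) / 6 + ((c n)\<^sup>2 * v (p n) / 2)\<^sup>2) \<le> err n"
      unfolding err_def distrib_left t1 by (intro add_mono order_refl t2 t3 t4 t5)
    finally show ?thesis .
  qed
  have "(\<lambda>n. (\<integral>\<omega>. cis (c n * (\<Sum>t<n. U (int t) \<omega>)) \<partial>M) - complex_of_real (exp (- ((c n)\<^sup>2 * v (p n) / 2))) ^ r n) \<longlonglongrightarrow> 0"
    by (rule Lim_null_comparison[OF _ err0]) (use bound in \<open>auto intro!: eventually_sequentiallyI[of 1]\<close>)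
  from tendsto_add[OF this main] show ?thesis by (simp add: c_def)
qed

end

section \<open>Ordinal patterns and the cell coupling\<close>

text \<open>The pattern depends on \<open>x\<close> only through this relation, one of finitely
  many. Congruence and measurability of the pattern thus follow from those of the relation, with the
  description operator left folded.\<close>

definition order_relation :: "nat \<Rightarrow> (nat \<Rightarrow> real) \<Rightarrow> (nat \<times> nat) set" where
  "order_relation m x = {(j, k). j < m \<and> k < m \<and> (x j < x k \<or> (x j = x k \<and> j < k))}"

lemma ord_pattern_order_relation:
  "ord_pattern m x = (THE \<pi>. \<pi> \<in> permutations_of_set {1..m} \<and>
      (\<forall>j<m. \<forall>k<m. \<pi> ! j < \<pi> ! k \<longleftrightarrow> (j, k) \<in> order_relation m x))"
  unfolding ord_pattern_def by (rule arg_cong[of _ _ The]) (auto simp: fun_eq_iff order_relation_def)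

lemma ord_pattern_cong:
  assumes "order_relation m x = order_relation m y"
  shows "ord_pattern m x = ord_pattern m y"
  by (simp add: ord_pattern_order_relation assms)

lemma measurable_ord_pattern:
  assumes "\<And>j. j < m \<Longrightarrow> x j \<in> borel_measurable M"
  shows "(\<lambda>\<omega>. ord_pattern m (\<lambda>j. x j \<omega>)) \<in> measurable M (count_space UNIV)"
proof -
  define A where "A = Pow ({..<m} \<times> {..<m})"
  have "(\<lambda>\<omega>. order_relation m (\<lambda>j. x j \<omega>)) \<in> measurable M (count_space A)"
  proof (subst measurable_count_space_eq2)
    show "finite A" by (simp add: A_def)
    have "(\<lambda>\<omega>. order_relation m (\<lambda>j. x j \<omega>)) -` {a} \<inter> space M \<in> sets M" if "a \<in> A" for a
    proof -
      have "(\<lambda>\<omega>. order_relation m (\<lambda>j. x j \<omega>)) -` {a} \<inter> space M = 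
        {\<omega> \<in> space M. \<forall>j\<in>{..<m}. \<forall>k\<in>{..<m}. (x j \<omega> < x k \<omega> \<or> (x j \<omega> = x k \<omega> \<and> j < k)) = ((j, k) \<in> a)}"
        using that by (auto simp: A_def order_relation_def set_eq_iff)
      also have "\<dots> \<in> sets M"
      proof (intro sets.sets_Collect_finite_All finite_lessThan)
        fix j k assume "j \<in> {..<m}" "k \<in> {..<m}"
        then have [measurable]: "x j \<in> borel_measurable M" "x k \<in> borel_measurable M" using assms by auto
        show "{\<omega> \<in> space M. (x j \<omega> < x k \<omega> \<or> (x j \<omega> = x k \<omega> \<and> j < k)) = ((j, k) \<in> a)} \<in> sets M"
          by measurable
      qed
      finally show ?thesis .
    qed
    then show "(\<lambda>\<omega>. order_relation m (\<lambda>j. x j \<omega>)) \<in> space M \<rightarrow> A \<and>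
      (\<forall>a\<in>A. (\<lambda>\<omega>. order_relation m (\<lambda>j. x j \<omega>)) -` {a} \<inter> space M \<in> sets M)"
      by (auto simp: A_def order_relation_def)
  qed
  then have "(\<lambda>\<omega>. (\<lambda>R. THE \<pi>. \<pi> \<in> permutations_of_set {1..m} \<and>
      (\<forall>j<m. \<forall>k<m. \<pi> ! j < \<pi> ! k \<longleftrightarrow> (j, k) \<in> R)) (order_relation m (\<lambda>j. x j \<omega>))) \<in> measurable M (count_space UNIV)"
    by (rule measurable_compose) simp
  then show ?thesis by (simp add: ord_pattern_order_relation)
qed

lemma op_delta_cong:
  assumes "\<And>l. l < m - 1 \<Longrightarrow> y l = y' l"
  shows "op_delta m y = op_delta m y'"
proof -
  have "(\<Sum>l<j. y l) = (\<Sum>l<j. y' l)" if "j < m" for j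
    using that assms by (intro sum.cong) auto
  then show ?thesis unfolding op_delta_def by (intro ord_pattern_cong) (auto simp: order_relation_def)
qed

lemma h_op_cong: "(\<And>l. l < m - 1 \<Longrightarrow> y l = y' l) \<Longrightarrow> h_op m y i = h_op m y' i"
  using op_delta_cong[of m y y'] by (simp add: h_op_def)

lemma measurable_h_op:
  assumes "\<And>l. l < m - 1 \<Longrightarrow> y l \<in> borel_measurable M"
  shows "(\<lambda>\<omega>. h_op m (\<lambda>l. y l \<omega>) i) \<in> borel_measurable M"
proof -
  have "(\<lambda>\<omega>. op_delta m (\<lambda>l. y l \<omega>)) \<in> measurable M (count_space UNIV)"
    unfolding op_delta_def
    by (intro measurable_ord_pattern borel_measurable_sum assms) auto
  then have "(\<lambda>\<omega>. (\<lambda>\<pi>. if \<pi> = op_enum m i then 1 else 0 :: real) (op_delta m (\<lambda>l. y l \<omega>))) \<in> borel_measurable M"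
    by (rule measurable_compose) simp
  then show ?thesis by (simp add: h_op_def)
qed

lemma h_op_bounds: "0 \<le> h_op m y i" "h_op m y i \<le> 1"
  by (simp_all add: h_op_def)

lemma vnorm_nonneg: "0 \<le> vnorm d y"
  by (simp add: vnorm_def sum_nonneg)

lemma vnorm_le_sum_abs: "vnorm d y \<le> (\<Sum>i<d. \<bar>y i\<bar>)"
  using L2_set_le_sum_abs[of y "{..<d}"] by (simp add: vnorm_def L2_set_def)

lemma abs_le_vnorm: "i < d \<Longrightarrow> \<bar>y i\<bar> \<le> vnorm d y"
  using member_le_L2_set[of "{..<d}" i "\<lambda>i. \<bar>y i\<bar>"] by (simp add: vnorm_def L2_set_def)

section \<open>Coupling two copies of the sample point inside a cell\<close>

context prob_space
begin

text \<open>The joint law of two copies of \<open>\<omega>\<close> that are conditionally independent given the cell \<open>\<kappa> \<omega>\<close>.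
  As there are only countably many cells, no regular conditional probabilities are needed.\<close>

definition cell_prob :: "('a \<Rightarrow> nat) \<Rightarrow> nat \<Rightarrow> real" where
  "cell_prob \<kappa> c = measure M {\<omega> \<in> space M. \<kappa> \<omega> = c}"

definition cell_weight :: "('a \<Rightarrow> nat) \<Rightarrow> 'a \<times> 'a \<Rightarrow> real" where
  "cell_weight \<kappa> x = (if \<kappa> (fst x) = \<kappa> (snd x) then 1 / cell_prob \<kappa> (\<kappa> (fst x)) else 0)"

definition cell_coupling :: "('a \<Rightarrow> nat) \<Rightarrow> ('a \<times> 'a) measure" where
  "cell_coupling \<kappa> = density (M \<Otimes>\<^sub>M M) (\<lambda>x. ennreal (cell_weight \<kappa> x))"

text \<open>The elementary conditional expectation of \<open>H\<close> given the cell. On a null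
  cell the division by 0 yields 0, so that bounds between 0 and 1 hold for every cell.\<close>

definition cell_average :: "('a \<Rightarrow> nat) \<Rightarrow> ('a \<Rightarrow> real) \<Rightarrow> nat \<Rightarrow> real" where
  "cell_average \<kappa> H c = (\<integral>\<omega>. H \<omega> * indicator {\<omega> \<in> space M. \<kappa> \<omega> = c} \<omega> \<partial>M) / cell_prob \<kappa> c"

context
  fixes \<kappa> :: "'a \<Rightarrow> nat"
  assumes \<kappa>[measurable]: "\<kappa> \<in> measurable M (count_space UNIV)"
begin

lemma cell_weight_measurable [measurable]: "cell_weight \<kappa> \<in> borel_measurable (M \<Otimes>\<^sub>M M)"
proof -
  have [measurable]: "(\<lambda>\<omega>. 1 / cell_prob \<kappa> (\<kappa> \<omega>)) \<in> borel_measurable M"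
    using measurable_compose[OF \<kappa>, of "\<lambda>c. 1 / cell_prob \<kappa> c" borel] by simp
  have "cell_weight \<kappa> = (\<lambda>x. if real (\<kappa> (fst x)) = real (\<kappa> (snd x)) then 1 / cell_prob \<kappa> (\<kappa> (fst x)) else 0)"
    by (auto simp: cell_weight_def fun_eq_iff)
  also have "\<dots> \<in> borel_measurable (M \<Otimes>\<^sub>M M)" by measurable
  finally show ?thesis .
qed

lemma cell_prob_nonneg: "cell_prob \<kappa> c \<ge> 0"
  by (simp add: cell_prob_def)

lemma cell_weight_swap: "cell_weight \<kappa> (x, y) = cell_weight \<kappa> (y, x)"
  by (simp add: cell_weight_def)

text \<open>There are countably many cells, so the union of those of probability 0 is a null
  set.\<close>

lemma AE_cell_prob_pos: "AE \<omega> in M. cell_prob \<kappa> (\<kappa> \<omega>) > 0"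
proof -
  have "AE \<omega> in M. \<kappa> \<omega> = c \<longrightarrow> cell_prob \<kappa> c > 0" for c
  proof (cases "cell_prob \<kappa> c > 0")
    case False
    then have "measure M {\<omega> \<in> space M. \<kappa> \<omega> = c} = 0" by (simp add: cell_prob_def zero_less_measure_iff)
    then have "AE \<omega> in M. \<not> (\<kappa> \<omega> = c)"
      by (subst AE_iff_measurable[OF _ refl]) (auto simp: emeasure_eq_measure)
    then show ?thesis by eventually_elim simp
  qed auto
  then have "AE \<omega> in M. \<forall>c. \<kappa> \<omega> = c \<longrightarrow> cell_prob \<kappa> c > 0"
    by (intro AE_all_countable[THEN iffD2] allI)
  then show ?thesis by eventually_elim simp
qed

lemma nn_integral_cell_weight:
  assumes "cell_prob \<kappa> (\<kappa> \<omega>) > 0" "\<omega> \<in> space M"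
  shows "(\<integral>\<^sup>+\<omega>'. ennreal (cell_weight \<kappa> (\<omega>, \<omega>')) \<partial>M) = 1"
proof -
  have "(\<integral>\<^sup>+\<omega>'. ennreal (cell_weight \<kappa> (\<omega>, \<omega>')) \<partial>M)
    = (\<integral>\<^sup>+\<omega>'. ennreal (1 / cell_prob \<kappa> (\<kappa> \<omega>)) * indicator {\<omega>' \<in> space M. \<kappa> \<omega>' = \<kappa> \<omega>} \<omega>' \<partial>M)"
    by (intro nn_integral_cong) (auto simp: cell_weight_def)
  also have "\<dots> = ennreal (1 / cell_prob \<kappa> (\<kappa> \<omega>)) * emeasure M {\<omega>' \<in> space M. \<kappa> \<omega>' = \<kappa> \<omega>}"
    by (intro nn_integral_cmult_indicator) measurable
  also have "\<dots> = ennreal (1 / cell_prob \<kappa> (\<kappa> \<omega>) * cell_prob \<kappa> (\<kappa> \<omega>))"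
    by (simp add: emeasure_eq_measure cell_prob_def flip: ennreal_mult'')
  also have "\<dots> = 1" using assms by simp
  finally show ?thesis .
qed

lemma sets_cell_coupling [simp, measurable_cong]: "sets (cell_coupling \<kappa>) = sets (M \<Otimes>\<^sub>M M)"
  by (simp add: cell_coupling_def)

lemma space_cell_coupling [simp]: "space (cell_coupling \<kappa>) = space M \<times> space M"
  by (simp add: cell_coupling_def space_pair_measure)

lemma nn_integral_cell_coupling:
  assumes f: "f \<in> borel_measurable (M \<Otimes>\<^sub>M M)"
  shows "(\<integral>\<^sup>+x. f x \<partial>cell_coupling \<kappa>) = (\<integral>\<^sup>+\<omega>. (\<integral>\<^sup>+\<omega>'. ennreal (cell_weight \<kappa> (\<omega>, \<omega>')) * f (\<omega>, \<omega>') \<partial>M) \<partial>M)"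
    and "(\<integral>\<^sup>+x. f x \<partial>cell_coupling \<kappa>) = (\<integral>\<^sup>+\<omega>'. (\<integral>\<^sup>+\<omega>. ennreal (cell_weight \<kappa> (\<omega>, \<omega>')) * f (\<omega>, \<omega>') \<partial>M) \<partial>M)"
proof -
  interpret P: pair_sigma_finite M M ..
  note [measurable] = f
  have d: "(\<integral>\<^sup>+x. f x \<partial>cell_coupling \<kappa>) = (\<integral>\<^sup>+x. ennreal (cell_weight \<kappa> x) * f x \<partial>(M \<Otimes>\<^sub>M M))"
    unfolding cell_coupling_def by (rule nn_integral_density) auto
  have m: "(\<lambda>x. ennreal (cell_weight \<kappa> x) * f x) \<in> borel_measurable (M \<Otimes>\<^sub>M M)" by measurable
  show "(\<integral>\<^sup>+x. f x \<partial>cell_coupling \<kappa>) = (\<integral>\<^sup>+\<omega>. (\<integral>\<^sup>+\<omega>'. ennreal (cell_weight \<kappa> (\<omega>, \<omega>')) * f (\<omega>, \<omega>') \<partial>M) \<partial>M)"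
    unfolding d using nn_integral_fst[OF m] by simp
  show "(\<integral>\<^sup>+x. f x \<partial>cell_coupling \<kappa>) = (\<integral>\<^sup>+\<omega>'. (\<integral>\<^sup>+\<omega>. ennreal (cell_weight \<kappa> (\<omega>, \<omega>')) * f (\<omega>, \<omega>') \<partial>M) \<partial>M)"
    unfolding d using P.nn_integral_snd[of "\<lambda>x. ennreal (cell_weight \<kappa> x) * f x"] m by (simp add: split_beta')
qed

lemma nn_integral_cell_coupling_marginal:
  fixes f :: "'a \<Rightarrow> ennreal"
  assumes f[measurable]: "f \<in> borel_measurable M"
  shows "(\<integral>\<^sup>+x. f (fst x) \<partial>cell_coupling \<kappa>) = (\<integral>\<^sup>+\<omega>. f \<omega> \<partial>M)"
    and "(\<integral>\<^sup>+x. f (snd x) \<partial>cell_coupling \<kappa>) = (\<integral>\<^sup>+\<omega>. f \<omega> \<partial>M)"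
proof -
  have m: "(\<lambda>x. f (fst x)) \<in> borel_measurable (M \<Otimes>\<^sub>M M)" "(\<lambda>x. f (snd x)) \<in> borel_measurable (M \<Otimes>\<^sub>M M)"
    by measurable
  have *: "(\<integral>\<^sup>+\<omega>. (\<integral>\<^sup>+\<omega>'. ennreal (cell_weight \<kappa> (\<omega>, \<omega>')) * f \<omega> \<partial>M) \<partial>M) = (\<integral>\<^sup>+\<omega>. f \<omega> \<partial>M)"
  proof (rule nn_integral_cong_AE)
    show "AE \<omega> in M. (\<integral>\<^sup>+\<omega>'. ennreal (cell_weight \<kappa> (\<omega>, \<omega>')) * f \<omega> \<partial>M) = f \<omega>"
      using AE_cell_prob_pos AE_space
    proof eventually_elim
      case (elim \<omega>)
      then have [measurable]: "(\<lambda>\<omega>'. cell_weight \<kappa> (\<omega>, \<omega>')) \<in> borel_measurable M"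
        using measurable_Pair2'[of \<omega> M M] by (auto intro: measurable_compose[OF _ cell_weight_measurable])
      show ?case using nn_integral_cell_weight[OF elim] by (subst nn_integral_multc) auto
    qed
  qed
  show "(\<integral>\<^sup>+x. f (fst x) \<partial>cell_coupling \<kappa>) = (\<integral>\<^sup>+\<omega>. f \<omega> \<partial>M)"
    using nn_integral_cell_coupling(1)[OF m(1)] * by simp
  show "(\<integral>\<^sup>+x. f (snd x) \<partial>cell_coupling \<kappa>) = (\<integral>\<^sup>+\<omega>. f \<omega> \<partial>M)"
    using nn_integral_cell_coupling(2)[OF m(2)] * by (simp add: cell_weight_swap)
qed

text \<open>Both marginals are \<open>M\<close> itself, so any random vector read off from the two
  coordinates has the same law twice, as \<open>one_continuous\<close> demands. The second case
  follows from the symmetry of the weight.\<close>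

lemma distr_cell_coupling:
  "distr (cell_coupling \<kappa>) M fst = M" "distr (cell_coupling \<kappa>) M snd = M"
proof -
  show "distr (cell_coupling \<kappa>) M fst = M"
  proof (rule measure_eqI)
    fix A assume "A \<in> sets (distr (cell_coupling \<kappa>) M fst)"
    then have [measurable]: "A \<in> sets M" by simp
    show "emeasure (distr (cell_coupling \<kappa>) M fst) A = emeasure M A"
      using nn_integral_cell_coupling_marginal(1)[of "indicator A"]
      by (subst nn_integral_indicator[symmetric], simp, subst nn_integral_distr) auto
  qed simp
  show "distr (cell_coupling \<kappa>) M snd = M"
  proof (rule measure_eqI)
    fix A assume "A \<in> sets (distr (cell_coupling \<kappa>) M snd)"
    then have [measurable]: "A \<in> sets M" by simp
    show "emeasure (distr (cell_coupling \<kappa>) M snd) A = emeasure M A"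
      using nn_integral_cell_coupling_marginal(2)[of "indicator A"]
      by (subst nn_integral_indicator[symmetric], simp, subst nn_integral_distr) auto
  qed simp
qed

lemma prob_space_cell_coupling: "prob_space (cell_coupling \<kappa>)"
proof
  have "emeasure (cell_coupling \<kappa>) (space (cell_coupling \<kappa>)) = (\<integral>\<^sup>+x. 1 \<partial>cell_coupling \<kappa>)" by simp
  then show "emeasure (cell_coupling \<kappa>) (space (cell_coupling \<kappa>)) = 1"
    using nn_integral_cell_coupling_marginal(1)[of "\<lambda>_. 1"] by (simp add: emeasure_space_1)
qed

lemma AE_cell_coupling: "AE x in cell_coupling \<kappa>. \<kappa> (fst x) = \<kappa> (snd x)"
proof -
  have "AE x in M \<Otimes>\<^sub>M M. 0 < ennreal (cell_weight \<kappa> x) \<longrightarrow> \<kappa> (fst x) = \<kappa> (snd x)"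
    by (simp add: cell_weight_def)
  then show ?thesis unfolding cell_coupling_def by (subst AE_density) auto
qed

lemma cell_average_bounds:
  assumes [measurable]: "H \<in> borel_measurable M" and H: "\<And>\<omega>. \<omega> \<in> space M \<Longrightarrow> 0 \<le> H \<omega> \<and> H \<omega> \<le> 1"
  shows "0 \<le> cell_average \<kappa> H c" "cell_average \<kappa> H c \<le> 1"
proof -
  show "0 \<le> cell_average \<kappa> H c" unfolding cell_average_def
    using H cell_prob_nonneg by (intro divide_nonneg_nonneg Bochner_Integration.integral_nonneg) (auto simp: indicator_def)
  have "(\<integral>\<omega>. H \<omega> * indicator {\<omega> \<in> space M. \<kappa> \<omega> = c} \<omega> \<partial>M) \<le> (\<integral>\<omega>. indicator {\<omega> \<in> space M. \<kappa> \<omega> = c} \<omega> \<partial>M)"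
    using H by (intro integral_mono integrable_const_bound[of _ 1] AE_I2) (auto simp: indicator_def)
  also have "\<dots> = cell_prob \<kappa> c" by (simp add: cell_prob_def)
  finally show "cell_average \<kappa> H c \<le> 1"
    unfolding cell_average_def using cell_prob_nonneg[of c] by (auto simp: divide_le_eq_1)
qed

text \<open>Jensen's inequality within a cell: the deviation of \<open>H\<close> at a point from the
  cell average is the average of its differences to the other points of the cell. Integrating the
  absolute values gives the coupling integral.\<close>

lemma cell_average_error:
  assumes H[measurable]: "H \<in> borel_measurable M" and Hb: "\<And>\<omega>. \<omega> \<in> space M \<Longrightarrow> 0 \<le> H \<omega> \<and> H \<omega> \<le> 1"
  shows "(\<integral>\<omega>. \<bar>H \<omega> - cell_average \<kappa> H (\<kappa> \<omega>)\<bar> \<partial>M) \<le> (\<integral>x. \<bar>H (fst x) - H (snd x)\<bar> \<partial>cell_coupling \<kappa>)"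
proof -
  interpret D: prob_space "cell_coupling \<kappa>" by (rule prob_space_cell_coupling)
  have Hd: "\<bar>H \<omega> - H \<omega>'\<bar> \<le> 1" if "\<omega> \<in> space M" "\<omega>' \<in> space M" for \<omega> \<omega>'
    using Hb[OF that(1)] Hb[OF that(2)] by linarith
  have [measurable]: "(\<lambda>\<omega>. cell_average \<kappa> H (\<kappa> \<omega>)) \<in> borel_measurable M"
    using measurable_compose[OF \<kappa>, of "cell_average \<kappa> H" borel] by simp
  have le: "AE \<omega> in M. ennreal \<bar>H \<omega> - cell_average \<kappa> H (\<kappa> \<omega>)\<bar> \<le> (\<integral>\<^sup>+\<omega>'. ennreal (cell_weight \<kappa> (\<omega>, \<omega>')) * ennreal \<bar>H \<omega> - H \<omega>'\<bar> \<partial>M)"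
    using AE_cell_prob_pos AE_space
  proof eventually_elim
    case (elim \<omega>)
    define c where "c = \<kappa> \<omega>"
    define A where "A = {\<omega>' \<in> space M. \<kappa> \<omega>' = c}"
    have [measurable]: "A \<in> sets M" unfolding A_def by measurable
    have pos: "cell_prob \<kappa> c > 0" using elim by (simp add: c_def)
    have mA: "measure M A = cell_prob \<kappa> c" by (simp add: A_def cell_prob_def)
    have iH: "integrable M (\<lambda>\<omega>'. H \<omega>' * indicator A \<omega>')"
      using Hb by (intro integrable_const_bound[of _ 1] AE_I2) (auto simp: indicator_def)
    have iA: "integrable M (\<lambda>\<omega>'. H \<omega> * indicator A \<omega>')"
      using Hb[OF elim(2)] by (intro integrable_const_bound[of _ 1] AE_I2) (auto simp: indicator_def)
    have iD: "integrable M (\<lambda>\<omega>'. indicator A \<omega>' * \<bar>H \<omega> - H \<omega>'\<bar>)"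
      using Hd[OF elim(2)] by (intro integrable_const_bound[of _ 1] AE_I2) (auto simp: indicator_def)
    have "H \<omega> - cell_average \<kappa> H c = (\<integral>\<omega>'. H \<omega> * indicator A \<omega>' - H \<omega>' * indicator A \<omega>' \<partial>M) / cell_prob \<kappa> c"
      using iH iA pos mA by (simp add: cell_average_def A_def[symmetric] field_simps)
    also have "(\<integral>\<omega>'. H \<omega> * indicator A \<omega>' - H \<omega>' * indicator A \<omega>' \<partial>M) = (\<integral>\<omega>'. indicator A \<omega>' * (H \<omega> - H \<omega>') \<partial>M)"
      by (intro Bochner_Integration.integral_cong) (auto simp: algebra_simps)
    finally have "\<bar>H \<omega> - cell_average \<kappa> H c\<bar> = \<bar>\<integral>\<omega>'. indicator A \<omega>' * (H \<omega> - H \<omega>') \<partial>M\<bar> / cell_prob \<kappa> c"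
      using pos by (simp add: abs_divide)
    also have "\<dots> \<le> (\<integral>\<omega>'. \<bar>indicator A \<omega>' * (H \<omega> - H \<omega>')\<bar> \<partial>M) / cell_prob \<kappa> c"
      using pos by (intro divide_right_mono integral_abs_bound) auto
    also have "\<dots> = (\<integral>\<omega>'. 1 / cell_prob \<kappa> c * (indicator A \<omega>' * \<bar>H \<omega> - H \<omega>'\<bar>) \<partial>M)"
      by (simp add: abs_mult)
    finally have "ennreal \<bar>H \<omega> - cell_average \<kappa> H c\<bar> \<le> ennreal (\<integral>\<omega>'. 1 / cell_prob \<kappa> c * (indicator A \<omega>' * \<bar>H \<omega> - H \<omega>'\<bar>) \<partial>M)"
      by (rule ennreal_leI)
    also have "\<dots> = (\<integral>\<^sup>+\<omega>'. ennreal (1 / cell_prob \<kappa> c * (indicator A \<omega>' * \<bar>H \<omega> - H \<omega>'\<bar>)) \<partial>M)"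
      using iD pos by (intro nn_integral_eq_integral[symmetric] integrable_mult_right) auto
    also have "\<dots> = (\<integral>\<^sup>+\<omega>'. ennreal (cell_weight \<kappa> (\<omega>, \<omega>')) * ennreal \<bar>H \<omega> - H \<omega>'\<bar> \<partial>M)"
      using pos by (intro nn_integral_cong) (auto simp: cell_weight_def A_def c_def indicator_def simp flip: ennreal_mult'')
    finally show ?case by (simp add: c_def)
  qed
  have m: "(\<lambda>x. ennreal \<bar>H (fst x) - H (snd x)\<bar>) \<in> borel_measurable (M \<Otimes>\<^sub>M M)" by measurable
  have bd: "0 \<le> cell_average \<kappa> H c \<and> cell_average \<kappa> H c \<le> 1" for c using cell_average_bounds[OF H Hb] by auto
  have iL: "integrable M (\<lambda>\<omega>. \<bar>H \<omega> - cell_average \<kappa> H (\<kappa> \<omega>)\<bar>)"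
  proof (rule integrable_const_bound[of _ 1])
    show "AE \<omega> in M. norm \<bar>H \<omega> - cell_average \<kappa> H (\<kappa> \<omega>)\<bar> \<le> 1"
    proof (rule AE_I2)
      fix \<omega> assume "\<omega> \<in> space M"
      then show "norm \<bar>H \<omega> - cell_average \<kappa> H (\<kappa> \<omega>)\<bar> \<le> 1" using Hb[of \<omega>] bd[of "\<kappa> \<omega>"] by (auto simp: abs_le_iff)
    qed
  qed measurable
  have iR: "integrable (cell_coupling \<kappa>) (\<lambda>x. \<bar>H (fst x) - H (snd x)\<bar>)"
    using Hd by (intro D.integrable_const_bound[of _ 1] AE_I2) auto
  have "ennreal (\<integral>\<omega>. \<bar>H \<omega> - cell_average \<kappa> H (\<kappa> \<omega>)\<bar> \<partial>M) = (\<integral>\<^sup>+\<omega>. ennreal \<bar>H \<omega> - cell_average \<kappa> H (\<kappa> \<omega>)\<bar> \<partial>M)"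
    using iL by (intro nn_integral_eq_integral[symmetric]) auto
  also have "\<dots> \<le> (\<integral>\<^sup>+\<omega>. (\<integral>\<^sup>+\<omega>'. ennreal (cell_weight \<kappa> (\<omega>, \<omega>')) * ennreal \<bar>H \<omega> - H \<omega>'\<bar> \<partial>M) \<partial>M)"
    by (rule nn_integral_mono_AE[OF le])
  also have "\<dots> = (\<integral>\<^sup>+x. ennreal \<bar>H (fst x) - H (snd x)\<bar> \<partial>cell_coupling \<kappa>)"
    using nn_integral_cell_coupling(1)[OF m] by simp
  also have "\<dots> = ennreal (\<integral>x. \<bar>H (fst x) - H (snd x)\<bar> \<partial>cell_coupling \<kappa>)"
    using iR by (intro nn_integral_eq_integral) auto
  finally show ?thesis by (simp add: ennreal_le_iff)
qed

end

end

text \<open>By \<open>cell_average_error\<close> it suffices to bound the kernel difference under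
  the coupling. Where the two increment vectors are within \<open>\<epsilon>\<close>, 1-continuity
  gives \<open>\<phi> \<epsilon>\<close>; elsewhere the difference is at most 1 and Markov's
  inequality applies to a bound on their distance.\<close>

lemma (in prob_space) one_continuous_cell_error:
  fixes Y W :: "nat \<Rightarrow> 'a \<Rightarrow> real" and \<kappa> :: "'a \<Rightarrow> nat"
  assumes \<kappa>[measurable]: "\<kappa> \<in> measurable M (count_space UNIV)"
    and Y: "\<And>l. Y l \<in> borel_measurable M"
    and cont: "one_continuous m (distr M (PiM {..<m-1} (\<lambda>_. borel)) (\<lambda>\<omega>. \<lambda>l\<in>{..<m-1}. Y l \<omega>)) \<phi>"
    and W: "\<And>l. l < m - 1 \<Longrightarrow> integrable M (\<lambda>\<omega>. Y l \<omega> - W l \<omega>)"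
    and e: "\<And>l. l < m - 1 \<Longrightarrow> (\<integral>\<omega>. \<bar>Y l \<omega> - W l \<omega>\<bar> \<partial>M) \<le> e l"
    and cell: "\<And>\<omega> \<omega>' l. \<omega> \<in> space M \<Longrightarrow> \<omega>' \<in> space M \<Longrightarrow> \<kappa> \<omega> = \<kappa> \<omega>' \<Longrightarrow> l < m - 1 \<Longrightarrow> \<bar>W l \<omega> - W l \<omega>'\<bar> \<le> \<delta>"
    and eps: "\<epsilon> > 0" and i: "i < fact m"
  shows "(\<integral>\<omega>. \<bar>h_op m (\<lambda>l. Y l \<omega>) i - cell_average \<kappa> (\<lambda>\<omega>. h_op m (\<lambda>l. Y l \<omega>) i) (\<kappa> \<omega>)\<bar> \<partial>M)
    \<le> \<phi> \<epsilon> + (2 * (\<Sum>l<m-1. e l) + real (m - 1) * \<delta>) / \<epsilon>"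
proof -
  define d where "d = m - 1"
  define P where "P = PiM {..<d} (\<lambda>_. borel :: real measure)"
  define D where "D = cell_coupling \<kappa>"
  define yv where "yv \<omega> = (\<lambda>l\<in>{..<d}. Y l \<omega>)" for \<omega>
  define H where "H \<omega> = h_op m (\<lambda>l. Y l \<omega>) i" for \<omega>
  interpret D: prob_space D unfolding D_def by (rule prob_space_cell_coupling[OF \<kappa>])
  note [measurable] = Y
  have setsD[measurable_cong]: "sets D = sets (M \<Otimes>\<^sub>M M)" by (simp add: D_def sets_cell_coupling[OF \<kappa>])
  have spD: "space D = space M \<times> space M" by (simp add: D_def space_cell_coupling[OF \<kappa>])
  have dD: "distr D M fst = M" "distr D M snd = M" unfolding D_def using distr_cell_coupling[OF \<kappa>] by auto
  have yv[measurable]: "yv \<in> measurable M P" unfolding yv_def P_def by measurable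
  have fs[measurable]: "fst \<in> measurable D M" "snd \<in> measurable D M" by measurable
  have H[measurable]: "H \<in> borel_measurable M" unfolding H_def by (intro measurable_h_op) auto
  have Hyv: "h_op m (yv \<omega>) j = h_op m (\<lambda>l. Y l \<omega>) j" for \<omega> j
    by (rule h_op_cong) (auto simp: yv_def d_def)
  define T where "T x = (yv (fst x), yv (snd x))" for x
  have T[measurable]: "T \<in> measurable D (P \<Otimes>\<^sub>M P)" unfolding T_def by measurable
  define \<mu> where "\<mu> = distr D (P \<Otimes>\<^sub>M P) T"
  have "distr \<mu> P fst = distr D P (yv \<circ> fst)" unfolding \<mu>_def by (subst distr_distr) (auto simp: T_def comp_def)
  also have "\<dots> = distr (distr D M fst) P yv" by (rule distr_distr[symmetric]) measurable
  finally have \<mu>1: "distr \<mu> P fst = distr M P yv" by (simp add: dD)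
  have "distr \<mu> P snd = distr D P (yv \<circ> snd)" unfolding \<mu>_def by (subst distr_distr) (auto simp: T_def comp_def)
  also have "\<dots> = distr (distr D M snd) P yv" by (rule distr_distr[symmetric]) measurable
  finally have \<mu>2: "distr \<mu> P snd = distr M P yv" by (simp add: dD)
  define vn where "vn z = vnorm (fact m) (\<lambda>j. h_op m (fst z) j - h_op m (snd z) j)" for z
  define dn where "dn z = vnorm d (\<lambda>j. fst z j - snd z j)" for z :: "(nat \<Rightarrow> real) \<times> (nat \<Rightarrow> real)"
  have comp: "(\<lambda>z. fst z l) \<in> borel_measurable (P \<Otimes>\<^sub>M P)" "(\<lambda>z. snd z l) \<in> borel_measurable (P \<Otimes>\<^sub>M P)" if "l < d" for l
    unfolding P_def using that by (auto intro!: measurable_compose[OF measurable_fst] measurable_compose[OF measurable_snd] measurable_component_singleton)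
  have [measurable]: "(\<lambda>z. h_op m (fst z) j) \<in> borel_measurable (P \<Otimes>\<^sub>M P)" "(\<lambda>z. h_op m (snd z) j) \<in> borel_measurable (P \<Otimes>\<^sub>M P)" for j
    using comp by (auto intro!: measurable_h_op simp: d_def)
  have [measurable]: "vn \<in> borel_measurable (P \<Otimes>\<^sub>M P)" unfolding vn_def vnorm_def by measurable
  have [measurable]: "(\<lambda>z. \<Sum>j<d. (fst z j - snd z j)\<^sup>2) \<in> borel_measurable (P \<Otimes>\<^sub>M P)" using comp
    by (intro borel_measurable_sum borel_measurable_power borel_measurable_diff) auto
  have [measurable]: "dn \<in> borel_measurable (P \<Otimes>\<^sub>M P)" unfolding dn_def vnorm_def by measurable
  have "(\<integral>z. vn z * indicator {z. dn z \<le> \<epsilon>} z \<partial>\<mu>) \<le> \<phi> \<epsilon>"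
  proof -
    have "prob_space \<mu>" unfolding \<mu>_def by (rule D.prob_space_distr[OF T])
    moreover have "sets \<mu> = sets (P \<Otimes>\<^sub>M P)" by (simp add: \<mu>_def)
    ultimately show ?thesis
      using cont eps \<mu>1 \<mu>2 unfolding one_continuous_def P_def d_def vn_def dn_def yv_def by blast
  qed
  \<comment> \<open>The set in the indicator is not confined to the space of \<open>\<mu>\<close>;
    the conditional form is a measurable function on that space and can be composed with
    \<open>T\<close>.\<close>
  also have "(\<integral>z. vn z * indicator {z. dn z \<le> \<epsilon>} z \<partial>\<mu>) = (\<integral>z. vn z * (if dn z \<le> \<epsilon> then 1 else 0) \<partial>\<mu>)"
    by (intro Bochner_Integration.integral_cong) (auto simp: indicator_def)
  also have "\<dots> = (\<integral>x. vn (T x) * (if dn (T x) \<le> \<epsilon> then 1 else 0) \<partial>D)"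
    unfolding \<mu>_def by (rule integral_distr) measurable
  finally have main: "(\<integral>x. vn (T x) * (if dn (T x) \<le> \<epsilon> then 1 else 0) \<partial>D) \<le> \<phi> \<epsilon>" .
  have vn_le: "vn z \<le> real (fact m)" for z
  proof -
    have "vn z \<le> (\<Sum>j<fact m. \<bar>h_op m (fst z) j - h_op m (snd z) j\<bar>)" unfolding vn_def by (rule vnorm_le_sum_abs)
    also have "\<dots> \<le> (\<Sum>j<(fact m::nat). 1)"
      by (intro sum_mono) (auto simp: h_op_def)
    finally show ?thesis by simp
  qed
  have vn0: "vn z \<ge> 0" "dn z \<ge> 0" for z by (simp_all add: vn_def dn_def vnorm_nonneg)
  have i1: "integrable D (\<lambda>x. vn (T x) * (if dn (T x) \<le> \<epsilon> then 1 else 0))"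
  proof (rule D.integrable_const_bound[of _ "real (fact m)"])
    show "AE x in D. norm (vn (T x) * (if dn (T x) \<le> \<epsilon> then 1 else 0)) \<le> real (fact m)"
      using vn_le vn0 by (intro AE_I2) auto
  qed measurable
  have iW: "integrable D (\<lambda>x. \<bar>Y l (fst x) - W l (fst x)\<bar>)" "integrable D (\<lambda>x. \<bar>Y l (snd x) - W l (snd x)\<bar>)"
    and EW: "(\<integral>x. \<bar>Y l (fst x) - W l (fst x)\<bar> \<partial>D) \<le> e l" "(\<integral>x. \<bar>Y l (snd x) - W l (snd x)\<bar> \<partial>D) \<le> e l"
    if "l < d" for l
  proof -
    have a: "integrable M (\<lambda>\<omega>. \<bar>Y l \<omega> - W l \<omega>\<bar>)" and [measurable]: "(\<lambda>\<omega>. \<bar>Y l \<omega> - W l \<omega>\<bar>) \<in> borel_measurable M"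
      using W[of l] that by (auto simp: d_def)
    show "integrable D (\<lambda>x. \<bar>Y l (fst x) - W l (fst x)\<bar>)"
      using integrable_distr[OF fs(1), of "\<lambda>\<omega>. \<bar>Y l \<omega> - W l \<omega>\<bar>"] a dD by simp
    show "integrable D (\<lambda>x. \<bar>Y l (snd x) - W l (snd x)\<bar>)"
      using integrable_distr[OF fs(2), of "\<lambda>\<omega>. \<bar>Y l \<omega> - W l \<omega>\<bar>"] a dD by simp
    show "(\<integral>x. \<bar>Y l (fst x) - W l (fst x)\<bar> \<partial>D) \<le> e l"
      using integral_distr[OF fs(1), of "\<lambda>\<omega>. \<bar>Y l \<omega> - W l \<omega>\<bar>"] dD e[of l] that by (simp add: d_def)
    show "(\<integral>x. \<bar>Y l (snd x) - W l (snd x)\<bar> \<partial>D) \<le> e l"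
      using integral_distr[OF fs(2), of "\<lambda>\<omega>. \<bar>Y l \<omega> - W l \<omega>\<bar>"] dD e[of l] that by (simp add: d_def)
  qed
  \<comment> \<open>Triangle inequality through \<open>W\<close> at both points, coordinate by
    coordinate; in a common cell the two values of \<open>W\<close> differ by at most
    \<open>\<delta>\<close>.\<close>
  define q where "q x = (\<Sum>l<d. \<bar>Y l (fst x) - W l (fst x)\<bar> + \<bar>Y l (snd x) - W l (snd x)\<bar> + \<delta>)" for x
  have iq: "integrable D q" unfolding q_def using iW by (intro Bochner_Integration.integrable_sum) auto
  have Eq: "(\<integral>x. q x \<partial>D) \<le> 2 * (\<Sum>l<d. e l) + real d * \<delta>"
  proof -
    have "(\<integral>x. q x \<partial>D) = (\<Sum>l<d. \<integral>x. \<bar>Y l (fst x) - W l (fst x)\<bar> + \<bar>Y l (snd x) - W l (snd x)\<bar> + \<delta> \<partial>D)"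
      unfolding q_def using iW by (intro Bochner_Integration.integral_sum) auto
    also have "\<dots> = (\<Sum>l<d. (\<integral>x. \<bar>Y l (fst x) - W l (fst x)\<bar> \<partial>D) + (\<integral>x. \<bar>Y l (snd x) - W l (snd x)\<bar> \<partial>D) + \<delta>)"
      using iW by (intro sum.cong refl) (simp add: D.prob_space)
    also have "\<dots> \<le> (\<Sum>l<d. e l + e l + \<delta>)" using EW by (intro sum_mono add_mono) auto
    finally show ?thesis by (simp add: sum.distrib sum_distrib_left)
  qed
  have Hb: "0 \<le> H \<omega> \<and> H \<omega> \<le> 1" for \<omega> by (simp add: H_def h_op_bounds)
  have "(\<integral>\<omega>. \<bar>H \<omega> - cell_average \<kappa> H (\<kappa> \<omega>)\<bar> \<partial>M) \<le> (\<integral>x. \<bar>H (fst x) - H (snd x)\<bar> \<partial>D)"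
    unfolding D_def by (rule cell_average_error[OF \<kappa> H Hb])
  also have "\<dots> \<le> (\<integral>x. vn (T x) * (if dn (T x) \<le> \<epsilon> then 1 else 0) + q x / \<epsilon> \<partial>D)"
  proof (rule integral_mono_AE)
    show "integrable D (\<lambda>x. \<bar>H (fst x) - H (snd x)\<bar>)"
    proof (rule D.integrable_const_bound[of _ 1])
      have "\<bar>H a - H b\<bar> \<le> 1" for a b using Hb[of a] Hb[of b] by (auto simp: abs_le_iff)
      then show "AE x in D. norm \<bar>H (fst x) - H (snd x)\<bar> \<le> 1" by simp
    qed measurable
    show "integrable D (\<lambda>x. vn (T x) * (if dn (T x) \<le> \<epsilon> then 1 else 0) + q x / \<epsilon>)" using i1 iq by simp
    have "AE x in D. \<kappa> (fst x) = \<kappa> (snd x)" unfolding D_def by (rule AE_cell_coupling[OF \<kappa>])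
    then show "AE x in D. \<bar>H (fst x) - H (snd x)\<bar> \<le> vn (T x) * (if dn (T x) \<le> \<epsilon> then 1 else 0) + q x / \<epsilon>"
      using AE_space
    proof eventually_elim
      case (elim x)
      then have x: "fst x \<in> space M" "snd x \<in> space M" by (auto simp: spD)
      have "dn (T x) \<le> (\<Sum>l<d. \<bar>yv (fst x) l - yv (snd x) l\<bar>)" unfolding dn_def T_def by (simp add: vnorm_le_sum_abs)
      also have "\<dots> \<le> q x" unfolding q_def
      proof (rule sum_mono)
        fix l assume "l \<in> {..<d}"
        then have "\<bar>W l (fst x) - W l (snd x)\<bar> \<le> \<delta>" using cell[OF x elim(1)] by (simp add: d_def)
        then show "\<bar>yv (fst x) l - yv (snd x) l\<bar> \<le> \<bar>Y l (fst x) - W l (fst x)\<bar> + \<bar>Y l (snd x) - W l (snd x)\<bar> + \<delta>"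
          using \<open>l \<in> {..<d}\<close> unfolding yv_def by simp
      qed
      finally have dq: "dn (T x) \<le> q x" .
      have "\<bar>H (fst x) - H (snd x)\<bar> = \<bar>h_op m (yv (fst x)) i - h_op m (yv (snd x)) i\<bar>" by (simp add: H_def Hyv)
      also have "\<dots> \<le> vn (T x)" unfolding vn_def T_def using abs_le_vnorm[OF i] by simp
      finally have Hv: "\<bar>H (fst x) - H (snd x)\<bar> \<le> vn (T x)" .
      show ?case
      proof (cases "dn (T x) \<le> \<epsilon>")
        case True
        have "q x / \<epsilon> \<ge> 0" using dq vn0(2)[of "T x"] eps by simp
        then show ?thesis using True Hv by simp
      next
        case False
        then have "1 \<le> q x / \<epsilon>" using dq eps by (simp add: pos_le_divide_eq)
        moreover have "\<bar>H (fst x) - H (snd x)\<bar> \<le> 1" using Hb[of "fst x"] Hb[of "snd x"] by (auto simp: abs_le_iff)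
        ultimately show ?thesis using False by simp
      qed
    qed
  qed
  also have "\<dots> = (\<integral>x. vn (T x) * (if dn (T x) \<le> \<epsilon> then 1 else 0) \<partial>D) + (\<integral>x. q x \<partial>D) / \<epsilon>"
    using i1 iq by simp
  also have "\<dots> \<le> \<phi> \<epsilon> + (2 * (\<Sum>l<d. e l) + real d * \<delta>) / \<epsilon>"
    using main Eq eps by (intro add_mono divide_right_mono) auto
  finally show ?thesis unfolding H_def[abs_def] d_def .
qed

section \<open>The multivariate central limit theorem\<close>

locale vector_mixing_functional = beta_mixing_rate M N Z C
  for M :: "'a measure" and N :: "'b measure" and Z C +
  fixes H :: "'k::finite \<Rightarrow> int \<Rightarrow> 'a \<Rightarrow> real" and V D and \<mu> :: "'k \<Rightarrow> real" and q :: "'k \<Rightarrow> 'k \<Rightarrow> nat \<Rightarrow> real"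
  assumes H_approx: "\<And>\<kappa>. approximable (H \<kappa>) (V \<kappa>) 1 D"
    and H_mean: "\<And>\<kappa> t. (\<integral>\<omega>. H \<kappa> t \<omega> \<partial>M) = \<mu> \<kappa>"
    and H_second: "\<And>\<kappa> \<iota> s k. (\<integral>\<omega>. H \<kappa> s \<omega> * H \<iota> (s + int k) \<omega> \<partial>M) = q \<kappa> \<iota> k"
    and H_shift: "\<And>\<tau> n s. (\<integral>\<omega>. cis (\<Sum>t<n. \<Sum>\<kappa>\<in>UNIV. \<tau> \<kappa> * (H \<kappa> (s + int t) \<omega> - \<mu> \<kappa>)) \<partial>M)
      = (\<integral>\<omega>. cis (\<Sum>t<n. \<Sum>\<kappa>\<in>UNIV. \<tau> \<kappa> * (H \<kappa> (int t) \<omega> - \<mu> \<kappa>)) \<partial>M)"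
begin

lemma H_measurable [measurable]: "H \<kappa> t \<in> borel_measurable M"
  and H_bound: "\<omega> \<in> space M \<Longrightarrow> \<bar>H \<kappa> t \<omega>\<bar> \<le> 1"
  and VH_gen_sigma: "V \<kappa> l t \<in> borel_measurable (gen_sigma M N Z {t - int l..t + int l})"
  and VH_bound: "\<omega> \<in> space M \<Longrightarrow> \<bar>V \<kappa> l t \<omega>\<bar> \<le> 1"
  and VH_error: "(\<integral>\<omega>. \<bar>H \<kappa> t \<omega> - V \<kappa> l t \<omega>\<bar> \<partial>M) \<le> D / (real l + 1) ^ 3"
  using H_approx by (auto simp: approximable_def)

lemma VH_measurable [measurable]: "V \<kappa> l t \<in> borel_measurable M"
  using VH_gen_sigma by (rule measurable_gen_sigma_M)

lemma H_integrable [simp]: "integrable M (H \<kappa> t)" "integrable M (V \<kappa> l t)" "integrable M (\<lambda>\<omega>. H \<kappa> s \<omega> * H \<iota> t \<omega>)"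
proof -
  show "integrable M (H \<kappa> t)" "integrable M (V \<kappa> l t)"
    by (rule integrable_bounded[of _ 1]; use H_bound VH_bound in simp)+
  show "integrable M (\<lambda>\<omega>. H \<kappa> s \<omega> * H \<iota> t \<omega>)"
    by (rule integrable_bounded[of _ 1]) (use H_bound in \<open>auto simp: abs_mult intro!: mult_le_one\<close>)
qed

lemma mean_bound: "\<bar>\<mu> \<kappa>\<bar> \<le> 1"
proof -
  have "\<bar>\<integral>\<omega>. H \<kappa> 0 \<omega> \<partial>M\<bar> \<le> (\<integral>\<omega>. \<bar>H \<kappa> 0 \<omega>\<bar> \<partial>M)" by (rule integral_abs_bound)
  also have "\<dots> \<le> (\<integral>\<omega>. 1 \<partial>M)" using H_bound by (intro integral_mono) auto
  finally show ?thesis by (simp add: H_mean prob_space)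
qed

definition d :: "'k \<Rightarrow> 'k \<Rightarrow> nat \<Rightarrow> real" where "d \<kappa> \<iota> k = q \<kappa> \<iota> k - \<mu> \<kappa> * \<mu> \<iota>"

lemma summable_cross_covariance: "summable (\<lambda>k. \<bar>d \<kappa> \<iota> k\<bar>)"
  by (rule summable_comparison_test'[OF summable_inverse_cube])
     (use covariance_decay[OF H_approx[of \<kappa>] H_approx[of \<iota>] order_refl] in \<open>auto simp: d_def H_second H_mean\<close>)

lemma summable_d: "summable (d \<kappa> \<iota>)" "summable (\<lambda>k. d \<kappa> \<iota> (Suc k))"
proof -
  show "summable (d \<kappa> \<iota>)" using summable_cross_covariance by (rule summable_rabs_cancel)
  then show "summable (\<lambda>k. d \<kappa> \<iota> (Suc k))" by (simp add: summable_Suc_iff)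
qed

definition U :: "('k \<Rightarrow> real) \<Rightarrow> int \<Rightarrow> 'a \<Rightarrow> real" where
  "U \<tau> t \<omega> = (\<Sum>\<kappa>\<in>UNIV. \<tau> \<kappa> * (H \<kappa> t \<omega> - \<mu> \<kappa>))"

definition UV :: "('k \<Rightarrow> real) \<Rightarrow> nat \<Rightarrow> int \<Rightarrow> 'a \<Rightarrow> real" where
  "UV \<tau> l t \<omega> = (\<Sum>\<kappa>\<in>UNIV. \<tau> \<kappa> * (V \<kappa> l t \<omega> - \<mu> \<kappa>))"

definition \<gamma> :: "('k \<Rightarrow> real) \<Rightarrow> nat \<Rightarrow> real" where
  "\<gamma> \<tau> k = (\<Sum>\<kappa>\<in>UNIV. \<Sum>\<iota>\<in>UNIV. \<tau> \<kappa> * \<tau> \<iota> * d \<kappa> \<iota> k)"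

text \<open>The cross-covariance summed over all integer lags: lag -k of the pair
  (\<open>\<kappa>\<close>, \<open>\<iota>\<close>) is lag k of the reversed pair.\<close>

definition S :: "'k \<Rightarrow> 'k \<Rightarrow> real" where
  "S \<kappa> \<iota> = d \<kappa> \<iota> 0 + (\<Sum>k. d \<kappa> \<iota> (Suc k) + d \<iota> \<kappa> (Suc k))"

text \<open>Each coordinate differs from its mean by at most 2. The additional 1 keeps the bound
  positive for zero coefficients, as \<open>approximable\<close> demands.\<close>

lemma U_approximable:
  "approximable (U \<tau>) (UV \<tau>) (2 * (\<Sum>\<kappa>\<in>UNIV. \<bar>\<tau> \<kappa>\<bar>) + 1) ((\<Sum>\<kappa>\<in>UNIV. \<bar>\<tau> \<kappa>\<bar>) * D)"
proof -
  define T where "T = (\<Sum>\<kappa>\<in>UNIV. \<bar>\<tau> \<kappa>\<bar>)"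
  have "T \<ge> 0" by (simp add: T_def sum_nonneg)
  have bd: "\<bar>\<Sum>\<kappa>\<in>UNIV. \<tau> \<kappa> * (x \<kappa> - \<mu> \<kappa>)\<bar> \<le> 2 * T + 1" if "\<And>\<kappa>. \<bar>x \<kappa>\<bar> \<le> 1" for x
  proof -
    have "\<bar>\<Sum>\<kappa>\<in>UNIV. \<tau> \<kappa> * (x \<kappa> - \<mu> \<kappa>)\<bar> \<le> (\<Sum>\<kappa>\<in>UNIV. \<bar>\<tau> \<kappa> * (x \<kappa> - \<mu> \<kappa>)\<bar>)" by (rule sum_abs)
    also have "\<dots> \<le> (\<Sum>\<kappa>\<in>UNIV. \<bar>\<tau> \<kappa>\<bar> * 2)"
    proof (rule sum_mono)
      fix \<kappa> have "\<bar>x \<kappa> - \<mu> \<kappa>\<bar> \<le> 2" using that[of \<kappa>] mean_bound[of \<kappa>] by linarith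
      then show "\<bar>\<tau> \<kappa> * (x \<kappa> - \<mu> \<kappa>)\<bar> \<le> \<bar>\<tau> \<kappa>\<bar> * 2" by (simp add: abs_mult mult_left_mono)
    qed
    finally show ?thesis by (simp add: T_def sum_distrib_right[symmetric])
  qed
  have "(\<integral>\<omega>. \<bar>U \<tau> t \<omega> - UV \<tau> l t \<omega>\<bar> \<partial>M) \<le> T * D / (real l + 1) ^ 3" for l t
  proof -
    have "(\<integral>\<omega>. \<bar>U \<tau> t \<omega> - UV \<tau> l t \<omega>\<bar> \<partial>M) \<le> (\<integral>\<omega>. (\<Sum>\<kappa>\<in>UNIV. \<bar>\<tau> \<kappa>\<bar> * \<bar>H \<kappa> t \<omega> - V \<kappa> l t \<omega>\<bar>) \<partial>M)"
    proof (rule integral_mono)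
      fix \<omega>
      have "U \<tau> t \<omega> - UV \<tau> l t \<omega> = (\<Sum>\<kappa>\<in>UNIV. \<tau> \<kappa> * (H \<kappa> t \<omega> - V \<kappa> l t \<omega>))"
        by (simp add: U_def UV_def algebra_simps sum_subtractf)
      then show "\<bar>U \<tau> t \<omega> - UV \<tau> l t \<omega>\<bar> \<le> (\<Sum>\<kappa>\<in>UNIV. \<bar>\<tau> \<kappa>\<bar> * \<bar>H \<kappa> t \<omega> - V \<kappa> l t \<omega>\<bar>)"
        using sum_abs[of "\<lambda>\<kappa>. \<tau> \<kappa> * (H \<kappa> t \<omega> - V \<kappa> l t \<omega>)" UNIV] by (simp add: abs_mult)
    qed (auto simp: U_def UV_def)
    also have "\<dots> = (\<Sum>\<kappa>\<in>UNIV. \<bar>\<tau> \<kappa>\<bar> * (\<integral>\<omega>. \<bar>H \<kappa> t \<omega> - V \<kappa> l t \<omega>\<bar> \<partial>M))"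
      by (simp add: Bochner_Integration.integral_sum)
    also have "\<dots> \<le> (\<Sum>\<kappa>\<in>UNIV. \<bar>\<tau> \<kappa>\<bar> * (D / (real l + 1) ^ 3))"
      by (intro sum_mono mult_left_mono VH_error) auto
    finally show ?thesis by (simp add: T_def sum_distrib_right sum_divide_distrib)
  qed
  then show ?thesis
    unfolding approximable_def T_def[symmetric] using \<open>T \<ge> 0\<close> VH_gen_sigma H_bound VH_bound
    by (auto simp: U_def[abs_def] UV_def[abs_def] intro!: bd borel_measurable_sum borel_measurable_times borel_measurable_diff)
qed

lemma U_functional:
  "stationary_mixing_functional M N Z C (U \<tau>) (UV \<tau>) (2 * (\<Sum>\<kappa>\<in>UNIV. \<bar>\<tau> \<kappa>\<bar>) + 1) ((\<Sum>\<kappa>\<in>UNIV. \<bar>\<tau> \<kappa>\<bar>) * D) (\<gamma> \<tau>)"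
proof unfold_locales
  show "approximable (U \<tau>) (UV \<tau>) (2 * (\<Sum>\<kappa>\<in>UNIV. \<bar>\<tau> \<kappa>\<bar>) + 1) ((\<Sum>\<kappa>\<in>UNIV. \<bar>\<tau> \<kappa>\<bar>) * D)"
    by (rule U_approximable)
  show "(\<integral>\<omega>. U \<tau> t \<omega> \<partial>M) = 0" for t
    by (simp add: U_def Bochner_Integration.integral_sum H_mean prob_space)
  show "(\<integral>\<omega>. U \<tau> s \<omega> * U \<tau> (s + int k) \<omega> \<partial>M) = \<gamma> \<tau> k" for s k
  proof -
    have "(\<integral>\<omega>. (H \<kappa> s \<omega> - \<mu> \<kappa>) * (H \<iota> (s + int k) \<omega> - \<mu> \<iota>) \<partial>M) = d \<kappa> \<iota> k" for \<kappa> \<iota>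
    proof -
      have "(\<integral>\<omega>. (H \<kappa> s \<omega> - \<mu> \<kappa>) * (H \<iota> (s + int k) \<omega> - \<mu> \<iota>) \<partial>M) =
        (\<integral>\<omega>. H \<kappa> s \<omega> * H \<iota> (s + int k) \<omega> - \<mu> \<iota> * H \<kappa> s \<omega> - \<mu> \<kappa> * H \<iota> (s + int k) \<omega> + \<mu> \<kappa> * \<mu> \<iota> \<partial>M)"
        by (intro Bochner_Integration.integral_cong) (auto simp: algebra_simps)
      also have "\<dots> = d \<kappa> \<iota> k"
        by (simp add: H_mean H_second prob_space d_def)
      finally show ?thesis .
    qed
    moreover have "integrable M (\<lambda>\<omega>. (H \<kappa> s \<omega> - \<mu> \<kappa>) * (H \<iota> (s + int k) \<omega> - \<mu> \<iota>))" for \<kappa> \<iota>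
      by (simp add: left_diff_distrib right_diff_distrib)
    moreover have "U \<tau> s \<omega> * U \<tau> (s + int k) \<omega> = (\<Sum>\<kappa>\<in>UNIV. \<Sum>\<iota>\<in>UNIV. \<tau> \<kappa> * \<tau> \<iota> * ((H \<kappa> s \<omega> - \<mu> \<kappa>) * (H \<iota> (s + int k) \<omega> - \<mu> \<iota>)))" for \<omega>
      by (simp add: U_def sum_product mult_ac)
    ultimately show ?thesis by (simp add: \<gamma>_def Bochner_Integration.integral_sum)
  qed
  show "(\<integral>\<omega>. cis (c * (\<Sum>t<n. U \<tau> (s + int t) \<omega>)) \<partial>M) = (\<integral>\<omega>. cis (c * (\<Sum>t<n. U \<tau> (int t) \<omega>)) \<partial>M)" for c n s
    using H_shift[where \<tau> = "\<lambda>\<kappa>. c * \<tau> \<kappa>" and n = n and s = s]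
    by (simp add: U_def sum_distrib_left mult.assoc)
qed

lemma sig2_eq_quad_form: "2 * (\<Sum>k. \<gamma> \<tau> k) - \<gamma> \<tau> 0 = quad_form S \<tau>"
proof -
  define E where "E \<kappa> \<iota> = (\<Sum>k. d \<kappa> \<iota> (Suc k))" for \<kappa> \<iota>
  have s: "summable (\<lambda>k. \<tau> \<kappa> * \<tau> \<iota> * d \<kappa> \<iota> (Suc k))" for \<kappa> \<iota>
    using summable_d by (intro summable_mult)
  have "summable (\<gamma> \<tau>)"
    unfolding \<gamma>_def by (intro summable_sum summable_mult summable_d)
  then have "2 * (\<Sum>k. \<gamma> \<tau> k) - \<gamma> \<tau> 0 = \<gamma> \<tau> 0 + 2 * (\<Sum>k. \<gamma> \<tau> (Suc k))"
    using suminf_split_head[of "\<gamma> \<tau>"] by simp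
  also have "(\<Sum>k. \<gamma> \<tau> (Suc k)) = (\<Sum>\<kappa>\<in>UNIV. \<Sum>\<iota>\<in>UNIV. \<tau> \<kappa> * \<tau> \<iota> * E \<kappa> \<iota>)"
    unfolding \<gamma>_def E_def using s summable_d by (simp add: suminf_sum summable_sum suminf_mult)
  \<comment> \<open>Exchanging the names of the two indices in one copy of the double sum yields the
    transposed matrix and thereby the symmetric \<open>S\<close>.\<close>
  also have "2 * \<dots> = (\<Sum>\<kappa>\<in>UNIV. \<Sum>\<iota>\<in>UNIV. \<tau> \<kappa> * \<tau> \<iota> * E \<kappa> \<iota>) + (\<Sum>\<kappa>\<in>UNIV. \<Sum>\<iota>\<in>UNIV. \<tau> \<kappa> * \<tau> \<iota> * E \<iota> \<kappa>)"
    by (subst (3) sum.swap) (simp add: mult_ac)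
  also have "\<gamma> \<tau> 0 + \<dots> = (\<Sum>\<kappa>\<in>UNIV. \<Sum>\<iota>\<in>UNIV. \<tau> \<kappa> * \<tau> \<iota> * (d \<kappa> \<iota> 0 + (E \<kappa> \<iota> + E \<iota> \<kappa>)))"
    by (simp add: \<gamma>_def sum.distrib distrib_left)
  also have "\<dots> = quad_form S \<tau>"
    unfolding quad_form_def S_def E_def using summable_d by (simp add: suminf_add)
  finally show ?thesis .
qed

lemma S_sym: "S \<kappa> \<iota> = S \<iota> \<kappa>"
proof -
  have "d \<kappa> \<iota> 0 = d \<iota> \<kappa> 0"
    using H_second[of \<kappa> 0 \<iota> 0] H_second[of \<iota> 0 \<kappa> 0] by (simp add: d_def mult.commute)
  then show ?thesis by (simp add: S_def add.commute)
qed

text \<open>The form at \<open>\<tau>\<close> is the long-run variance of the linear combination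
  \<open>U \<tau>\<close>, a limit of normalized second moments.\<close>

lemma S_psd: "quad_form S \<tau> \<ge> 0"
proof -
  interpret F: stationary_mixing_functional M N Z C "U \<tau>" "UV \<tau>" "2 * (\<Sum>\<kappa>\<in>UNIV. \<bar>\<tau> \<kappa>\<bar>) + 1" "(\<Sum>\<kappa>\<in>UNIV. \<bar>\<tau> \<kappa>\<bar>) * D" "\<gamma> \<tau>"
    by (rule U_functional)
  show ?thesis using F.sig2_nonneg unfolding F.sig2_def sig2_eq_quad_form .
qed

text \<open>Time starts at 1 as in the empirical frequencies; characteristic functions are moved to
  start 0 by \<open>char_shift\<close>.\<close>

definition Y :: "nat \<Rightarrow> 'a \<Rightarrow> real ^ 'k" where
  "Y n \<omega> = (\<chi> \<kappa>. 1 / sqrt (real n) * (\<Sum>t<n. H \<kappa> (1 + int t) \<omega> - \<mu> \<kappa>))"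

lemma Y_measurable [measurable]: "Y n \<in> borel_measurable M"
proof -
  have "(\<lambda>\<omega>. Y n \<omega> \<bullet> axis \<kappa> 1) \<in> borel_measurable M" for \<kappa>
    unfolding Y_def by (simp add: inner_axis)
  then show ?thesis by (subst borel_measurable_euclidean_space) (auto simp: Basis_vec_def)
qed

lemma inner_Y: "(\<chi> \<kappa>. \<tau> \<kappa>) \<bullet> Y n \<omega> = 1 / sqrt (real n) * (\<Sum>t<n. U \<tau> (1 + int t) \<omega>)"
proof -
  have "(\<chi> \<kappa>. \<tau> \<kappa>) \<bullet> Y n \<omega> = 1 / sqrt (real n) * (\<Sum>\<kappa>\<in>UNIV. \<Sum>t<n. \<tau> \<kappa> * (H \<kappa> (1 + int t) \<omega> - \<mu> \<kappa>))"
    by (simp add: inner_vec_def Y_def sum_distrib_left sum_divide_distrib)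
  also have "\<dots> = 1 / sqrt (real n) * (\<Sum>t<n. U \<tau> (1 + int t) \<omega>)"
    unfolding U_def by (subst sum.swap) (rule refl)
  finally show ?thesis .
qed

lemma Y_second_moment: "\<exists>B. \<forall>n. (\<integral>\<omega>. (norm (Y n \<omega>))\<^sup>2 \<partial>M) \<le> B"
proof -
  \<comment> \<open>Each coordinate of \<open>Y\<close> is the normalized sum for a unit coefficient
    vector, so the scalar second moment bound applies to it.\<close>
  define u where "u \<kappa> = (\<lambda>\<iota>. of_bool (\<iota> = \<kappa>) :: real)" for \<kappa> :: 'k
  have comp: "Y n \<omega> $ \<kappa> = 1 / sqrt (real n) * (\<Sum>t<n. U (u \<kappa>) (1 + int t) \<omega>)" for n \<omega> \<kappa>
  proof -
    have "(\<chi> \<iota>. u \<kappa> \<iota>) = axis \<kappa> (1::real)" by (auto simp: u_def axis_def vec_eq_iff)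
    then have "(\<chi> \<iota>. u \<kappa> \<iota>) \<bullet> Y n \<omega> = Y n \<omega> $ \<kappa>" by (simp add: inner_axis')
    then show ?thesis using inner_Y[of "u \<kappa>"] by simp
  qed
  have "\<exists>B. \<forall>n. (\<integral>\<omega>. (Y n \<omega> $ \<kappa>)\<^sup>2 \<partial>M) \<le> B \<and> integrable M (\<lambda>\<omega>. (Y n \<omega> $ \<kappa>)\<^sup>2)" for \<kappa>
  proof -
    interpret F: stationary_mixing_functional M N Z C "U (u \<kappa>)" "UV (u \<kappa>)" "2 * (\<Sum>\<iota>\<in>UNIV. \<bar>u \<kappa> \<iota>\<bar>) + 1" "(\<Sum>\<iota>\<in>UNIV. \<bar>u \<kappa> \<iota>\<bar>) * D" "\<gamma> (u \<kappa>)"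
      by (rule U_functional)
    have "(\<integral>\<omega>. (Y n \<omega> $ \<kappa>)\<^sup>2 \<partial>M) \<le> 2 * F.Gam" for n
    proof -
      have inj: "inj_on (\<lambda>t. 1 + int t) {..<n}" by (auto simp: inj_on_def)
      have "(\<integral>\<omega>. (Y n \<omega> $ \<kappa>)\<^sup>2 \<partial>M) = 1 / real n * (\<integral>\<omega>. (\<Sum>t<n. U (u \<kappa>) (1 + int t) \<omega>)\<^sup>2 \<partial>M)"
        unfolding comp by (simp add: power_divide)
      also have "\<dots> \<le> 1 / real n * (2 * F.Gam * real n)"
        using F.second_moment_le[of "(\<lambda>t. 1 + int t) ` {..<n}"] inj
        by (intro mult_left_mono) (auto simp: sum.reindex card_image)
      also have "\<dots> \<le> 2 * F.Gam" using F.Gam_nonneg by (cases "n = 0") auto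
      finally show ?thesis .
    qed
    moreover have "integrable M (\<lambda>\<omega>. (Y n \<omega> $ \<kappa>)\<^sup>2)" for n
      unfolding comp by (simp add: power2_eq_square sum_product)
    ultimately show ?thesis by blast
  qed
  then obtain B where B: "\<And>\<kappa> n. (\<integral>\<omega>. (Y n \<omega> $ \<kappa>)\<^sup>2 \<partial>M) \<le> B \<kappa>" "\<And>\<kappa> n. integrable M (\<lambda>\<omega>. (Y n \<omega> $ \<kappa>)\<^sup>2)" by metis
  have "(\<integral>\<omega>. (norm (Y n \<omega>))\<^sup>2 \<partial>M) \<le> (\<Sum>\<kappa>\<in>UNIV. B \<kappa>)" for n
  proof -
    have "(\<integral>\<omega>. (norm (Y n \<omega>))\<^sup>2 \<partial>M) = (\<Sum>\<kappa>\<in>UNIV. \<integral>\<omega>. (Y n \<omega> $ \<kappa>)\<^sup>2 \<partial>M)"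
      using B(2) by (simp add: norm_vec_def L2_set_def sum_nonneg Bochner_Integration.integral_sum)
    then show ?thesis using B(1) by (simp add: sum_mono)
  qed
  then show ?thesis by blast
qed

text \<open>This bound depends on \<open>n\<close> and only serves integrability; the bound uniform
  in \<open>n\<close> is \<open>Y_second_moment\<close>.\<close>

lemma Y_norm_bound: "\<exists>B. \<forall>\<omega>\<in>space M. norm (Y n \<omega>) \<le> B"
proof -
  have "\<bar>Y n \<omega> $ \<kappa>\<bar> \<le> 1 / sqrt (real n) * (real n * 2)" if "\<omega> \<in> space M" for \<omega> \<kappa>
  proof -
    have "\<bar>\<Sum>t<n. H \<kappa> (1 + int t) \<omega> - \<mu> \<kappa>\<bar> \<le> (\<Sum>t<n. \<bar>H \<kappa> (1 + int t) \<omega> - \<mu> \<kappa>\<bar>)" by (rule sum_abs)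
    also have "\<dots> \<le> (\<Sum>t<n. 2)"
    proof (rule sum_mono)
      fix t show "\<bar>H \<kappa> (1 + int t) \<omega> - \<mu> \<kappa>\<bar> \<le> 2"
        using H_bound[OF that, of \<kappa> "1 + int t"] mean_bound[of \<kappa>] by linarith
    qed
    finally show ?thesis unfolding Y_def by (simp add: abs_mult divide_right_mono)
  qed
  then have "norm (Y n \<omega>) \<le> (\<Sum>\<kappa>\<in>(UNIV::'k set). 1 / sqrt (real n) * (real n * 2))" if "\<omega> \<in> space M" for \<omega>
    using that by (intro order_trans[OF norm_le_l1_cart] sum_mono) auto
  then show ?thesis by blast
qed

theorem vector_clt: "converges_in_distr_normal M Y S"
proof -
  obtain G :: "(real ^ 'k) measure" where G: "gaussian_measure G S"
    using gaussian_measure_exists[OF S_sym S_psd] by blast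
  then have Gp: "prob_space G" "sets G = sets borel"
    and Gc: "\<And>t. (\<integral>x. cis (t \<bullet> x) \<partial>G) = complex_of_real (exp (- quad_form S (\<lambda>\<kappa>. t $ \<kappa>) / 2))"
    by (auto simp: gaussian_measure_def quad_form_def)
  have "(\<lambda>n. \<integral>\<omega>. g (Y n \<omega>) \<partial>M) \<longlonglongrightarrow> (\<integral>x. g x \<partial>G)" if g: "continuous_on UNIV g" "bounded (range g)" for g :: "real ^ 'k \<Rightarrow> real"
  proof (rule weak_convergence_of_characteristic_functions[OF prob_space_axioms Gp Y_measurable _ _ g])
    fix t :: "real ^ 'k"
    define \<tau> where "\<tau> \<kappa> = t $ \<kappa>" for \<kappa>
    have t: "t = (\<chi> \<kappa>. \<tau> \<kappa>)" by (simp add: \<tau>_def vec_eq_iff)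
    interpret F: stationary_mixing_functional M N Z C "U \<tau>" "UV \<tau>" "2 * (\<Sum>\<kappa>\<in>UNIV. \<bar>\<tau> \<kappa>\<bar>) + 1" "(\<Sum>\<kappa>\<in>UNIV. \<bar>\<tau> \<kappa>\<bar>) * D" "\<gamma> \<tau>"
      by (rule U_functional)
    have "(\<integral>\<omega>. cis (t \<bullet> Y n \<omega>) \<partial>M) = (\<integral>\<omega>. cis (1 / sqrt (real n) * (\<Sum>t<n. U \<tau> (int t) \<omega>)) \<partial>M)" for n
      unfolding t inner_Y by (rule F.char_shift)
    moreover have "(\<integral>x. cis (t \<bullet> x) \<partial>G) = complex_of_real (exp (- (1\<^sup>2 * F.sig2 / 2)))"
      unfolding Gc F.sig2_def sig2_eq_quad_form by (simp add: \<tau>_def[abs_def])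
    ultimately show "(\<lambda>n. \<integral>\<omega>. cis (t \<bullet> Y n \<omega>) \<partial>M) \<longlonglongrightarrow> (\<integral>x. cis (t \<bullet> x) \<partial>G)"
      using F.characteristic_function_tendsto[of 1] by simp
  next
    fix e :: real assume "e > 0"
    obtain B where B: "\<And>n. (\<integral>\<omega>. (norm (Y n \<omega>))\<^sup>2 \<partial>M) \<le> B" using Y_second_moment by blast
    have "0 \<le> (\<integral>\<omega>. (norm (Y 0 \<omega>))\<^sup>2 \<partial>M)" by simp
    then have "B \<ge> 0" using B[of 0] by linarith
    \<comment> \<open>Chebyshev's inequality gives the tail bound B / R^2; the additional 1 makes
      \<open>R\<close> positive also when \<open>B\<close> is 0.\<close>
    define R where "R = sqrt (B / e) + 1"
    have "R > 0" unfolding R_def using \<open>B \<ge> 0\<close> \<open>e > 0\<close> by (intro add_nonneg_pos) auto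
    have "(sqrt (B / e))\<^sup>2 \<le> R\<^sup>2" unfolding R_def using \<open>B \<ge> 0\<close> \<open>e > 0\<close> by (intro power_mono) auto
    then have "B / e \<le> R\<^sup>2" using \<open>B \<ge> 0\<close> \<open>e > 0\<close> by simp
    then have BR: "B \<le> e * R\<^sup>2" using \<open>e > 0\<close> by (simp add: pos_divide_le_eq mult.commute)
    have "measure M {\<omega> \<in> space M. norm (Y n \<omega>) > R} \<le> e" for n
    proof -
      obtain K where K: "\<And>\<omega>. \<omega> \<in> space M \<Longrightarrow> norm (Y n \<omega>) \<le> K" using Y_norm_bound by blast
      have i: "integrable M (\<lambda>\<omega>. (norm (Y n \<omega>))\<^sup>2)"
        by (rule integrable_bounded[of _ "K\<^sup>2"]) (use K in \<open>auto intro!: power_mono\<close>)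
      have "R\<^sup>2 * measure M {\<omega> \<in> space M. norm (Y n \<omega>) > R} = (\<integral>\<omega>. R\<^sup>2 * indicator {\<omega> \<in> space M. norm (Y n \<omega>) > R} \<omega> \<partial>M)"
        by simp
      also have "\<dots> \<le> (\<integral>\<omega>. (norm (Y n \<omega>))\<^sup>2 \<partial>M)"
      proof (rule integral_mono)
        show "integrable M (\<lambda>\<omega>. R\<^sup>2 * indicator {\<omega> \<in> space M. norm (Y n \<omega>) > R} \<omega>)"
          by (rule integrable_bounded[of _ "R\<^sup>2"]) (auto simp: indicator_def)
        show "R\<^sup>2 * indicator {\<omega> \<in> space M. norm (Y n \<omega>) > R} \<omega> \<le> (norm (Y n \<omega>))\<^sup>2" for \<omega>
          using \<open>R > 0\<close> by (auto simp: indicator_def intro!: power_mono)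
      qed (rule i)
      also have "\<dots> \<le> R\<^sup>2 * e" using B[of n] BR by (simp add: mult.commute)
      finally show ?thesis using \<open>R > 0\<close> by simp
    qed
    then show "\<exists>R. \<forall>n. measure M {\<omega> \<in> space M. norm (Y n \<omega>) > R} \<le> e" by blast
  qed
  with G show ?thesis unfolding converges_in_distr_normal_def by blast
qed

end

section \<open>Approximation of the kernel\<close>

text \<open>A window of a small radius is also a window of any larger radius, so only the running minimum
  of the errors matters; summability against \<open>k\<^sup>2\<close> makes it cubic.\<close>
lemma running_min_cubic_rate:
  fixes b :: "nat \<Rightarrow> real"
  assumes b: "\<And>k. b k \<ge> 0" and "summable (\<lambda>k. real k ^ 2 * b k)"
  shows "\<exists>C. \<forall>l. \<exists>k\<le>l. b k \<le> C / (real l + 1) ^ 3"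
proof -
  define s where "s = (\<Sum>k. real k ^ 2 * b k)"
  \<comment> \<open>For l >= 1 one has (l + 1)^3 <= 8 l^3 <= 24 (1^2 + ... + l^2), which produces
    24. The term \<open>b 0\<close> covers l = 0, and 1 makes the contradiction strict.\<close>
  define C where "C = 24 * s + b 0 + 1"
  have "s \<ge> 0" unfolding s_def using assms by (intro suminf_nonneg) auto
  have "\<exists>k\<le>l. b k \<le> C / (real l + 1) ^ 3" for l :: nat
  proof (cases "l = 0")
    case True
    then show ?thesis using \<open>s \<ge> 0\<close> by (auto simp: C_def)
  next
    case False
    show ?thesis
    proof (rule ccontr)
      define c where "c = C / (real l + 1) ^ 3"
      assume "\<not> (\<exists>k\<le>l. b k \<le> C / (real l + 1) ^ 3)"
      then have big: "c \<le> b k" if "k \<le> l" for k using that unfolding c_def by force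
      have "c \<ge> 0" unfolding c_def using \<open>s \<ge> 0\<close> b[of 0] by (simp add: C_def)
      have cube: "real n ^ 3 \<le> 3 * (\<Sum>k\<le>n. real k ^ 2)" for n
        by (induction n) (auto simp: power2_eq_square power3_eq_cube algebra_simps)
      have "real l + 1 \<le> 2 * real l" using False by simp
      then have "(real l + 1) ^ 3 \<le> (2 * real l) ^ 3" by (intro power_mono) auto
      also have "\<dots> = 8 * real l ^ 3" by (simp add: power_mult_distrib)
      also have "\<dots> \<le> 24 * (\<Sum>k\<le>l. real k ^ 2)" using cube[of l] by simp
      finally have "(real l + 1) ^ 3 * c \<le> 24 * (\<Sum>k\<le>l. real k ^ 2) * c" using \<open>c \<ge> 0\<close> by (rule mult_right_mono)
      also have "\<dots> = 24 * (\<Sum>k\<le>l. real k ^ 2 * c)" by (simp add: sum_distrib_right)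
      also have "\<dots> \<le> 24 * (\<Sum>k\<le>l. real k ^ 2 * b k)"
        using big by (intro mult_left_mono sum_mono) auto
      also have "(\<Sum>k\<le>l. real k ^ 2 * b k) \<le> s"
        unfolding s_def using assms by (intro sum_le_suminf) auto
      finally have "C \<le> 24 * s" by (simp add: c_def)
      then show False using b[of 0] by (simp add: C_def)
    qed
  qed
  then show ?thesis by blast
qed

lemma stationary_process_integrable_shift:
  fixes F :: "(int \<Rightarrow> 'b) \<Rightarrow> 'c::{banach, second_countable_topology}"
  assumes "stationary_process M N Z" and Z: "\<And>t. Z t \<in> measurable M N" and "prob_space M"
    and F: "F \<in> borel_measurable (PiM UNIV (\<lambda>_. N))"
    and int: "integrable M (\<lambda>\<omega>. F (\<lambda>i. Z i \<omega>))"
  shows "integrable M (\<lambda>\<omega>. F (\<lambda>i. Z (s + i) \<omega>))"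
proof -
  have paths: "(\<lambda>\<omega> i. Z (r + i) \<omega>) \<in> measurable M (PiM UNIV (\<lambda>_. N))" for r
    using measurable_restrict[of UNIV "\<lambda>i. Z (r + i)" M "\<lambda>_. N", OF Z] by (simp add: restrict_def)
  show ?thesis
    using stationary_process_shift[OF assms(1-3), of s] integrable_distr_eq[OF paths F, of s]
      integrable_distr_eq[OF paths[of 0] F] int by simp
qed

text \<open>The hypothesis concerns time 0 only. There the conditional expectation is a function
  \<open>v k\<close> of the window path; applied to the window around \<open>t\<close>, the same
  function has the same error because the path law is shift invariant.\<close>

lemma one_approx_window:
  assumes M: "prob_space M" and oa: "one_approx_functional M N Z \<Delta> a"
  shows "\<exists>v. \<forall>k. v k \<in> borel_measurable (PiM {- int k..int k} (\<lambda>_. N)) \<and>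
    (\<forall>t. integrable M (\<lambda>\<omega>. \<Delta> t \<omega> - v k (\<lambda>i\<in>{- int k..int k}. Z (t + i) \<omega>)) \<and>
      (\<integral>\<omega>. \<bar>\<Delta> t \<omega> - v k (\<lambda>i\<in>{- int k..int k}. Z (t + i) \<omega>)\<bar> \<partial>M) \<le> a k)"
proof -
  interpret prob_space M by fact
  have st: "stationary_process M N Z" and Z: "\<And>t. Z t \<in> measurable M N" and int0: "integrable M (\<Delta> 0)"
    and ak: "\<And>k::nat. (\<integral>\<omega>. \<bar>\<Delta> 0 \<omega> - real_cond_exp M (gen_sigma M N Z {- int k..int k}) (\<Delta> 0) \<omega>\<bar> \<partial>M) \<le> a k"
    using oa by (auto simp: one_approx_functional_def functional_of_def)
  obtain f where f: "f \<in> borel_measurable (PiM UNIV (\<lambda>_::int. N))"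
    and \<Delta>f: "\<And>t \<omega>. \<omega> \<in> space M \<Longrightarrow> \<Delta> t \<omega> = f (\<lambda>k. Z (t + k) \<omega>)"
    using oa by (auto simp: one_approx_functional_def functional_of_def)
  have "\<exists>v. v \<in> borel_measurable (PiM {- int k..int k} (\<lambda>_. N)) \<and>
    (\<forall>t. integrable M (\<lambda>\<omega>. \<Delta> t \<omega> - v (\<lambda>i\<in>{- int k..int k}. Z (t + i) \<omega>)) \<and>
      (\<integral>\<omega>. \<bar>\<Delta> t \<omega> - v (\<lambda>i\<in>{- int k..int k}. Z (t + i) \<omega>)\<bar> \<partial>M) \<le> a k)" for k
  proof -
    define I where "I = {- int k..int k}"
    define ce where "ce = real_cond_exp M (gen_sigma M N Z I) (\<Delta> 0)"
    have sub: "subalgebra M (gen_sigma M N Z I)" using Z by (rule subalgebra_gen_sigma)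
    interpret S: finite_measure_subalgebra M "gen_sigma M N Z I"
      using sub by unfold_locales
    have ce_int: "integrable M ce" unfolding ce_def by (rule S.real_cond_exp_int(1)[OF int0])
    have "ce \<in> borel_measurable (gen_sigma M N Z I)" unfolding ce_def by simp
    then obtain v where v: "v \<in> borel_measurable (PiM I (\<lambda>_. N))" "\<And>\<omega>. \<omega> \<in> space M \<Longrightarrow> ce \<omega> = v (\<lambda>i\<in>I. Z i \<omega>)"
      using gen_sigma_factorization[of Z M N ce I, OF Z] by blast
    define F where "F z = f z - v (restrict z I)" for z
    have F: "F \<in> borel_measurable (PiM UNIV (\<lambda>_. N))"
      unfolding F_def using f v(1) by (intro borel_measurable_diff measurable_compose[OF measurable_restrict_subset]) auto
    have F0: "F (\<lambda>i. Z i \<omega>) = \<Delta> 0 \<omega> - ce \<omega>" if "\<omega> \<in> space M" for \<omega>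
      using \<Delta>f[OF that, of 0] v(2)[OF that] by (simp add: F_def)
    have Ft: "F (\<lambda>i. Z (t + i) \<omega>) = \<Delta> t \<omega> - v (\<lambda>i\<in>I. Z (t + i) \<omega>)" if "\<omega> \<in> space M" for t \<omega>
      using \<Delta>f[OF that, of t] by (simp add: F_def)
    have "integrable M (\<lambda>\<omega>. F (\<lambda>i. Z i \<omega>))"
      using int0 ce_int by (simp add: F0 cong: Bochner_Integration.integrable_cong)
    then have "integrable M (\<lambda>\<omega>. F (\<lambda>i. Z (t + i) \<omega>))" for t
      by (rule stationary_process_integrable_shift[OF st Z M F])
    then have 1: "integrable M (\<lambda>\<omega>. \<Delta> t \<omega> - v (\<lambda>i\<in>I. Z (t + i) \<omega>))" for t
      by (simp add: Ft cong: Bochner_Integration.integrable_cong)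
    have aF: "(\<lambda>z. \<bar>F z\<bar>) \<in> borel_measurable (PiM UNIV (\<lambda>_. N))" using F by measurable
    have 2: "(\<integral>\<omega>. \<bar>\<Delta> t \<omega> - v (\<lambda>i\<in>I. Z (t + i) \<omega>)\<bar> \<partial>M) \<le> a k" for t
    proof -
      have "(\<integral>\<omega>. \<bar>\<Delta> t \<omega> - v (\<lambda>i\<in>I. Z (t + i) \<omega>)\<bar> \<partial>M) = (\<integral>\<omega>. \<bar>F (\<lambda>i. Z (t + i) \<omega>)\<bar> \<partial>M)"
        by (simp add: Ft cong: Bochner_Integration.integral_cong)
      also have "\<dots> = (\<integral>\<omega>. \<bar>F (\<lambda>i. Z i \<omega>)\<bar> \<partial>M)"
        by (rule stationary_process_integral_shift[OF st Z M aF])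
      also have "\<dots> = (\<integral>\<omega>. \<bar>\<Delta> 0 \<omega> - ce \<omega>\<bar> \<partial>M)"
        by (simp add: F0 cong: Bochner_Integration.integral_cong)
      also have "\<dots> \<le> a k" using ak[of k] by (simp add: ce_def I_def)
      finally show ?thesis .
    qed
    show ?thesis using v(1) 1 2 unfolding I_def by blast
  qed
  then show ?thesis by (intro choice allI)
qed

text \<open>A grid cell is coded by a list of integers. Lists of integers form a countable type, so
  the list can be extended one coordinate at a time.\<close>

lemma measurable_map_floor:
  fixes x :: "nat \<Rightarrow> 'a \<Rightarrow> real"
  assumes "\<And>l. l < d \<Longrightarrow> x l \<in> borel_measurable M"
  shows "(\<lambda>z. map (\<lambda>l. \<lfloor>x l z\<rfloor>) [0..<d]) \<in> measurable M (count_space UNIV)"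
  using assms
proof (induction d)
  case (Suc d)
  have L: "(\<lambda>z. map (\<lambda>l. \<lfloor>x l z\<rfloor>) [0..<d]) \<in> measurable M (count_space UNIV)" using Suc by simp
  have "(\<lambda>z. \<lfloor>x d z\<rfloor>) \<in> measurable M (count_space UNIV)" using Suc.prems[of d] by simp
  moreover have "(\<lambda>z. map (\<lambda>l. \<lfloor>x l z\<rfloor>) [0..<d] @ [c]) \<in> measurable M (count_space UNIV)" for c
    using measurable_compose[OF L, of "\<lambda>xs. xs @ [c]" "count_space UNIV"] by simp
  ultimately have "(\<lambda>z. map (\<lambda>l. \<lfloor>x l z\<rfloor>) [0..<d] @ [\<lfloor>x d z\<rfloor>]) \<in> measurable M (count_space UNIV)"
    by (rule measurable_compose_countable[rotated])
  then show ?case by simp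
qed simp

text \<open>The grid width is \<open>A\<close> and the closeness threshold 2 sqrt(A). The Markov
  term is then at most (2A + (m-1)A) / (2 sqrt(A)), a multiple of sqrt(A).\<close>

lemma kernel_window_approximation:
  assumes M: "prob_space M" and oa: "one_approx_functional M N Z \<Delta> a"
    and \<Delta>: "\<And>t. \<Delta> t \<in> borel_measurable M"
    and cont: "one_continuous m (distr M (PiM {..<m-1} (\<lambda>_. borel)) (\<lambda>\<omega>. \<lambda>l\<in>{..<m-1}. \<Delta> (1 + int l) \<omega>)) \<phi>"
    and k: "k \<ge> m - 1" and i: "i < fact m"
  defines "A \<equiv> \<Sum>j\<le>m-1. a (k - j)"
  shows "\<exists>g\<in>borel_measurable (PiM {- int k..int k} (\<lambda>_. N)). (\<forall>z. 0 \<le> g z \<and> g z \<le> 1) \<and>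
    (\<integral>\<omega>. \<bar>h_op m (\<lambda>l. \<Delta> (1 + int l) \<omega>) i - g (\<lambda>j\<in>{- int k..int k}. Z j \<omega>)\<bar> \<partial>M)
      \<le> \<phi> (2 * sqrt A) + (real m + 1) * sqrt A"
proof -
  interpret prob_space M by fact
  have Z: "\<And>t. Z t \<in> measurable M N"
    using oa by (auto simp: one_approx_functional_def functional_of_def)
  obtain v where v: "\<And>r. v r \<in> borel_measurable (PiM {- int r..int r} (\<lambda>_. N))"
    and vi: "\<And>r t. integrable M (\<lambda>\<omega>. \<Delta> t \<omega> - v r (\<lambda>i\<in>{- int r..int r}. Z (t + i) \<omega>))"
    and va: "\<And>r t. (\<integral>\<omega>. \<bar>\<Delta> t \<omega> - v r (\<lambda>i\<in>{- int r..int r}. Z (t + i) \<omega>)\<bar> \<partial>M) \<le> a r"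
    using one_approx_window[OF M oa] by blast
  have a0: "a r \<ge> 0" for r
    using va[of 0 r] by (meson Bochner_Integration.integral_nonneg abs_ge_zero order_trans)
  define I where "I = {- int k..int k}"
  \<comment> \<open>The increment with index \<open>l\<close> sits at time 1 + l, so its window must
    be shrunk by 1 + l to stay within radius \<open>k\<close> around 0. The errors are the terms j =
    1, ..., m-1 of \<open>A\<close>.\<close>
  define r where "r l = k - (1 + l)" for l
  define w where "w l z = v (r l) (\<lambda>i\<in>{- int (r l)..int (r l)}. z (1 + int l + i))" for l and z :: "int \<Rightarrow> 'b"
  define path where "path \<omega> = (\<lambda>j\<in>I. Z j \<omega>)" for \<omega>
  have win: "1 + int l + j \<in> I" if "l < m - 1" "j \<in> {- int (r l)..int (r l)}" for l j
    using that k by (auto simp: I_def r_def)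
  have wm: "w l \<in> borel_measurable (PiM I (\<lambda>_. N))" if "l < m - 1" for l
    unfolding w_def using win[OF that]
    by (intro measurable_compose[OF _ v] measurable_restrict measurable_component_singleton) auto
  have path: "path \<in> measurable M (PiM I (\<lambda>_. N))" unfolding path_def by (intro measurable_restrict Z)
  define Y where "Y l = \<Delta> (1 + int l)" for l
  define W where "W l \<omega> = w l (path \<omega>)" for l \<omega>
  have W_eq: "W l \<omega> = v (r l) (\<lambda>i\<in>{- int (r l)..int (r l)}. Z (1 + int l + i) \<omega>)" if "l < m - 1" for l \<omega>
    unfolding W_def w_def path_def using win[OF that] by (intro arg_cong[of _ _ "v (r l)"]) (auto simp: restrict_def)
  have W[measurable]: "W l \<in> borel_measurable M" if "l < m - 1" for l
    unfolding W_def using measurable_compose[OF path wm[OF that]] .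
  have Yi: "integrable M (\<lambda>\<omega>. Y l \<omega> - W l \<omega>)" and Ye: "(\<integral>\<omega>. \<bar>Y l \<omega> - W l \<omega>\<bar> \<partial>M) \<le> a (r l)" if "l < m - 1" for l
    using vi[of "1 + int l" "r l"] va[of "1 + int l" "r l"] by (simp_all add: Y_def W_eq[OF that])
  have sum_e: "(\<Sum>l<m-1. a (r l)) \<le> A"
  proof -
    have "(\<Sum>l<m-1. a (r l)) = (\<Sum>j\<in>Suc ` {..<m-1}. a (k - j))" by (simp add: sum.reindex r_def)
    also have "\<dots> \<le> A" unfolding A_def using a0 by (intro sum_mono2) auto
    finally show ?thesis .
  qed
  have A0: "A \<ge> 0" unfolding A_def by (intro sum_nonneg a0)
  show ?thesis
  proof (cases "A = 0")
    \<comment> \<open>1-continuity speaks of positive thresholds only. Here the increments agree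
      almost surely with functions of the window, so the kernel of these functions has error 0, and
      the convention \<open>\<phi> 0 = 0\<close> makes the right side 0.\<close>
    case True
    have "AE \<omega> in M. \<forall>l\<in>{..<m-1}. Y l \<omega> = W l \<omega>"
    proof (subst AE_finite_all)
      show "\<forall>l\<in>{..<m-1}. AE \<omega> in M. Y l \<omega> = W l \<omega>"
      proof
        fix l assume l: "l \<in> {..<m-1}"
        have "a (r l) \<le> (\<Sum>l<m-1. a (r l))" using l a0 by (intro member_le_sum) auto
        then have "(\<integral>\<omega>. \<bar>Y l \<omega> - W l \<omega>\<bar> \<partial>M) \<le> 0" using sum_e True Ye[of l] l by simp
        then have "(\<integral>\<omega>. \<bar>Y l \<omega> - W l \<omega>\<bar> \<partial>M) = 0" by (intro antisym) auto
        then have "AE \<omega> in M. \<bar>Y l \<omega> - W l \<omega>\<bar> = 0"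
          using Yi[of l] l by (subst (asm) integral_nonneg_eq_0_iff_AE) auto
        then show "AE \<omega> in M. Y l \<omega> = W l \<omega>" by eventually_elim simp
      qed
    qed simp
    then have eq: "AE \<omega> in M. \<bar>h_op m (\<lambda>l. Y l \<omega>) i - h_op m (\<lambda>l. W l \<omega>) i\<bar> = 0"
    proof eventually_elim
      case (elim \<omega>)
      then have "h_op m (\<lambda>l. Y l \<omega>) i = h_op m (\<lambda>l. W l \<omega>) i" by (intro h_op_cong) auto
      then show ?case by simp
    qed
    have [measurable]: "(\<lambda>\<omega>. h_op m (\<lambda>l. Y l \<omega>) i) \<in> borel_measurable M" "(\<lambda>\<omega>. h_op m (\<lambda>l. W l \<omega>) i) \<in> borel_measurable M"
      using W \<Delta> by (auto intro!: measurable_h_op simp: Y_def)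
    have "(\<integral>\<omega>. \<bar>h_op m (\<lambda>l. Y l \<omega>) i - h_op m (\<lambda>l. W l \<omega>) i\<bar> \<partial>M) = (\<integral>\<omega>. 0 \<partial>M)"
      using eq by (intro integral_cong_AE) auto
    then have "(\<integral>\<omega>. \<bar>h_op m (\<lambda>l. Y l \<omega>) i - h_op m (\<lambda>l. w l (path \<omega>)) i\<bar> \<partial>M) \<le> \<phi> (2 * sqrt A) + (real m + 1) * sqrt A"
      using True cont by (simp add: W_def one_continuous_def)
    moreover have "(\<lambda>z. h_op m (\<lambda>l. w l z) i) \<in> borel_measurable (PiM I (\<lambda>_. N))"
      by (intro measurable_h_op wm)
    ultimately show ?thesis
      unfolding I_def path_def Y_def by (intro bexI[of _ "\<lambda>z. h_op m (\<lambda>l. w l z) i"]) (auto simp: h_op_bounds)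
  next
    case False
    with A0 have "A > 0" by simp
    \<comment> \<open>Two points of a cell differ by at most \<open>A\<close> in each coordinate, so
      discretization costs no more than a multiple of the approximation error.\<close>
    define \<kappa>' where "\<kappa>' z = to_nat (map (\<lambda>l. \<lfloor>w l z / A\<rfloor>) [0..<m-1])" for z
    define \<kappa> where "\<kappa> \<omega> = \<kappa>' (path \<omega>)" for \<omega>
    define h where "h \<omega> = h_op m (\<lambda>l. Y l \<omega>) i" for \<omega>
    have "(\<lambda>z. map (\<lambda>l. \<lfloor>w l z / A\<rfloor>) [0..<m-1]) \<in> measurable (PiM I (\<lambda>_. N)) (count_space UNIV)"
      by (rule measurable_map_floor) (intro borel_measurable_divide wm borel_measurable_const)
    then have \<kappa>'m: "\<kappa>' \<in> measurable (PiM I (\<lambda>_. N)) (count_space UNIV)"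
      unfolding \<kappa>'_def by (rule measurable_compose) simp
    have \<kappa>m: "\<kappa> \<in> measurable M (count_space UNIV)"
      unfolding \<kappa>_def by (rule measurable_compose[OF path \<kappa>'m])
    have hm: "h \<in> borel_measurable M" unfolding h_def using \<Delta> by (intro measurable_h_op) (simp add: Y_def)
    have cell: "\<bar>W l \<omega> - W l \<omega>'\<bar> \<le> A" if "\<kappa> \<omega> = \<kappa> \<omega>'" "l < m - 1" for \<omega> \<omega>' l
    proof -
      have "map (\<lambda>l. \<lfloor>W l \<omega> / A\<rfloor>) [0..<m-1] = map (\<lambda>l. \<lfloor>W l \<omega>' / A\<rfloor>) [0..<m-1]"
        using that(1) by (simp add: \<kappa>_def \<kappa>'_def W_def)
      then have "\<lfloor>W l \<omega> / A\<rfloor> = \<lfloor>W l \<omega>' / A\<rfloor>" using that(2) by simp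
      then have "\<bar>W l \<omega> / A - W l \<omega>' / A\<bar> \<le> 1" by linarith
      then show ?thesis using \<open>A > 0\<close> by (simp add: pos_divide_le_eq abs_divide flip: diff_divide_distrib)
    qed
    have "(\<integral>\<omega>. \<bar>h_op m (\<lambda>l. Y l \<omega>) i - cell_average \<kappa> (\<lambda>\<omega>. h_op m (\<lambda>l. Y l \<omega>) i) (\<kappa> \<omega>)\<bar> \<partial>M)
      \<le> \<phi> (2 * sqrt A) + (2 * (\<Sum>l<m-1. a (r l)) + real (m - 1) * A) / (2 * sqrt A)"
    proof (rule one_continuous_cell_error[where W = W])
      show "one_continuous m (distr M (PiM {..<m-1} (\<lambda>_. borel)) (\<lambda>\<omega>. \<lambda>l\<in>{..<m-1}. Y l \<omega>)) \<phi>"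
        using cont by (simp add: Y_def)
    qed (use \<kappa>m \<Delta> Yi Ye cell \<open>A > 0\<close> i in \<open>auto simp: Y_def\<close>)
    also have "(2 * (\<Sum>l<m-1. a (r l)) + real (m - 1) * A) / (2 * sqrt A) \<le> ((real m + 1) * A) / (2 * sqrt A)"
    proof (rule divide_right_mono)
      have "real (m - 1) * A \<le> real m * A - A \<or> m = 0" by (cases m) (auto simp: algebra_simps)
      moreover have "A \<ge> 0" "2 * (\<Sum>l<m-1. a (r l)) \<le> 2 * A" using sum_e \<open>A > 0\<close> by auto
      moreover have "(\<Sum>l<m-1. a (r l)) \<le> 0" if "m = 0" using that by simp
      ultimately show "2 * (\<Sum>l<m-1. a (r l)) + real (m - 1) * A \<le> (real m + 1) * A"
        by (auto simp: algebra_simps)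
    qed (use \<open>A > 0\<close> in auto)
    also have "((real m + 1) * A) / (2 * sqrt A) = (real m + 1) / 2 * sqrt A"
    proof -
      have "(real m + 1) * A / (2 * sqrt A) = (real m + 1) / 2 * (A / sqrt A)" by simp
      then show ?thesis using \<open>A > 0\<close> by (simp add: real_div_sqrt)
    qed
    also have "\<dots> \<le> (real m + 1) * sqrt A" using \<open>A > 0\<close> by (intro mult_right_mono) auto
    finally have "(\<integral>\<omega>. \<bar>h \<omega> - cell_average \<kappa> h (\<kappa>' (path \<omega>))\<bar> \<partial>M) \<le> \<phi> (2 * sqrt A) + (real m + 1) * sqrt A"
      by (simp add: \<kappa>_def[symmetric] h_def[abs_def])
    moreover have "(\<lambda>z. cell_average \<kappa> h (\<kappa>' z)) \<in> borel_measurable (PiM I (\<lambda>_. N))"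
      by (rule measurable_compose[OF \<kappa>'m]) simp
    moreover have "0 \<le> cell_average \<kappa> h c \<and> cell_average \<kappa> h c \<le> 1" for c
      using cell_average_bounds[OF \<kappa>m hm] by (auto simp: h_def h_op_bounds)
    ultimately show ?thesis
      unfolding I_def path_def h_def Y_def
      by (intro bexI[of _ "\<lambda>z. cell_average \<kappa> h (\<kappa>' z)"]) (auto simp: h_def[abs_def] Y_def)
  qed
qed

section \<open>Summability of the window errors and the resulting cubic rate\<close>

lemma sqrt_sum_le_sum_sqrt:
  fixes a :: "'i \<Rightarrow> real"
  assumes "\<And>i. i \<in> I \<Longrightarrow> a i \<ge> 0"
  shows "sqrt (\<Sum>i\<in>I. a i) \<le> (\<Sum>i\<in>I. sqrt (a i))"
  using assms
proof (induction I rule: infinite_finite_induct)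
  case (insert x F)
  have "sqrt (\<Sum>i\<in>insert x F. a i) \<le> sqrt (a x) + sqrt (\<Sum>i\<in>F. a i)"
    using insert by (simp add: sqrt_add_le_add_sqrt sum_nonneg)
  also have "\<dots> \<le> (\<Sum>i\<in>insert x F. sqrt (a i))" using insert by simp
  finally show ?case .
qed auto

text \<open>In the window sums the term a_(k-j) carries the weight k^2 instead of (k-j)^2. The shift
  is absorbed by (x + j)^2 <= 2 x^2 + 2 j^2, where \<open>c\<close> itself is summable because the
  weight is at least 1 from index 1 on.\<close>

lemma summable_shifted_square_weight:
  fixes c :: "nat \<Rightarrow> real"
  assumes c: "\<And>k. c k \<ge> 0" and s: "summable (\<lambda>k. real k ^ 2 * c k)"
  shows "summable (\<lambda>n. real (n + s + j) ^ 2 * c (n + s))"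
proof -
  have "summable c"
  proof (rule summable_comparison_test)
    have "norm (c k) \<le> real k ^ 2 * c k" if "k \<ge> 1" for k
    proof -
      have "1 * c k \<le> real k ^ 2 * c k" using that c by (intro mult_right_mono) auto
      then show ?thesis using c[of k] by simp
    qed
    then show "\<exists>N. \<forall>k\<ge>N. norm (c k) \<le> real k ^ 2 * c k" by blast
  qed (rule s)
  then have "summable (\<lambda>k. 2 * (real k ^ 2 * c k) + 2 * real j ^ 2 * c k)"
    using s by (intro summable_add summable_mult)
  then have "summable (\<lambda>n. 2 * (real (n + s) ^ 2 * c (n + s)) + 2 * real j ^ 2 * c (n + s))"
    by (rule summable_ignore_initial_segment)
  then show ?thesis
  proof (rule summable_comparison_test'[of _ 0])
    fix n
    have "real (n + s + j) ^ 2 \<le> 2 * real (n + s) ^ 2 + 2 * real j ^ 2"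
      using sum_squares_bound[of "real (n + s)" "real j"] by (simp add: power2_sum)
    then have "real (n + s + j) ^ 2 * c (n + s) \<le> (2 * real (n + s) ^ 2 + 2 * real j ^ 2) * c (n + s)"
      using c by (rule mult_right_mono)
    then show "norm (real (n + s + j) ^ 2 * c (n + s)) \<le> 2 * (real (n + s) ^ 2 * c (n + s)) + 2 * real j ^ 2 * c (n + s)"
      using c[of "n + s"] by (simp add: distrib_right mult.assoc)
  qed
qed

lemma summable_sqrt_window_sum:
  fixes a :: "nat \<Rightarrow> real"
  assumes a: "\<And>k. a k \<ge> 0" and s: "summable (\<lambda>k. real k ^ 2 * sqrt (a k))"
  shows "summable (\<lambda>n. real (n + r) ^ 2 * sqrt (\<Sum>j\<le>r. a (n + r - j)))"
proof -
  have "summable (\<lambda>n. \<Sum>j\<le>r. real (n + r) ^ 2 * sqrt (a (n + r - j)))"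
  proof (rule summable_sum)
    fix j assume "j \<in> {..r}"
    then have "(\<lambda>n. real (n + r) ^ 2 * sqrt (a (n + r - j))) = (\<lambda>n. real (n + (r - j) + j) ^ 2 * sqrt (a (n + (r - j))))"
      by auto
    then show "summable (\<lambda>n. real (n + r) ^ 2 * sqrt (a (n + r - j)))"
      using summable_shifted_square_weight[of "\<lambda>k. sqrt (a k)" "r - j" j] a s by simp
  qed
  then show ?thesis
  proof (rule summable_comparison_test'[of _ 0])
    fix n
    have "real (n + r) ^ 2 * sqrt (\<Sum>j\<le>r. a (n + r - j)) \<le> real (n + r) ^ 2 * (\<Sum>j\<le>r. sqrt (a (n + r - j)))"
      using a by (intro mult_left_mono sqrt_sum_le_sum_sqrt) auto
    then show "norm (real (n + r) ^ 2 * sqrt (\<Sum>j\<le>r. a (n + r - j))) \<le> (\<Sum>j\<le>r. real (n + r) ^ 2 * sqrt (a (n + r - j)))"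
      using a by (simp add: sum_distrib_left sum_nonneg abs_mult)
  qed
qed

lemma op_enum_inj:
  assumes "i < fact m" "j < fact m" "op_enum m i = op_enum m j" shows "i = j"
  using assms unfolding op_enum_def
  by (subst (asm) nth_eq_iff_index_eq) (auto simp: card_permutations_of_set)

text \<open>The sums of increments telescope to the path minus its value at \<open>t\<close>, and
  subtracting a constant does not affect the order.\<close>

lemma op_delta_increments:
  "op_delta m (\<lambda>l. X (t + 1 + int l) - X (t + 1 + int l - 1)) = ord_pattern m (\<lambda>j. X (t + int j))"
proof -
  have "(\<Sum>l<j. X (t + 1 + int l) - X (t + 1 + int l - 1)) = X (t + int j) - X t" for j
    by (induction j) (simp_all add: add_ac)
  then show ?thesis unfolding op_delta_def by (intro ord_pattern_cong) (auto simp: order_relation_def)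
qed

lemma kernel_cubic_approximation:
  assumes M: "prob_space M" and oa: "one_approx_functional M N Z \<Delta> a"
    and \<Delta>: "\<And>t. \<Delta> t \<in> borel_measurable M"
    and cont: "one_continuous m (distr M (PiM {..<m-1} (\<lambda>_. borel)) (\<lambda>\<omega>. \<lambda>l\<in>{..<m-1}. \<Delta> (1 + int l) \<omega>)) \<phi>"
    and sa: "summable (\<lambda>k. real k ^ 2 * sqrt (a k))"
    and s\<phi>: "summable (\<lambda>j. let k = j + (m - 1) in real k ^ 2 * \<phi> (2 * sqrt (\<Sum>i\<le>m-1. a (k - i))))"
  shows "\<exists>D. \<forall>i<fact m. \<forall>l. \<exists>k\<le>l. \<exists>g\<in>borel_measurable (PiM {- int k..int k} (\<lambda>_. N)).
    (\<forall>z. 0 \<le> g z \<and> g z \<le> 1) \<and>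
    (\<integral>\<omega>. \<bar>h_op m (\<lambda>l. \<Delta> (1 + int l) \<omega>) i - g (\<lambda>j\<in>{- int k..int k}. Z j \<omega>)\<bar> \<partial>M) \<le> D / (real l + 1) ^ 3"
proof -
  interpret prob_space M by fact
  have a0: "a k \<ge> 0" for k
    using oa unfolding one_approx_functional_def
    by (meson Bochner_Integration.integral_nonneg abs_ge_zero order_trans)
  define A where "A k = (\<Sum>j\<le>m-1. a (k - j))" for k
  have A0: "A k \<ge> 0" for k unfolding A_def by (intro sum_nonneg a0)
  have \<phi>0: "\<phi> x \<ge> 0" if "x \<ge> 0" for x
    using cont that by (cases "x = 0") (auto simp: one_continuous_def less_imp_le)
  \<comment> \<open>Below m - 1 the window cannot hold a whole pattern; there the zero function
    serves as approximant with error at most 1. Finitely many terms do not affect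
    summability.\<close>
  define b where "b k = (if k < m - 1 then 1 else \<phi> (2 * sqrt (A k)) + (real m + 1) * sqrt (A k))" for k
  have b0: "b k \<ge> 0" for k using A0 \<phi>0 by (auto simp: b_def)
  have "summable (\<lambda>n. real (n + (m - 1)) ^ 2 * \<phi> (2 * sqrt (A (n + (m - 1)))) + (real m + 1) * (real (n + (m - 1)) ^ 2 * sqrt (A (n + (m - 1)))))"
    unfolding A_def using s\<phi> summable_sqrt_window_sum[OF a0 sa, of "m - 1"]
    by (intro summable_add summable_mult) (simp_all add: Let_def)
  then have "summable (\<lambda>n. real (n + (m - 1)) ^ 2 * b (n + (m - 1)))"
    by (simp add: b_def algebra_simps)
  then have "summable (\<lambda>k. real k ^ 2 * b k)" by (rule summable_iff_shift[THEN iffD1])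
  then obtain D where D: "\<And>l. \<exists>k\<le>l. b k \<le> D / (real l + 1) ^ 3" using running_min_cubic_rate[of b] b0 by blast
  have "\<exists>g\<in>borel_measurable (PiM {- int k..int k} (\<lambda>_. N)). (\<forall>z. 0 \<le> g z \<and> g z \<le> 1) \<and>
    (\<integral>\<omega>. \<bar>h_op m (\<lambda>l. \<Delta> (1 + int l) \<omega>) i - g (\<lambda>j\<in>{- int k..int k}. Z j \<omega>)\<bar> \<partial>M) \<le> b k" if i: "i < fact m" for i k
  proof (cases "k < m - 1")
    case True
    have [measurable]: "(\<lambda>\<omega>. h_op m (\<lambda>l. \<Delta> (1 + int l) \<omega>) i) \<in> borel_measurable M"
      by (intro measurable_h_op \<Delta>)
    have "(\<integral>\<omega>. \<bar>h_op m (\<lambda>l. \<Delta> (1 + int l) \<omega>) i\<bar> \<partial>M) \<le> (\<integral>\<omega>. 1 \<partial>M)"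
      by (intro integral_mono integrable_bounded[of _ 1]) (auto simp: h_op_bounds)
    then show ?thesis using True by (intro bexI[of _ "\<lambda>_. 0"]) (auto simp: b_def prob_space)
  next
    case False
    then show ?thesis using kernel_window_approximation[OF M oa \<Delta> cont _ i, of k] by (simp add: b_def A_def)
  qed
  then show ?thesis using D by (meson order_trans)
qed

section \<open>The limit theorem for ordinal pattern frequencies\<close>

theorem theorem2p3:
  fixes M :: "'a measure" and N :: "'b measure" and Z :: "int \<Rightarrow> 'a \<Rightarrow> 'b"
    and X :: "int \<Rightarrow> 'a \<Rightarrow> real" and m :: nat
    and a :: "nat \<Rightarrow> real" and \<phi> :: "real \<Rightarrow> real"
    and enum :: "'k::finite \<Rightarrow> nat"
  defines "\<Delta> \<equiv> (\<lambda>t \<omega>. X t \<omega> - X (t - 1) \<omega>)"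
  defines "OP \<equiv> (\<lambda>t \<omega>. ord_pattern m (\<lambda>j. X (t + int j) \<omega>))"
  defines "p \<equiv> (\<lambda>i. measure M {\<omega> \<in> space M. OP 0 \<omega> = op_enum m i})"
  defines "pp \<equiv> (\<lambda>i j (k::nat). measure M
              {\<omega> \<in> space M. OP 0 \<omega> = op_enum m i \<and> OP (int k) \<omega> = op_enum m j})"
  defines "phat \<equiv> (\<lambda>(n::nat) \<omega> i. (1 / real n) *
              (\<Sum>t=1..n. h_op m (\<lambda>l. \<Delta> (int t + 1 + int l) \<omega>) i))"
  defines "\<sigma> \<equiv> (\<lambda>i j. p i * ((if i = j then 1 else 0) - p j) +
              (\<Sum>k. pp i j (Suc k) + pp j i (Suc k) - 2 * p i * p j))"
  assumes "prob_space M"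
    and "m \<ge> 2"
    and "\<forall>t. X t \<in> borel_measurable M"
    and "stationary_process M borel \<Delta>"
    and "\<forall>j<m. \<forall>k<m. j \<noteq> k \<longrightarrow> measure M {\<omega> \<in> space M. X (int j) \<omega> = X (int k) \<omega>} = 0"
    and "one_approx_functional M N Z \<Delta> a"
    and "absolutely_regular M N Z"
    and "summable (\<lambda>k. real k ^ 2 * (sqrt (a k) + beta_coeff M N Z k))"
    and "one_continuous m
           (distr M (PiM {..<m-1} (\<lambda>_. borel)) (\<lambda>\<omega>. \<lambda>l\<in>{..<m-1}. \<Delta> (1 + int l) \<omega>)) \<phi>"
    and "summable (\<lambda>j. let k = j + (m - 1) in
           real k ^ 2 * \<phi> (2 * sqrt (\<Sum>i\<le>m-1. a (k - i))))"
    and "bij_betw enum UNIV {..<fact m}"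
  shows "(\<forall>i<fact m. \<forall>j<fact m.
            summable (\<lambda>k. \<bar>pp i j (Suc k) + pp j i (Suc k) - 2 * p i * p j\<bar>))
       \<and> converges_in_distr_normal M
           (\<lambda>n \<omega>. \<chi> \<kappa>. sqrt (real n) * (phat n \<omega> (enum \<kappa>) - p (enum \<kappa>)))
           (\<lambda>\<kappa> \<iota>. \<sigma> (enum \<kappa>) (enum \<iota>))"
proof -
  interpret prob_space M by fact
  note X = assms(9) and oa = assms(12) and cont = assms(15)
  have \<Delta>m: "\<Delta> t \<in> borel_measurable M" for t unfolding \<Delta>_def using X by (intro borel_measurable_diff) auto
  have st: "stationary_process M N Z" and Z: "\<And>t. Z t \<in> measurable M N"
    using oa by (auto simp: one_approx_functional_def functional_of_def)
  obtain f where f: "f \<in> borel_measurable (PiM UNIV (\<lambda>_::int. N))"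
    and \<Delta>f: "\<And>t \<omega>. \<omega> \<in> space M \<Longrightarrow> \<Delta> t \<omega> = f (\<lambda>k. Z (t + k) \<omega>)"
    using oa by (auto simp: one_approx_functional_def functional_of_def)
  have a0: "a k \<ge> 0" for k
    using oa unfolding one_approx_functional_def
    by (meson Bochner_Integration.integral_nonneg abs_ge_zero order_trans)
  have \<beta>0: "beta_coeff M N Z k \<ge> 0" for k by (rule beta_coeff_nonneg[OF prob_space_axioms Z])
  have sa: "summable (\<lambda>k. real k ^ 2 * sqrt (a k))"
    by (rule summable_comparison_test'[OF assms(14)]) (use a0 \<beta>0 in \<open>auto simp: distrib_left\<close>)
  have s\<beta>: "summable (\<lambda>k. real k ^ 2 * beta_coeff M N Z k)"
    by (rule summable_comparison_test'[OF assms(14)]) (use a0 \<beta>0 in \<open>auto simp: distrib_left\<close>)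
  obtain C where C: "\<And>k. \<exists>i\<le>k. beta_coeff M N Z i \<le> C / (real k + 1) ^ 3"
    using running_min_cubic_rate[OF \<beta>0 s\<beta>] by blast
  interpret B: beta_mixing_rate M N Z C
    using Z C by unfold_locales auto

  define H where "H i t \<omega> = h_op m (\<lambda>l. \<Delta> (t + 1 + int l) \<omega>) i" for i t \<omega>
  have Hm[measurable]: "H i t \<in> borel_measurable M" for i t
    unfolding H_def by (intro measurable_h_op \<Delta>m)
  have H01: "0 \<le> H i t \<omega>" "H i t \<omega> \<le> 1" for i t \<omega> by (simp_all add: H_def h_op_bounds)
  have H_OP: "H i t \<omega> = of_bool (OP t \<omega> = op_enum m i)" for i t \<omega>
    unfolding H_def h_op_def OP_def \<Delta>_def using op_delta_increments[of m "\<lambda>s. X s \<omega>" t] by simp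
  \<comment> \<open>The kernel at time 0 as a function of the whole path of \<open>Z\<close>. The
    kernel at time \<open>t\<close> is the same function of the shifted path, so each stationarity
    claim below is one application of \<open>shift\<close>.\<close>
  define hh where "hh i z = h_op m (\<lambda>l. f (\<lambda>j. z (1 + int l + j))) i" for i and z :: "int \<Rightarrow> 'b"
  have shift_m: "(\<lambda>z j. z (s + j)) \<in> measurable (PiM UNIV (\<lambda>_. N)) (PiM UNIV (\<lambda>_. N))" for s :: int
    using measurable_restrict[of UNIV "\<lambda>j z. z (s + j)" "PiM UNIV (\<lambda>_. N)" "\<lambda>_. N",
        OF measurable_component_singleton] by (simp add: restrict_def)
  have hhm: "hh i \<in> borel_measurable (PiM UNIV (\<lambda>_. N))" for i
    unfolding hh_def by (intro measurable_h_op measurable_compose[OF shift_m f])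
  have hhs: "(\<lambda>z. hh i (\<lambda>j. z (s + j))) \<in> borel_measurable (PiM UNIV (\<lambda>_. N))" for i s
    by (rule measurable_compose[OF shift_m hhm])
  have H_hh: "H i t \<omega> = hh i (\<lambda>j. Z (t + j) \<omega>)" if "\<omega> \<in> space M" for i t \<omega>
    unfolding H_def hh_def using \<Delta>f[OF that] by (simp add: add.assoc)
  note shift = stationary_process_integral_shift[OF st Z prob_space_axioms]

  have H_mean: "(\<integral>\<omega>. H i t \<omega> \<partial>M) = p i" for i t
  proof -
    have "(\<integral>\<omega>. H i t \<omega> \<partial>M) = (\<integral>\<omega>. H i 0 \<omega> \<partial>M)"
      using shift[OF hhm, of i t] by (simp add: H_hh cong: Bochner_Integration.integral_cong)
    also have "\<dots> = (\<integral>\<omega>. indicator {\<omega> \<in> space M. OP 0 \<omega> = op_enum m i} \<omega> \<partial>M)"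
      by (intro Bochner_Integration.integral_cong) (auto simp: H_OP)
    also have "\<dots> = p i" by (simp add: p_def Int_absorb2)
    finally show ?thesis .
  qed
  have H_second: "(\<integral>\<omega>. H i s \<omega> * H j (s + int k) \<omega> \<partial>M) = pp i j k" for i j s k
  proof -
    have "(\<lambda>z. hh i z * hh j (\<lambda>u. z (int k + u))) \<in> borel_measurable (PiM UNIV (\<lambda>_. N))"
      by (intro borel_measurable_times hhm hhs)
    from shift[OF this, of s] have "(\<integral>\<omega>. H i s \<omega> * H j (s + int k) \<omega> \<partial>M) = (\<integral>\<omega>. H i 0 \<omega> * H j (int k) \<omega> \<partial>M)"
      by (simp add: H_hh add.assoc cong: Bochner_Integration.integral_cong)
    also have "\<dots> = (\<integral>\<omega>. indicator {\<omega> \<in> space M. OP 0 \<omega> = op_enum m i \<and> OP (int k) \<omega> = op_enum m j} \<omega> \<partial>M)"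
      by (intro Bochner_Integration.integral_cong) (auto simp: H_OP)
    also have "\<dots> = pp i j k" by (simp add: pp_def Int_absorb2)
    finally show ?thesis .
  qed

  obtain D where D: "\<And>i l. i < fact m \<Longrightarrow> \<exists>k\<le>l. \<exists>g\<in>borel_measurable (PiM {- int k..int k} (\<lambda>_. N)).
    (\<forall>z. 0 \<le> g z \<and> g z \<le> 1) \<and>
    (\<integral>\<omega>. \<bar>h_op m (\<lambda>l. \<Delta> (1 + int l) \<omega>) i - g (\<lambda>j\<in>{- int k..int k}. Z j \<omega>)\<bar> \<partial>M) \<le> D / (real l + 1) ^ 3"
    using kernel_cubic_approximation[OF prob_space_axioms oa \<Delta>m cont sa assms(16)] by blast
  have ex: "\<exists>V. \<forall>t. V t \<in> borel_measurable (gen_sigma M N Z {t - int l..t + int l}) \<and>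
       (\<forall>\<omega>\<in>space M. \<bar>V t \<omega>\<bar> \<le> 1) \<and> (\<integral>\<omega>. \<bar>H i t \<omega> - V t \<omega>\<bar> \<partial>M) \<le> D / (real l + 1) ^ 3" if i: "i < fact m" for i l
  proof -
    obtain k g where kl: "k \<le> l" and g: "g \<in> borel_measurable (PiM {- int k..int k} (\<lambda>_. N))"
      and g01: "\<And>z. 0 \<le> g z \<and> g z \<le> 1"
      and ge: "(\<integral>\<omega>. \<bar>h_op m (\<lambda>l. \<Delta> (1 + int l) \<omega>) i - g (\<lambda>j\<in>{- int k..int k}. Z j \<omega>)\<bar> \<partial>M) \<le> D / (real l + 1) ^ 3"
      using D[OF i, of l] by blast
    \<comment> \<open>A radius k <= l is enough, since functions of the smaller window are
      measurable for the larger one.\<close>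
    define V where "V t \<omega> = g (\<lambda>j\<in>{- int k..int k}. Z (t + j) \<omega>)" for t \<omega>
    have "V t \<in> borel_measurable (gen_sigma M N Z {t - int l..t + int l})" for t
      unfolding V_def using kl by (intro measurable_compose[OF measurable_gen_sigma_window g] Z) auto
    moreover have "\<bar>V t \<omega>\<bar> \<le> 1" for t \<omega> using g01 by (simp add: V_def)
    moreover have "(\<integral>\<omega>. \<bar>H i t \<omega> - V t \<omega>\<bar> \<partial>M) \<le> D / (real l + 1) ^ 3" for t
    proof -
      have "(\<lambda>z. \<bar>hh i z - g (restrict z {- int k..int k})\<bar>) \<in> borel_measurable (PiM UNIV (\<lambda>_. N))"
        by (intro borel_measurable_abs borel_measurable_diff hhm measurable_compose[OF measurable_restrict_subset g]) auto
      from shift[OF this, of t] have "(\<integral>\<omega>. \<bar>H i t \<omega> - V t \<omega>\<bar> \<partial>M) = (\<integral>\<omega>. \<bar>H i 0 \<omega> - g (\<lambda>j\<in>{- int k..int k}. Z j \<omega>)\<bar> \<partial>M)"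
        by (simp add: H_hh V_def cong: Bochner_Integration.integral_cong)
      then show ?thesis using ge by (simp add: H_def)
    qed
    ultimately show ?thesis by blast
  qed
  have enum_lt: "enum \<kappa> < fact m" for \<kappa> using assms(17) by (auto simp: bij_betw_def)
  have "\<exists>V. B.approximable (H (enum \<kappa>)) V 1 D" for \<kappa>
  proof -
    have "\<forall>l. \<exists>V. \<forall>t. V t \<in> borel_measurable (gen_sigma M N Z {t - int l..t + int l}) \<and>
       (\<forall>\<omega>\<in>space M. \<bar>V t \<omega>\<bar> \<le> 1) \<and> (\<integral>\<omega>. \<bar>H (enum \<kappa>) t \<omega> - V t \<omega>\<bar> \<partial>M) \<le> D / (real l + 1) ^ 3"
      using ex[OF enum_lt] by blast
    from choice[OF this] obtain V where "\<forall>l t. V l t \<in> borel_measurable (gen_sigma M N Z {t - int l..t + int l}) \<and>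
       (\<forall>\<omega>\<in>space M. \<bar>V l t \<omega>\<bar> \<le> 1) \<and> (\<integral>\<omega>. \<bar>H (enum \<kappa>) t \<omega> - V l t \<omega>\<bar> \<partial>M) \<le> D / (real l + 1) ^ 3" by blast
    then have "B.approximable (H (enum \<kappa>)) V 1 D" unfolding B.approximable_def using H01 Hm by auto
    then show ?thesis by blast
  qed
  then obtain V where V: "\<And>\<kappa>. B.approximable (H (enum \<kappa>)) (V \<kappa>) 1 D" by metis
  interpret F: vector_mixing_functional M N Z C "\<lambda>\<kappa>. H (enum \<kappa>)" V D "\<lambda>\<kappa>. p (enum \<kappa>)" "\<lambda>\<kappa> \<iota>. pp (enum \<kappa>) (enum \<iota>)"
  proof unfold_locales
    fix \<tau> :: "'k \<Rightarrow> real" and n :: nat and s :: int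
    define G where "G z = cis (\<Sum>t<n. \<Sum>\<kappa>\<in>UNIV. \<tau> \<kappa> * (hh (enum \<kappa>) (\<lambda>j. z (int t + j)) - p (enum \<kappa>)))" for z
    have "G \<in> borel_measurable (PiM UNIV (\<lambda>_. N))" unfolding G_def
      by (intro measurable_compose[OF _ cis_borel_measurable] borel_measurable_sum borel_measurable_times borel_measurable_diff hhs) auto
    from shift[OF this, of s]
    show "(\<integral>\<omega>. cis (\<Sum>t<n. \<Sum>\<kappa>\<in>UNIV. \<tau> \<kappa> * (H (enum \<kappa>) (s + int t) \<omega> - p (enum \<kappa>))) \<partial>M)
      = (\<integral>\<omega>. cis (\<Sum>t<n. \<Sum>\<kappa>\<in>UNIV. \<tau> \<kappa> * (H (enum \<kappa>) (int t) \<omega> - p (enum \<kappa>))) \<partial>M)"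
      by (simp add: G_def H_hh add.assoc cong: Bochner_Integration.integral_cong)
  qed (rule V H_mean H_second)+

  have d_Suc: "F.d \<kappa> \<iota> k + F.d \<iota> \<kappa> k = pp (enum \<kappa>) (enum \<iota>) k + pp (enum \<iota>) (enum \<kappa>) k - 2 * p (enum \<kappa>) * p (enum \<iota>)" for \<kappa> \<iota> k
    by (simp add: F.d_def)
  have "summable (\<lambda>k. \<bar>pp i j (Suc k) + pp j i (Suc k) - 2 * p i * p j\<bar>)" if "i < fact m" "j < fact m" for i j
  proof -
    have "i \<in> range enum" "j \<in> range enum" using that assms(17) by (simp_all add: bij_betw_def)
    then obtain \<kappa> \<iota> where e: "enum \<kappa> = i" "enum \<iota> = j" by auto
    have "summable (\<lambda>k. \<bar>F.d \<kappa> \<iota> (Suc k)\<bar> + \<bar>F.d \<iota> \<kappa> (Suc k)\<bar>)"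
      by (intro summable_add summable_Suc_iff[THEN iffD2] F.summable_cross_covariance)
    then have "summable (\<lambda>k. \<bar>F.d \<kappa> \<iota> (Suc k) + F.d \<iota> \<kappa> (Suc k)\<bar>)"
      by (rule summable_comparison_test'[of _ 0]) simp
    then show ?thesis by (simp add: d_Suc e)
  qed
  moreover have "F.S = (\<lambda>\<kappa> \<iota>. \<sigma> (enum \<kappa>) (enum \<iota>))"
  proof (intro ext)
    fix \<kappa> \<iota>
    \<comment> \<open>At lag 0 distinct patterns exclude each other, which turns the lag-0
      covariance into the multinomial term with the Kronecker delta.\<close>
    have "pp (enum \<kappa>) (enum \<iota>) 0 = (if enum \<kappa> = enum \<iota> then p (enum \<kappa>) else 0)"
    proof (cases "enum \<kappa> = enum \<iota>")
      case False
      then have "{\<omega> \<in> space M. OP 0 \<omega> = op_enum m (enum \<kappa>) \<and> OP (int 0) \<omega> = op_enum m (enum \<iota>)} = {}"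
        using op_enum_inj[OF enum_lt enum_lt, of \<kappa> \<iota>] by auto
      then have "pp (enum \<kappa>) (enum \<iota>) 0 = measure M {}" unfolding pp_def by (simp only:)
      then show ?thesis using False by simp
    qed (simp add: pp_def p_def)
    then show "F.S \<kappa> \<iota> = \<sigma> (enum \<kappa>) (enum \<iota>)"
      by (simp add: F.S_def \<sigma>_def d_Suc F.d_def[of _ _ 0] algebra_simps)
  qed
  moreover have "F.Y = (\<lambda>n \<omega>. \<chi> \<kappa>. sqrt (real n) * (phat n \<omega> (enum \<kappa>) - p (enum \<kappa>)))"
  proof (intro ext)
    fix n \<omega>
    have "(\<Sum>t=1..n. h_op m (\<lambda>l. \<Delta> (int t + 1 + int l) \<omega>) i) = (\<Sum>t<n. H i (1 + int t) \<omega>)" for i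
      unfolding H_def by (rule sum.reindex_bij_witness[of _ Suc "\<lambda>t. t - 1"]) (auto simp: of_nat_diff)
    \<comment> \<open>For n = 0 both sides are 0; otherwise this is n / sqrt(n) = sqrt(n).\<close>
    then have "1 / sqrt (real n) * (\<Sum>t<n. H i (1 + int t) \<omega> - p i) = sqrt (real n) * (phat n \<omega> i - p i)" for i
      by (cases "n = 0") (simp_all add: phat_def sum_subtractf field_simps)
    then show "F.Y n \<omega> = (\<chi> \<kappa>. sqrt (real n) * (phat n \<omega> (enum \<kappa>) - p (enum \<kappa>)))"
      by (simp add: F.Y_def)
  qed
  ultimately show ?thesis using F.vector_clt by simp
qed

end
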